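(* Let $\Phi:[0,\infty]\to[0,\infty]$ be a non-decreasing convex function such that, for every measurable function $\mu:\mathbb{D}\to\mathbb{D}$ satisfying $\int_{\mathbb{D}}\Phi(K_\mu(z))\,dx\,dy<\infty$, the Beltrami equation $f_{\bar z}=\mu(z)f_z$ has a homeomorphic ACL solution in $\mathbb{D}$. Then there is $\delta>0$ such that $$\int_\delta^\infty \log\Phi(t)\,\frac{dt}{t^2}=\infty.$$
   Context: $\mathbb{D}=\{z\in\mathbb{C}:|z|<1\}$. $f_{\bar z}=(f_x+if_y)/2$, $f_z=(f_x-if_y)/2$, and $K_\mu(z)=\frac{1+|\mu(z)|}{1-|\mu(z)|}$. A homeomorphic ACL solution is a homeomorphism $f:\mathbb{D}\to\mathbb{C}$ which is ACL (absolutely continuous on almost all segments parallel to the sides of every closed axis-parallel rectangle in $\mathbb{D}$) and satisfies the equation a.e. *)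

theory Defs
  imports "HOL-Analysis.Analysis"
begin

definition unit_disc :: "complex set" where
  "unit_disc = ball 0 1"

definition abs_cont_on_interval :: "(real \<Rightarrow> complex) \<Rightarrow> real \<Rightarrow> real \<Rightarrow> bool" where
  "abs_cont_on_interval g a b \<longleftrightarrow>
     (\<forall>\<epsilon>>0. \<exists>\<delta>>0. \<forall>(n::nat) (l::nat \<Rightarrow> real) (r::nat \<Rightarrow> real).
        (\<forall>k<n. a \<le> l k \<and> l k \<le> r k \<and> r k \<le> b) \<longrightarrow>
        (\<forall>j<n. \<forall>k<n. j \<noteq> k \<longrightarrow> r j \<le> l k \<or> r k \<le> l j) \<longrightarrow>
        (\<Sum>k<n. r k - l k) < \<delta> \<longrightarrow>
        (\<Sum>k<n. norm (g (r k) - g (l k))) < \<epsilon>)"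

definition ACL_on :: "complex set \<Rightarrow> (complex \<Rightarrow> complex) \<Rightarrow> bool" where
  "ACL_on U f \<longleftrightarrow>
     (\<forall>a b c d. a \<le> b \<and> c \<le> d \<and> {z. a \<le> Re z \<and> Re z \<le> b \<and> c \<le> Im z \<and> Im z \<le> d} \<subseteq> U \<longrightarrow>
        (AE y in lborel. y \<in> {c..d} \<longrightarrow> abs_cont_on_interval (\<lambda>x. f (Complex x y)) a b) \<and>
        (AE x in lborel. x \<in> {a..b} \<longrightarrow> abs_cont_on_interval (\<lambda>y. f (Complex x y)) c d))"

text \<open>f satisfies the Beltrami equation f_zbar = mu f_z at z, where f_x, f_y are the
  partial derivatives and f_zbar = (f_x + i f_y)/2, f_z = (f_x - i f_y)/2.\<close>
definition beltrami_at :: "(complex \<Rightarrow> complex) \<Rightarrow> (complex \<Rightarrow> complex) \<Rightarrow> complex \<Rightarrow> bool" where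
  "beltrami_at \<mu> f z \<longleftrightarrow>
     (\<exists>fx fy. ((\<lambda>h::real. f (z + of_real h)) has_vector_derivative fx) (at 0) \<and>
             ((\<lambda>h::real. f (z + \<i> * of_real h)) has_vector_derivative fy) (at 0) \<and>
             (fx + \<i> * fy) / 2 = \<mu> z * ((fx - \<i> * fy) / 2))"

definition homeo_ACL_solution :: "(complex \<Rightarrow> complex) \<Rightarrow> (complex \<Rightarrow> complex) \<Rightarrow> bool" where
  "homeo_ACL_solution \<mu> f \<longleftrightarrow>
     (\<exists>g. homeomorphism unit_disc (f ` unit_disc) f g) \<and>
     ACL_on unit_disc f \<and>
     (AE z in lborel. z \<in> unit_disc \<longrightarrow> beltrami_at \<mu> f z)"

definition dilatation :: "(complex \<Rightarrow> complex) \<Rightarrow> complex \<Rightarrow> real" where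
  "dilatation \<mu> z = (1 + norm (\<mu> z)) / (1 - norm (\<mu> z))"

definition convex_ennreal_fun :: "(ennreal \<Rightarrow> ennreal) \<Rightarrow> bool" where
  "convex_ennreal_fun \<Phi> \<longleftrightarrow>
     (\<forall>x y (t::real). x < \<infinity> \<longrightarrow> y < \<infinity> \<longrightarrow> 0 \<le> t \<longrightarrow> t \<le> 1 \<longrightarrow>
        \<Phi> (ennreal t * x + ennreal (1 - t) * y) \<le> ennreal t * \<Phi> x + ennreal (1 - t) * \<Phi> y)"

text \<open>Positive and negative parts of log Phi(t) (with log 0 = -\<infinity>, log \<infinity> = \<infinity>).\<close>
definition log_pos :: "(ennreal \<Rightarrow> ennreal) \<Rightarrow> real \<Rightarrow> ennreal" where
  "log_pos \<Phi> t = (if \<Phi> (ennreal t) = \<infinity> then \<infinity>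
                   else ennreal (max 0 (ln (enn2real (\<Phi> (ennreal t))))))"

definition log_neg :: "(ennreal \<Rightarrow> ennreal) \<Rightarrow> real \<Rightarrow> ennreal" where
  "log_neg \<Phi> t = (if \<Phi> (ennreal t) = 0 then \<infinity>
                   else ennreal (max 0 (- ln (enn2real (\<Phi> (ennreal t))))))"

text \<open>The (extended Lebesgue) integral of log Phi(t) / t^2 over [\<delta>,\<infinity>) equals +\<infinity>:
  positive part integral infinite, negative part integral finite.\<close>
definition log_integral_infinite :: "(ennreal \<Rightarrow> ennreal) \<Rightarrow> real \<Rightarrow> bool" where
  "log_integral_infinite \<Phi> \<delta> \<longleftrightarrow>
     (\<integral>\<^sup>+ t \<in> {\<delta>..}. log_pos \<Phi> t * ennreal (1 / t\<^sup>2) \<partial>lborel) = \<infinity> \<and>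
     (\<integral>\<^sup>+ t \<in> {\<delta>..}. log_neg \<Phi> t * ennreal (1 / t\<^sup>2) \<partial>lborel) < \<infinity>"

end

theory Submission
  imports Defs
begin

text \<open>
  If no \<open>\<delta>\<close> works, then \<open>\<Phi>\<close> is finite on the reals and \<open>\<Sum>j. log\<^sup>+ \<Phi>(2\<^sup>j) / 2\<^sup>j\<close> converges.
  This leaves room for a radial \<open>K \<ge> 1\<close>, equal to \<open>2\<^sup>j\<close> on a ring shrinking fast enough, such that
  \<open>\<Phi>(K)\<close>, \<open>K\<close> and \<open>1 / (|z|\<^sup>2 K)\<close> are all integrable over the disc. The coefficient
  \<open>\<mu>(z) = - (K - 1) / (K + 1) * z / cnj z\<close> has dilatation \<open>K\<close> and belongs to a radial stretching that opens
  the origin into a disc, so it should have no homeomorphic solution.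

  To see this directly, let \<open>f\<close> be a solution and \<open>v = \<psi>(f)\<close>, where \<open>\<psi>\<close> is a bump of height 1 on the disc of radius \<open>c\<close>
  around \<open>f(0)\<close>. Its Dirichlet energy does not depend on \<open>c\<close>, and \<open>v\<close> lives in a small disc about 0.
  Since \<open>z / |z|\<^sup>2\<close> has divergence \<open>2\<pi>\<close> times the Dirac mass at 0, the integral of \<open>-\<nabla>v \<cdot> z / |z|\<^sup>2\<close> is about \<open>2\<pi>\<close>.
  The equation gives \<open>|x f\<^sub>x + y f\<^sub>y|\<^sup>2 = |z|\<^sup>2 J / K\<close> for the Jacobian \<open>J\<close>, so Cauchy-Schwarz bounds the same
  integral by the square root of the energy (area formula) times the integral of \<open>1 / (|z|\<^sup>2 K)\<close> over a small disc,
  which tends to 0 with \<open>c\<close>.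
\<close>

section \<open>Absolutely continuous functions\<close>

text \<open>The obstacle is the weak regularity of a solution: it is a homeomorphism with partial
  derivatives almost everywhere and absolute continuity on almost all lines, and nothing else is
  given. On the support of the bump the partials are integrable because their norms are at most sqrt
  (K J) <= (K + J) / 2; this is why K itself has to be integrable. The area formula is obtained only
  on pieces relative to which f is differentiable, and the null set that they miss may have an image
  of positive area. What survives is an inequality, the integral of J over a set is at most the area
  of its image, and this is the direction that the energy bound needs.

  The field z / |z|^2 is replaced by z / (|z|^2 + e^2) for one fixed e, so that no limit is taken: a
  fraction of the mass 2 pi is enough. The lower bound becomes pi / 8. A weighted AM-GM inequality,
  applied pointwise, plays the part of Cauchy-Schwarz and bounds the same integral by pi / 16 + pi /
  32: the first term comes from the area pi c^2 of the target disc, the second from the smallness of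
  the disc about 0.\<close>

lemma abs_cont_finite_family:
  assumes "abs_cont_on_interval F a b" "e > 0"
  shows "\<exists>d>0. \<forall>(P :: 'i set) l r. finite P \<longrightarrow> (\<forall>i\<in>P. a \<le> l i \<and> l i \<le> r i \<and> r i \<le> b) \<longrightarrow>
      (\<forall>i\<in>P. \<forall>j\<in>P. i \<noteq> j \<longrightarrow> r i \<le> l j \<or> r j \<le> l i) \<longrightarrow>
      (\<Sum>i\<in>P. r i - l i) < d \<longrightarrow> (\<Sum>i\<in>P. norm (F (r i) - F (l i))) < e"
proof -
  have "\<exists>d>0. \<forall>(n::nat) l r. (\<forall>k<n. a \<le> l k \<and> l k \<le> r k \<and> r k \<le> b) \<longrightarrow>
        (\<forall>j<n. \<forall>k<n. j \<noteq> k \<longrightarrow> r j \<le> l k \<or> r k \<le> l j) \<longrightarrow>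
        (\<Sum>k<n. r k - l k) < d \<longrightarrow> (\<Sum>k<n. norm (F (r k) - F (l k))) < e"
    using assms(1)[unfolded abs_cont_on_interval_def, rule_format, OF assms(2)] .
  then obtain d where dD: "d > 0 \<and> (\<forall>(n::nat) l r. (\<forall>k<n. a \<le> l k \<and> l k \<le> r k \<and> r k \<le> b) \<longrightarrow>
        (\<forall>j<n. \<forall>k<n. j \<noteq> k \<longrightarrow> r j \<le> l k \<or> r k \<le> l j) \<longrightarrow>
        (\<Sum>k<n. r k - l k) < d \<longrightarrow> (\<Sum>k<n. norm (F (r k) - F (l k))) < e)"
    by (rule exE)
  then have d: "d > 0" by (rule conjunct1)
  note D = conjunct2[OF dD, rule_format]
  show ?thesis
  proof (intro exI[of _ d] conjI d allI impI)
    fix P :: "'i set" and l r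
    assume fin: "finite P" and A: "\<forall>i\<in>P. a \<le> l i \<and> l i \<le> r i \<and> r i \<le> b"
      and B: "\<forall>i\<in>P. \<forall>j\<in>P. i \<noteq> j \<longrightarrow> r i \<le> l j \<or> r j \<le> l i"
      and C: "(\<Sum>i\<in>P. r i - l i) < d"
    \<comment> \<open>The families needed later are tagged divisions, that is finite sets of pairs;
      an enumeration turns them into the \<open>nat\<close>-indexed families of the
      definition.\<close>
    obtain h where h: "bij_betw h {..<card P} P"
      using ex_bij_betw_nat_finite[OF fin] by (auto simp: atLeast0LessThan)
    have hP: "h k \<in> P" if "k < card P" for k
      using h that by (auto simp: bij_betw_def)
    have hinj: "h j \<noteq> h k" if "j < card P" "k < card P" "j \<noteq> k" for j k
      using h that by (auto simp: bij_betw_def inj_on_def)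
    have "(\<Sum>k<card P. norm (F (r (h k)) - F (l (h k)))) < e"
    proof (rule D)
      show "a \<le> l (h k) \<and> l (h k) \<le> r (h k) \<and> r (h k) \<le> b" if "k < card P" for k
        using that A hP by blast
      show "r (h j) \<le> l (h k) \<or> r (h k) \<le> l (h j)" if "j < card P" "k < card P" "j \<noteq> k" for j k
        using that B hP hinj by blast
      show "(\<Sum>k<card P. r (h k) - l (h k)) < d"
        using C sum.reindex_bij_betw[OF h, of "\<lambda>i. r i - l i"] by simp
    qed
    then show "(\<Sum>i\<in>P. norm (F (r i) - F (l i))) < e"
      using sum.reindex_bij_betw[OF h, of "\<lambda>i. norm (F (r i) - F (l i))"] by simp
  qed
qed

text \<open>Neighbouring intervals may share end points, so the lengths are read off from the
  interiors, which are pairwise disjoint over the tagged pairs; a one-point interval has length 0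
  and empty interior.\<close>

lemma tagged_intervals_in_open:
  fixes p :: "(real \<times> real set) set"
  assumes p: "p tagged_partial_division_of {a..b}" and sub: "\<And>x K. (x, K) \<in> p \<Longrightarrow> K \<subseteq> U"
    and U: "U \<in> lmeasurable"
  shows "(\<Sum>(x, K)\<in>p. Sup K - Inf K) \<le> measure lebesgue U"
proof -
  have fin: "finite p" using p by (rule tagged_partial_division_ofD)
  have cb: "\<exists>u v. K = {u..v} \<and> u \<le> v" if xK: "(x, K) \<in> p" for x K
  proof -
    obtain u v where "K = cbox u v" using tagged_partial_division_ofD(4)[OF p xK] by blast
    moreover have "x \<in> K" using tagged_partial_division_ofD(2)[OF p xK] .
    ultimately show ?thesis by (intro exI[of _ u] exI[of _ v]) auto
  qed
  have ioc: "\<exists>u v. snd i = {u..v} \<and> interior (snd i) = {u<..<v} \<and> u \<le> v" if i: "i \<in> p" for i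
  proof -
    obtain u v where "snd i = {u..v}" "u \<le> v" using cb[of "fst i" "snd i"] i by auto
    then show ?thesis by (intro exI[of _ u] exI[of _ v]) simp
  qed
  have "(\<Sum>(x, K)\<in>p. Sup K - Inf K) = (\<Sum>i\<in>p. measure lebesgue (interior (snd i)))"
  proof (rule sum.cong[OF refl])
    fix i assume "i \<in> p"
    then obtain u v where "snd i = {u..v}" "interior (snd i) = {u<..<v}" "u \<le> v" using ioc by metis
    then show "(case i of (x, K) \<Rightarrow> Sup K - Inf K) = measure lebesgue (interior (snd i))"
      by (cases i) simp
  qed
  also have "\<dots> = measure lebesgue (\<Union>i\<in>p. interior (snd i))"
  proof (rule measure_UNION'[symmetric, OF fin])
    show "interior (snd i) \<in> fmeasurable lebesgue" if "i \<in> p" for i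
    proof -
      obtain u v where "interior (snd i) = {u<..<v}" using ioc[OF \<open>i \<in> p\<close>] by metis
      then show ?thesis by simp
    qed
    show "pairwise (\<lambda>i j. disjnt (interior (snd i)) (interior (snd j))) p"
      unfolding pairwise_def disjnt_def
    proof (intro ballI impI)
      fix i j assume "i \<in> p" "j \<in> p" "i \<noteq> j"
      then show "interior (snd i) \<inter> interior (snd j) = {}"
        using tagged_partial_division_ofD(5)[OF p, of "fst i" "snd i" "fst j" "snd j"]
        by (simp add: prod_eq_iff)
    qed
  qed
  also have "\<dots> \<le> measure lebesgue U"
  proof (rule measure_mono_fmeasurable[OF _ _ U])
    show "(\<Union>i\<in>p. interior (snd i)) \<subseteq> U"
    proof (rule UN_least)
      fix i assume "i \<in> p"
      then show "interior (snd i) \<subseteq> U"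
        using sub[of "fst i" "snd i"] interior_subset[of "snd i"] by simp
    qed
    show "(\<Union>i\<in>p. interior (snd i)) \<in> sets lebesgue"
      by (intro sets.finite_UN fin) simp
  qed
  finally show ?thesis .
qed

text \<open>
  Henstock--Kurzweil argument: tags in \<open>N\<close> are confined to an open set of small measure, where absolute continuity
  controls the increments; the other tags are handled by the derivative.
\<close>

theorem abs_cont_fundamental_theorem:
  fixes F :: "real \<Rightarrow> complex"
  assumes ab: "a \<le> b" and AC: "abs_cont_on_interval F a b" and N: "negligible N"
    and der: "\<And>x. x \<in> {a..b} - N \<Longrightarrow> (F has_vector_derivative F' x) (at x within {a..b})"
  shows "(F' has_integral F b - F a) {a..b}"
proof -
  \<comment> \<open>\<open>F'\<close> is arbitrary on \<open>N\<close>. With the value 0 there, a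
    tag in \<open>N\<close> contributes only an increment of \<open>F\<close>; the original values
    return at the end through \<open>has_integral_spike\<close>.\<close>
  define G where "G x = (if x \<in> N then 0 else F' x)" for x
  have "(G has_integral F b - F a) {a..b}"
    unfolding has_integral[of G _ a b, unfolded box_real]
  proof safe
    fix e :: real assume "e > 0"
    \<comment> \<open>Summed over the division this costs \<open>e1 * (b - a) \<le> e / 2\<close>;
      the added 1 covers the case \<open>a = b\<close>.\<close>
    define e1 where "e1 = e / (2 * (b - a + 1))"
    have e1: "e1 > 0" using \<open>e > 0\<close> ab by (simp add: e1_def)
    have D: "\<exists>d>0. \<forall>y\<in>{a..b}. norm (y-x) < d \<longrightarrow> norm (F y - F x - (y-x) *\<^sub>R F' x) \<le> e1 * norm (y-x)"
      if x: "x \<in> {a..b} - N" for x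
      using der[OF x] e1 unfolding has_vector_derivative_def has_derivative_within_alt by blast
    have "\<forall>x\<in>{a..b} - N. \<exists>d. d > 0 \<and> (\<forall>y\<in>{a..b}. norm (y-x) < d \<longrightarrow> norm (F y - F x - (y-x) *\<^sub>R F' x) \<le> e1 * norm (y-x))"
      using D by blast
    from bchoice[OF this] obtain d0 where d0: "\<forall>x\<in>{a..b} - N. d0 x > 0 \<and> (\<forall>y\<in>{a..b}. norm (y-x) < d0 x \<longrightarrow>
        norm (F y - F x - (y-x) *\<^sub>R F' x) \<le> e1 * norm (y-x))" by blast
    define d where "d x = (if x \<in> {a..b} - N then d0 x else 1)" for x
    have dD: "norm (F y - F x - (y-x) *\<^sub>R F' x) \<le> e1 * norm (y-x)"
      if "x \<in> {a..b} - N" "y \<in> {a..b}" "norm (y-x) < d x" for x y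
      using d0 that by (simp add: d_def)
    have d: "0 < d x" for x
      using d0 by (simp add: d_def)
    have e2: "e / 2 > 0" using \<open>e > 0\<close> by simp
    obtain \<delta> where \<delta>ac: "\<delta> > 0 \<and> (\<forall>(P :: (real \<times> real set) set) l r. finite P \<longrightarrow> (\<forall>i\<in>P. a \<le> l i \<and> l i \<le> r i \<and> r i \<le> b) \<longrightarrow>
      (\<forall>i\<in>P. \<forall>j\<in>P. i \<noteq> j \<longrightarrow> r i \<le> l j \<or> r j \<le> l i) \<longrightarrow>
      (\<Sum>i\<in>P. r i - l i) < \<delta> \<longrightarrow> (\<Sum>i\<in>P. norm (F (r i) - F (l i))) < e / 2)"
      using abs_cont_finite_family[OF AC e2] by (rule exE)
    then have \<delta>: "\<delta> > 0" by (rule conjunct1)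
    note ac = conjunct2[OF \<delta>ac, rule_format]
    have NL: "N \<in> sets lebesgue" and N0: "emeasure lebesgue N = 0"
      using N by (auto simp: negligible_iff_null_sets)
    obtain U where U: "open U" "N \<subseteq> U" "U - N \<in> lmeasurable" "emeasure lebesgue (U - N) < ennreal \<delta>"
      using sets_lebesgue_outer_open[OF NL \<delta>] by metis
    have NLm: "N \<in> lmeasurable" using N by (simp add: negligible_imp_measurable)
    have Ueq: "U = (U - N) \<union> N" using U by auto
    have Um: "U \<in> lmeasurable"
      by (subst Ueq) (use U NLm in \<open>intro fmeasurable.Un\<close>)
    have "emeasure lebesgue U \<le> emeasure lebesgue (U - N) + emeasure lebesgue N"
      by (subst Ueq) (use U NL in \<open>intro emeasure_subadditive\<close>, auto)
    then have "emeasure lebesgue U < ennreal \<delta>" using U N0 by simp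
    then have Ud: "measure lebesgue U < \<delta>"
      using Um \<delta> by (simp add: emeasure_eq_measure2 ennreal_less_iff)
    define \<gamma> where "\<gamma> x = (if x \<in> N then U else ball x (d x))" for x
    show "\<exists>\<gamma>. gauge \<gamma> \<and> (\<forall>p. p tagged_division_of {a..b} \<and> \<gamma> fine p \<longrightarrow>
      norm ((\<Sum>(x, k)\<in>p. measure lborel k *\<^sub>R G x) - (F b - F a)) < e)"
    proof (intro exI[of _ \<gamma>] conjI allI impI)
      show "gauge \<gamma>" using U d by (auto simp: \<gamma>_def gauge_def)
      fix p assume "p tagged_division_of {a..b} \<and> \<gamma> fine p"
      then have pt: "p tagged_division_of {a..b}" and fine: "\<gamma> fine p" by auto
      have fin: "finite p" using pt by (rule tagged_division_ofD)
      have cb: "\<exists>u v. K = {u..v} \<and> u \<le> v \<and> a \<le> u \<and> v \<le> b" if xK: "(x, K) \<in> p" for x K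
      proof -
        obtain u v where "K = cbox u v" using tagged_division_ofD(4)[OF pt xK] by blast
        moreover have "x \<in> K" "K \<subseteq> {a..b}" using tagged_division_ofD(2,3)[OF pt xK] by auto
        ultimately show ?thesis by (intro exI[of _ u] exI[of _ v]) auto
      qed
      define p1 where "p1 = {(x, K) \<in> p. x \<in> N}"
      define p2 where "p2 = {(x, K) \<in> p. x \<notin> N}"
      \<comment> \<open>A one-point interval of the division may lie inside another one and so
        violate the ordering that absolute continuity asks for. Its increment is 0, so it is
        dropped.\<close>
      define p3 where "p3 = {(x, K) \<in> p1. Inf K < Sup K}"
      have pp: "p = p1 \<union> p2" "p1 \<inter> p2 = {}" "finite p1" "finite p2" "p3 \<subseteq> p1" "finite p3" "p1 \<subseteq> p" "p2 \<subseteq> p"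
        using fin by (auto simp: p1_def p2_def p3_def intro: finite_subset[of _ p])
      have ba: "b - a = (\<Sum>(x,K)\<in>p. Sup K - Inf K)" and Fba: "F b - F a = (\<Sum>(x,K)\<in>p. F(Sup K) - F(Inf K))"
        using additive_tagged_division_1[OF ab pt, where f= "\<lambda>x. x"] additive_tagged_division_1[OF ab pt, where f= F]
        by auto
      have S1: "norm (\<Sum>(x,K)\<in>p1. measure lborel K *\<^sub>R G x - (F (Sup K) - F (Inf K))) < e / 2"
      proof -
        have "norm (\<Sum>(x,K)\<in>p1. measure lborel K *\<^sub>R G x - (F (Sup K) - F (Inf K)))
          \<le> (\<Sum>(x,K)\<in>p1. norm (F (Sup K) - F (Inf K)))"
          by (rule sum_norm_le) (auto simp: p1_def G_def norm_minus_commute)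
        also have "\<dots> = (\<Sum>(x,K)\<in>p3. norm (F (Sup K) - F (Inf K)))"
        proof (rule sum.mono_neutral_right[OF \<open>finite p1\<close> \<open>p3 \<subseteq> p1\<close>], safe)
          fix x K assume "(x, K) \<in> p1" "(x, K) \<notin> p3"
          then have "(x, K) \<in> p" "\<not> Inf K < Sup K" by (auto simp: p3_def p1_def)
          then have "Inf K = Sup K" using cb[of x K] by auto
          then show "norm (F (Sup K) - F (Inf K)) = 0" by simp
        qed
        also have "\<dots> < e / 2"
          unfolding case_prod_unfold
        proof (rule ac)
          show "finite p3" by fact
          show "a \<le> Inf (snd i) \<and> Inf (snd i) \<le> Sup (snd i) \<and> Sup (snd i) \<le> b" if "i \<in> p3" for i
            using cb[of "fst i" "snd i"] that by (auto simp: p3_def p1_def)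
          show "Sup (snd i) \<le> Inf (snd j) \<or> Sup (snd j) \<le> Inf (snd i)"
            if "i \<in> p3" "j \<in> p3" "i \<noteq> j" for i j
          proof -
            have ij: "(fst i, snd i) \<in> p" "(fst j, snd j) \<in> p" using that by (auto simp: p3_def p1_def)
            obtain u v where u: "snd i = {u..v}" "u \<le> v" using cb[OF ij(1)] by blast
            obtain s t where s: "snd j = {s..t}" "s \<le> t" using cb[OF ij(2)] by blast
            have lt: "u < v" "s < t" using that u s by (auto simp: p3_def)
            have "interior (snd i) \<inter> interior (snd j) = {}"
              using tagged_division_ofD(5)[OF pt ij] that by (simp add: prod_eq_iff)
            then have "{u<..<v} \<inter> {s<..<t} = {}" using u s by simp
            \<comment> \<open>If neither interval preceded the other, the midpoint of their overlap
              would lie in both interiors.\<close>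
            then have "(max u s + min v t) / 2 \<notin> {u<..<v} \<inter> {s<..<t}" by simp
            then have "v \<le> s \<or> t \<le> u"
              using lt by (auto simp: max_def min_def split: if_splits)
            then show ?thesis using u s by auto
          qed
          have "(\<Sum>(x, K)\<in>p3. Sup K - Inf K) \<le> measure lebesgue U"
          proof (rule tagged_intervals_in_open[OF _ _ Um])
            show "p3 tagged_partial_division_of {a..b}"
              using pt pp by (meson tagged_division_of_def tagged_partial_division_subset)
            show "K \<subseteq> U" if "(x, K) \<in> p3" for x K
              using fineD[OF fine, of x K] that by (simp add: p3_def p1_def \<gamma>_def)
          qed
          then show "(\<Sum>i\<in>p3. Sup (snd i) - Inf (snd i)) < \<delta>" using Ud by (simp add: case_prod_unfold)
        qed
        finally show ?thesis .
      qed
      have S2: "norm (\<Sum>(x,K)\<in>p2. measure lborel K *\<^sub>R G x - (F (Sup K) - F (Inf K))) \<le> e / 2"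
      proof -
        have "norm (\<Sum>(x,K)\<in>p2. measure lborel K *\<^sub>R G x - (F (Sup K) - F (Inf K)))
          \<le> (\<Sum>i\<in>p2. e1 * (case i of (x,K) \<Rightarrow> Sup K - Inf K))"
        proof (rule sum_norm_le, safe)
          fix x K assume "(x, K) \<in> p2"
          then have xK: "(x, K) \<in> p" "x \<notin> N" by (auto simp: p2_def)
          then obtain u v where k: "K = {u..v}" "u \<le> v" "a \<le> u" "v \<le> b" using cb by blast
          have x: "x \<in> K" "K \<subseteq> {a..b}" using tagged_division_ofD(2,3)[OF pt xK(1)] by auto
          have ball: "K \<subseteq> ball x (d x)" using fineD[OF fine xK(1)] xK(2) by (simp add: \<gamma>_def)
          \<comment> \<open>The tag lies between \<open>u\<close> and \<open>v\<close>, so the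
            errors measured from \<open>x\<close> to both ends add up to exactly
            \<open>e1 * (v - u)\<close>.\<close>
          have "norm ((v - u) *\<^sub>R F' x - (F v - F u)) = norm (F u - F x - (u - x) *\<^sub>R F' x - (F v - F x - (v - x) *\<^sub>R F' x))"
            by (auto simp: algebra_simps)
          also have "\<dots> \<le> norm (F u - F x - (u - x) *\<^sub>R F' x) + norm (F v - F x - (v - x) *\<^sub>R F' x)"
            by (rule norm_triangle_ineq4)
          also have "\<dots> \<le> e1 * norm (u - x) + e1 * norm (v - x)"
          proof (rule add_mono)
            have "u \<in> K" "v \<in> K" using k by auto
            then have "dist x u < d x" "dist x v < d x" using ball by auto
            then show "norm (F u - F x - (u - x) *\<^sub>R F' x) \<le> e1 * norm (u - x)"
              "norm (F v - F x - (v - x) *\<^sub>R F' x) \<le> e1 * norm (v - x)"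
              using dD[of x u] dD[of x v] k x xK by (auto simp: dist_real_def abs_minus_commute)
          qed
          also have "\<dots> = e1 * (v - u)" using x k by (auto simp: algebra_simps)
          finally show "norm (measure lborel K *\<^sub>R G x - (F (Sup K) - F (Inf K))) \<le> e1 * (Sup K - Inf K)"
            using k xK by (simp add: G_def)
        qed
        also have "\<dots> \<le> (\<Sum>i\<in>p. e1 * (case i of (x,K) \<Rightarrow> Sup K - Inf K))"
        proof (intro sum_mono2[OF fin \<open>p2 \<subseteq> p\<close>])
          fix i assume "i \<in> p - p2"
          then obtain x K where "i = (x, K)" "(x, K) \<in> p" by (cases i) auto
          then show "0 \<le> e1 * (case i of (x, K) \<Rightarrow> Sup K - Inf K)" using cb[of x K] e1 by auto
        qed
        also have "\<dots> = e1 * (b - a)" by (simp add: ba sum_distrib_left)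
        also have "\<dots> \<le> e / 2" using \<open>e > 0\<close> ab by (simp add: e1_def field_simps)
        finally show ?thesis .
      qed
      have "(\<Sum>(x, k)\<in>p. measure lborel k *\<^sub>R G x) - (F b - F a) = (\<Sum>(x,K)\<in>p. measure lborel K *\<^sub>R G x - (F (Sup K) - F (Inf K)))"
        unfolding Fba by (simp add: sum_subtractf case_prod_unfold)
      also have "\<dots> = (\<Sum>(x,K)\<in>p1. measure lborel K *\<^sub>R G x - (F (Sup K) - F (Inf K))) +
          (\<Sum>(x,K)\<in>p2. measure lborel K *\<^sub>R G x - (F (Sup K) - F (Inf K)))"
        using pp by (simp add: sum.union_disjoint)
      finally show "norm ((\<Sum>(x, k)\<in>p. measure lborel k *\<^sub>R G x) - (F b - F a)) < e"
        using S1 S2 norm_triangle_ineq[of "\<Sum>(x,K)\<in>p1. measure lborel K *\<^sub>R G x - (F (Sup K) - F (Inf K))"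
            "\<Sum>(x,K)\<in>p2. measure lborel K *\<^sub>R G x - (F (Sup K) - F (Inf K))"] by simp
    qed
  qed
  then show ?thesis
    by (rule has_integral_spike[OF N, rotated]) (simp add: G_def)
qed

section \<open>The Jacobian integral of a homeomorphism\<close>

lemma lborel_complex_eq_distr_pair:
  "(lborel :: complex measure) = distr (lborel \<Otimes>\<^sub>M lborel) borel (\<lambda>(x, y). Complex x y)"
proof (rule lborel_eqI)
  have m[measurable]: "(\<lambda>(x, y). Complex x y) \<in> borel_measurable (lborel \<Otimes>\<^sub>M lborel)"
    unfolding Complex_eq case_prod_unfold by measurable
  fix l u :: complex
  assume "\<And>b. b \<in> Basis \<Longrightarrow> l \<bullet> b \<le> u \<bullet> b"
  from this[of 1] this[of \<i>] have le: "Re l \<le> Re u" "Im l \<le> Im u"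
    by (auto simp: Basis_complex_def)
  have "(\<lambda>(x, y). Complex x y) -` box l u \<inter> space (lborel \<Otimes>\<^sub>M lborel) = {Re l<..<Re u} \<times> {Im l<..<Im u}"
    by (auto simp: in_box_complex_iff space_pair_measure)
  then have "emeasure (distr (lborel \<Otimes>\<^sub>M lborel) borel (\<lambda>(x, y). Complex x y)) (box l u)
     = emeasure (lborel \<Otimes>\<^sub>M lborel) ({Re l<..<Re u} \<times> {Im l<..<Im u})"
    by (subst emeasure_distr[OF m]) auto
  also have "\<dots> = ennreal (Re u - Re l) * ennreal (Im u - Im l)"
    using le by (subst lborel.emeasure_pair_measure_Times) auto
  also have "\<dots> = (\<Prod>b\<in>Basis. (u - l) \<bullet> b)"
    using le by (simp add: Basis_complex_def ennreal_mult)
  finally show "emeasure (distr (lborel \<Otimes>\<^sub>M lborel) borel (\<lambda>(x, y). Complex x y)) (box l u) = (\<Prod>b\<in>Basis. (u - l) \<bullet> b)" .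
qed simp

text \<open>The change of variables theorem \<open>has_measure_differentiable_image\<close> speaks
  of \<open>real^'n\<close> and of \<open>det (matrix ...)\<close>; \<open>f\<close> is conjugated
  by this measure-preserving linear identification.\<close>

definition complex_of_vec :: "real^2 \<Rightarrow> complex" where
  "complex_of_vec v = Complex (v $ 1) (v $ 2)"

definition vec_of_complex :: "complex \<Rightarrow> real^2" where
  "vec_of_complex z = vector [Re z, Im z]"

lemma complex_of_vec_of_complex [simp]: "complex_of_vec (vec_of_complex z) = z"
  by (simp add: complex_of_vec_def vec_of_complex_def)

lemma vec_of_complex_of_vec [simp]: "vec_of_complex (complex_of_vec v) = v"
  by (simp add: complex_of_vec_def vec_of_complex_def vec_eq_iff forall_2)

lemma bounded_linear_complex_of_vec: "bounded_linear complex_of_vec"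
  unfolding complex_of_vec_def Complex_eq
  by (intro bounded_linear_add bounded_linear_vec_nth bounded_linear_const_mult
      bounded_linear_compose[OF bounded_linear_of_real])

lemma bounded_linear_vec_of_complex: "bounded_linear vec_of_complex"
proof (rule linear_conv_bounded_linear[THEN iffD1], rule linearI)
  fix x y z :: complex and r :: real
  show "vec_of_complex (x + y) = vec_of_complex x + vec_of_complex y"
    "vec_of_complex (r *\<^sub>R z) = r *\<^sub>R vec_of_complex z"
    by (simp_all add: vec_of_complex_def vec_eq_iff forall_2)
qed

lemma borel_measurable_complex_of_vec [measurable]: "complex_of_vec \<in> borel_measurable borel"
  by (intro borel_measurable_continuous_onI linear_continuous_on bounded_linear_complex_of_vec)

lemma lborel_complex_eq_distr_vec:
  "(lborel :: complex measure) = distr lborel borel complex_of_vec"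
proof (rule lborel_eqI)
  fix l u :: complex
  assume "\<And>b. b \<in> Basis \<Longrightarrow> l \<bullet> b \<le> u \<bullet> b"
  from this[of 1] this[of \<i>] have le: "Re l \<le> Re u" "Im l \<le> Im u"
    by (auto simp: Basis_complex_def)
  have "complex_of_vec -` box l u \<inter> space lborel = box (vec_of_complex l) (vec_of_complex u)"
    by (auto simp: in_box_complex_iff mem_box_cart forall_2 complex_of_vec_def vec_of_complex_def)
  then have "emeasure (distr lborel borel complex_of_vec) (box l u)
     = emeasure lborel (box (vec_of_complex l) (vec_of_complex u))"
    by (subst emeasure_distr) auto
  also have "\<dots> = (\<Prod>b\<in>Basis. (u - l) \<bullet> b)"
    using le
    by (subst emeasure_lborel_box)
      (auto simp: Basis_complex_def Basis_vec_def UNIV_2 axis_eq_axis vec_of_complex_def inner_axis inner_diff_left)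
  finally show "emeasure (distr lborel borel complex_of_vec) (box l u) = (\<Prod>b\<in>Basis. (u - l) \<bullet> b)" .
qed simp

text \<open>The determinant of a real-linear map of the plane, with columns \<open>L 1\<close> and
  \<open>L \<i>\<close>.\<close>

definition jac :: "(complex \<Rightarrow> complex) \<Rightarrow> real" where
  "jac L = Re (L 1) * Im (L \<i>) - Re (L \<i>) * Im (L 1)"

text \<open>The derivative is required only within \<open>S\<close>, because the sets produced by
  Egorov's theorem may have empty interior. Boundedness of the image makes its measure a real
  number, the form in which the change of variables theorem expresses it.\<close>

lemma nn_integral_jacobian_image:
  fixes f :: "complex \<Rightarrow> complex"
  assumes S: "S \<in> sets borel" and der: "\<And>z. z \<in> S \<Longrightarrow> (f has_derivative f' z) (at z within S)"
    and inj: "inj_on f S" and fS: "f ` S \<in> sets borel" and bnd: "bounded (f ` S)"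
    and jm[measurable]: "(\<lambda>z. jac (f' z)) \<in> borel_measurable borel"
  shows "(\<integral>\<^sup>+z\<in>S. ennreal \<bar>jac (f' z)\<bar> \<partial>lborel) = emeasure lborel (f ` S)"
proof -
  define F where "F = vec_of_complex \<circ> f \<circ> complex_of_vec"
  define F' where "F' v = vec_of_complex \<circ> f' (complex_of_vec v) \<circ> complex_of_vec" for v
  define T where "T = vec_of_complex ` S"
  have Teq: "T = complex_of_vec -` S" unfolding T_def by (auto intro: image_eqI[where x="complex_of_vec _"])
  have T: "T \<in> sets borel" unfolding Teq using measurable_sets_borel[OF borel_measurable_complex_of_vec S] by simp
  have FT: "F ` T = vec_of_complex ` f ` S" by (auto simp: F_def T_def image_comp o_def)
  have FTeq: "F ` T = complex_of_vec -` f ` S" unfolding FT by (auto intro: image_eqI[where x="complex_of_vec _"])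
  have FTb: "F ` T \<in> sets borel" unfolding FTeq using measurable_sets_borel[OF borel_measurable_complex_of_vec fS] by simp
  have "bounded (F ` T)" unfolding FT by (rule bounded_linear_image[OF bnd bounded_linear_vec_of_complex])
  then have FTm: "F ` T \<in> lmeasurable"
    using FTb by (intro bounded_set_imp_lmeasurable) auto
  have dF: "(F has_derivative F' v) (at v within T)" if "v \<in> T" for v
  proof -
    have 1: "(f has_derivative f' (complex_of_vec v)) (at (complex_of_vec v) within complex_of_vec ` T)"
      using der[of "complex_of_vec v"] that by (auto simp: T_def image_comp o_def)
    have 2: "((f \<circ> complex_of_vec) has_derivative (f' (complex_of_vec v) \<circ> complex_of_vec)) (at v within T)"
      using diff_chain_within[OF bounded_linear_imp_has_derivative[OF bounded_linear_complex_of_vec] 1] .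
    show ?thesis
      unfolding F_def F'_def comp_assoc
      by (rule diff_chain_within[OF 2 bounded_linear_imp_has_derivative[OF bounded_linear_vec_of_complex]])
  qed
  have injF: "inj_on F T"
    using inj unfolding F_def T_def by (auto simp: inj_on_def) (metis complex_of_vec_of_complex)
  have "((\<lambda>v. \<bar>det (matrix (F' v))\<bar>) has_integral measure lebesgue (F ` T)) T"
    using has_measure_differentiable_image[OF _ dF injF, of "measure lebesgue (F ` T)"] T FTm by auto
  then have "(\<integral>\<^sup>+v. ennreal \<bar>det (matrix (F' v))\<bar> * indicator T v \<partial>lborel) = ennreal (measure lebesgue (F ` T))"
    by (intro nn_integral_has_integral_lebesgue') auto
  also have "\<dots> = emeasure lborel (F ` T)"
    using emeasure_eq_measure2[OF FTm] FTb by simp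
  also have "\<dots> = emeasure lborel (f ` S)"
    by (subst lborel_complex_eq_distr_vec, subst emeasure_distr) (use fS in \<open>auto simp: FTeq\<close>)
  finally have A: "(\<integral>\<^sup>+v. ennreal \<bar>det (matrix (F' v))\<bar> * indicator T v \<partial>lborel) = emeasure lborel (f ` S)" .
  have det: "det (matrix (F' v)) = jac (f' (complex_of_vec v))" for v
  proof -
    have "complex_of_vec (axis 1 1) = 1" "complex_of_vec (axis 2 1) = \<i>"
      by (simp_all add: complex_of_vec_def axis_def complex_eq_iff)
    then show ?thesis
      by (simp add: det_2 matrix_def F'_def jac_def vec_of_complex_def)
  qed
  have "(\<integral>\<^sup>+z\<in>S. ennreal \<bar>jac (f' z)\<bar> \<partial>lborel)
      = (\<integral>\<^sup>+z. ennreal \<bar>jac (f' z)\<bar> * indicator S z \<partial>distr lborel borel complex_of_vec)"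
    by (subst lborel_complex_eq_distr_vec) (rule refl)
  also have "\<dots> = (\<integral>\<^sup>+v. ennreal \<bar>jac (f' (complex_of_vec v))\<bar> * indicator S (complex_of_vec v) \<partial>lborel)"
    using S by (intro nn_integral_distr) auto
  also have "\<dots> = emeasure lborel (f ` S)"
    unfolding A[symmetric] det Teq by (simp add: indicator_def)
  finally show ?thesis .
qed

text \<open>Egorov's theorem in terms of sets: \<open>P k n\<close> collects the points where
  accuracy \<open>k\<close> is reached at stage \<open>n\<close>. For each \<open>k\<close> a stage
  \<open>N k m\<close> is chosen that misses less than \<open>(1/2)^(k + m)\<close> of
  \<open>X\<close>. Summing over \<open>k\<close>, the set \<open>E m\<close> of points good at all
  these stages misses at most \<open>2 * (1/2)^m\<close>, hence the union of all \<open>E m\<close>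
  misses a null set.\<close>

lemma egorov_sets:
  fixes P :: "nat \<Rightarrow> nat \<Rightarrow> 'a set"
  assumes X[measurable]: "X \<in> sets M" and fin: "emeasure M X < \<infinity>"
    and P[measurable]: "\<And>k n. P k n \<in> sets M" and inc: "\<And>k. incseq (P k)"
    and ae: "AE x in M. x \<in> X \<longrightarrow> (\<forall>k. \<exists>n. x \<in> P k n)"
  shows "\<exists>E :: nat \<Rightarrow> 'a set. (\<forall>m. E m \<in> sets M \<and> E m \<subseteq> X \<and> (\<forall>k. \<exists>n. E m \<subseteq> P k n)) \<and>
    (AE x in M. x \<in> X \<longrightarrow> (\<exists>m. x \<in> E m))"
proof -
  have ex: "\<exists>n. emeasure M (X - P k n) < ennreal e" if "e > 0" for k :: nat and e :: real
  proof -
    have "(\<lambda>n. emeasure M (X - P k n)) \<longlonglongrightarrow> emeasure M (\<Inter>n. X - P k n)"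
    proof (rule Lim_emeasure_decseq)
      show "decseq (\<lambda>n. X - P k n)" using inc[of k] by (auto simp: decseq_def incseq_def)
      show "emeasure M (X - P k n) \<noteq> \<infinity>" for n
        using fin emeasure_mono[of "X - P k n" X M] X by (auto simp: top_unique less_top[symmetric])
    qed auto
    moreover have "emeasure M (\<Inter>n. X - P k n) = 0"
          proof -
      have "AE x in M. x \<notin> (\<Inter>n. X - P k n)" using ae by eventually_elim blast
      then have "(\<Inter>n. X - P k n) \<in> null_sets M" by (subst AE_iff_null_sets) auto
      then show ?thesis by (rule null_setsD1)
    qed
    ultimately have "(\<lambda>n. emeasure M (X - P k n)) \<longlonglongrightarrow> 0" by simp
    then have "eventually (\<lambda>n. emeasure M (X - P k n) < ennreal e) sequentially"
      using that by (intro order_tendstoD(2)) auto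
    then show ?thesis by (auto simp: eventually_sequentially)
  qed
  have "\<exists>n. emeasure M (X - P k n) < ennreal ((1/2)^(k + m))" for k m :: nat
    by (rule ex) simp
  then obtain N where N: "\<And>k m. emeasure M (X - P k (N k m)) < ennreal ((1/2)^(k + m))" by metis
  define E where "E m = X \<inter> (\<Inter>k. P k (N k m))" for m
  have Em[measurable]: "E m \<in> sets M" for m unfolding E_def by measurable
  have small: "emeasure M (X - E m) \<le> ennreal (2 * (1/2)^m)" for m
  proof -
    have "emeasure M (X - E m) \<le> emeasure M (\<Union>k. X - P k (N k m))"
      by (rule emeasure_mono) (auto simp: E_def)
    also have "\<dots> \<le> (\<Sum>k. emeasure M (X - P k (N k m)))"
      by (rule emeasure_subadditive_countably) auto
    also have "\<dots> \<le> (\<Sum>k. ennreal ((1/2)^(k + m)))"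
      by (intro suminf_le less_imp_le[OF N]) auto
    also have "\<dots> = ennreal (2 * (1/2)^m)"
    proof (rule suminf_ennreal_eq)
      have "(\<lambda>k. (1/2)^k * (1/2)^m :: real) sums (1 / (1 - 1/2) * (1/2)^m)"
        by (intro sums_mult2 geometric_sums) simp
      then show "(\<lambda>k. (1/2)^(k + m) :: real) sums (2 * (1/2)^m)" by (simp add: power_add)
    qed simp
    finally show ?thesis .
  qed
  have "emeasure M (X - (\<Union>m. E m)) \<le> 0"
  proof (rule LIMSEQ_le_const)
    have "(\<lambda>m. 2 * (1/2)^m :: real) \<longlonglongrightarrow> 2 * 0"
      by (intro tendsto_mult tendsto_const LIMSEQ_power_zero) simp
    then show "(\<lambda>m. ennreal (2 * (1/2)^m)) \<longlonglongrightarrow> 0"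
      using tendsto_ennrealI by fastforce
    show "\<exists>N. \<forall>n\<ge>N. emeasure M (X - (\<Union>m. E m)) \<le> ennreal (2 * (1/2)^n)"
    proof (intro exI allI impI)
      fix n :: nat
      have "emeasure M (X - (\<Union>m. E m)) \<le> emeasure M (X - E n)" by (rule emeasure_mono) auto
      then show "emeasure M (X - (\<Union>m. E m)) \<le> ennreal (2 * (1/2)^n)" using small[of n] by simp
    qed
  qed
  then have "X - (\<Union>m. E m) \<in> null_sets M" by auto
  then have "AE x in M. x \<in> X \<longrightarrow> (\<exists>m. x \<in> E m)" by (rule AE_I') auto
  moreover have "E m \<subseteq> X \<and> (\<forall>k. \<exists>n. E m \<subseteq> P k n)" for m by (auto simp: E_def)
  ultimately show ?thesis using Em by (intro exI[of _ E]) simp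
qed

section \<open>Partial derivatives and differentiability relative to a subset\<close>

definition partials_at :: "(complex \<Rightarrow> complex) \<Rightarrow> complex \<Rightarrow> complex \<Rightarrow> complex \<Rightarrow> bool" where
  "partials_at f z p q \<longleftrightarrow>
     ((\<lambda>h::real. f (z + of_real h)) has_vector_derivative p) (at 0) \<and>
     ((\<lambda>h::real. f (z + \<i> * of_real h)) has_vector_derivative q) (at 0)"

lemma continuous_le_of_le_rationals:
  fixes \<phi> :: "real \<Rightarrow> real"
  assumes cont: "continuous_on {a<..<b} \<phi>" and le: "\<And>r. r \<in> {a<..<b} \<Longrightarrow> r \<in> \<rat> \<Longrightarrow> \<phi> r \<le> 0"
    and h: "h \<in> {a<..<b}"
  shows "\<phi> h \<le> 0"
proof (rule ccontr)
  assume "\<not> \<phi> h \<le> 0"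
  have "open ({a<..<b} \<inter> \<phi> -` {0<..})"
    using cont by (rule continuous_open_preimage) auto
  moreover have "h \<in> {a<..<b} \<inter> \<phi> -` {0<..}" using h \<open>\<not> \<phi> h \<le> 0\<close> by auto
  ultimately obtain e where e: "e > 0" "ball h e \<subseteq> {a<..<b} \<inter> \<phi> -` {0<..}"
    by (meson open_contains_ball)
  obtain r where r: "r \<in> \<rat>" "h < r" "r < h + e" using Rats_dense_in_real[of h "h + e"] e by auto
  then have "r \<in> ball h e" by (auto simp: dist_real_def)
  then show False using e le[of r] r by force
qed

text \<open>The sets fed to Egorov's theorem: \<open>k\<close> is the accuracy and \<open>n\<close>
  the scale, both shifted by one to avoid division by 0. The condition on \<open>norm z\<close>
  keeps every point \<open>z + d h\<close> in the disc when \<open>norm d = 1\<close>, so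
  \<open>f\<close> is only evaluated where it is continuous.\<close>

definition quotient_close :: "(complex \<Rightarrow> complex) \<Rightarrow> (complex \<Rightarrow> complex) \<Rightarrow> complex \<Rightarrow> nat \<Rightarrow> nat \<Rightarrow> complex set" where
  "quotient_close f p d k n = {z. norm z + 1 / real (Suc n) < 1 \<and>
     (\<forall>h. \<bar>h\<bar> < 1 / real (Suc n) \<longrightarrow> norm (f (z + d * of_real h) - f z - h *\<^sub>R p z) \<le> \<bar>h\<bar> / real (Suc k))}"

lemma quotient_closeD:
  assumes "z \<in> quotient_close f p d k n"
  shows "norm z + 1 / real (Suc n) < 1"
    "\<bar>h\<bar> < 1 / real (Suc n) \<Longrightarrow> norm (f (z + d * of_real h) - f z - h *\<^sub>R p z) \<le> \<bar>h\<bar> / real (Suc k)"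
  using assms by (auto simp: quotient_close_def)

lemma in_unit_disc_shift:
  assumes "norm z + s < 1" "norm d = 1" "\<bar>h\<bar> < s"
  shows "z \<in> unit_disc" "z + d * of_real h \<in> unit_disc"
  using norm_triangle_ineq[of z "d * of_real h"] assms by (auto simp: unit_disc_def norm_mult)

text \<open>The condition ranges over uncountably many \<open>h\<close>, but both of its sides are
  continuous in \<open>h\<close>. Testing rational \<open>h\<close> is therefore enough and leaves a
  countable intersection of Borel sets.\<close>

lemma quotient_close_measurable:
  assumes cont: "continuous_on unit_disc f" and p[measurable]: "p \<in> borel_measurable borel" and d: "norm d = 1"
  shows "quotient_close f p d k n \<in> sets borel"
proof -
  define F where "F z = (if z \<in> unit_disc then f z else 0)" for z
  have [measurable]: "F \<in> borel_measurable borel"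
    unfolding F_def using cont by (intro borel_measurable_continuous_on_if) (auto simp: unit_disc_def)
  define s where "s = 1 / real (Suc n)"
  have s: "s > 0" by (simp add: s_def)
  let ?I = "{- s<..<s}"
  have in_disc: "z \<in> unit_disc" "z + d * of_real h \<in> unit_disc" if "norm z + s < 1" "h \<in> ?I" for z h
    using in_unit_disc_shift[OF that(1) d, of h] that(2) by (auto simp: abs_less_iff)
  have "quotient_close f p d k n = {z. norm z + s < 1} \<inter>
     (\<Inter>h\<in>\<rat> \<inter> ?I. {z. norm (F (z + d * of_real h) - F z - h *\<^sub>R p z) \<le> \<bar>h\<bar> / real (Suc k)})" (is "_ = ?R")
  proof (intro equalityI subsetI)
    fix z assume z: "z \<in> quotient_close f p d k n"
    then have z1: "norm z + s < 1" using quotient_closeD(1) by (auto simp: s_def)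
    have "norm (F (z + d * of_real h) - F z - h *\<^sub>R p z) \<le> \<bar>h\<bar> / real (Suc k)" if "h \<in> ?I" for h
    proof -
      have "F (z + d * of_real h) = f (z + d * of_real h)" "F z = f z"
        using in_disc[OF z1 that] by (auto simp: F_def)
      moreover have "\<bar>h\<bar> < s" using that by auto
      ultimately show ?thesis using quotient_closeD(2)[OF z] unfolding s_def by presburger
    qed
    then show "z \<in> ?R" using z1 by blast
  next
    fix z assume z: "z \<in> ?R"
    then have z1: "norm z + s < 1" by auto
    have "norm (f (z + d * of_real h) - f z - h *\<^sub>R p z) - \<bar>h\<bar> / real (Suc k) \<le> 0" if "h \<in> ?I" for h
    proof (rule continuous_le_of_le_rationals[OF _ _ that])
      have "continuous_on ?I (\<lambda>h. f (z + d * of_real h))"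
        using in_disc(2)[OF z1] by (intro continuous_on_compose2[OF cont] continuous_intros) auto
      then show "continuous_on ?I (\<lambda>h. norm (f (z + d * of_real h) - f z - h *\<^sub>R p z) - \<bar>h\<bar> / real (Suc k))"
        by (intro continuous_intros) auto
      show "norm (f (z + d * of_real r) - f z - r *\<^sub>R p z) - \<bar>r\<bar> / real (Suc k) \<le> 0"
        if r: "r \<in> ?I" "r \<in> \<rat>" for r
      proof -
        have "F (z + d * of_real r) = f (z + d * of_real r)" "F z = f z"
          using in_disc[OF z1 r(1)] by (auto simp: F_def)
        then show ?thesis using z r by force
      qed
    qed
    then have "norm (f (z + d * of_real h) - f z - h *\<^sub>R p z) \<le> \<bar>h\<bar> / real (Suc k)" if "\<bar>h\<bar> < s" for h
      using that by (smt (verit) greaterThanLessThan_iff)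
    then show "z \<in> quotient_close f p d k n" using z1 unfolding quotient_close_def s_def by blast
  qed
  moreover have "?R \<in> sets borel"
  proof (intro sets.Int sets.countable_INT')
    show "{z :: complex. norm z + s < 1} \<in> sets borel" by measurable
    show "countable (\<rat> \<inter> ?I)" using countable_rat by blast
    have "0 \<in> \<rat> \<inter> ?I" using s by simp
    then show "\<rat> \<inter> ?I \<noteq> {}" by blast
    show "(\<lambda>h. {z. norm (F (z + d * of_real h) - F z - h *\<^sub>R p z) \<le> \<bar>h\<bar> / real (Suc k)}) ` (\<rat> \<inter> ?I) \<subseteq> sets borel"
      by (intro image_subsetI) measurable
  qed
  ultimately show ?thesis by simp
qed

lemma quotient_close_incseq: "incseq (quotient_close f p d k)"
proof (rule incseq_SucI, rule subsetI)
  fix n z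
  have le: "1 / real (Suc (Suc n)) \<le> 1 / real (Suc n)" by (simp add: field_simps)
  assume z: "z \<in> quotient_close f p d k n"
  show "z \<in> quotient_close f p d k (Suc n)"
    unfolding quotient_close_def mem_Collect_eq
  proof (intro conjI allI impI)
    show "norm z + 1 / real (Suc (Suc n)) < 1" using quotient_closeD(1)[OF z] le by linarith
    fix h assume "\<bar>h\<bar> < 1 / real (Suc (Suc n))"
    then show "norm (f (z + d * of_real h) - f z - h *\<^sub>R p z) \<le> \<bar>h\<bar> / real (Suc k)"
      using le by (intro quotient_closeD(2)[OF z]) linarith
  qed
qed

lemma quotient_close_ex:
  assumes z: "z \<in> unit_disc" and der: "((\<lambda>h::real. f (z + d * of_real h)) has_vector_derivative p z) (at 0)"
  shows "\<exists>n. z \<in> quotient_close f p d k n"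
proof -
  have "\<exists>\<delta>>0. \<forall>h. norm (h - 0) < \<delta> \<longrightarrow> norm (f (z + d * of_real h) - f (z + d * of_real 0) - (h - 0) *\<^sub>R p z) \<le> (1 / real (Suc k)) * norm (h - 0)"
    using der unfolding has_vector_derivative_def has_derivative_at_alt by (elim conjE allE[of _ "1 / real (Suc k)"]) simp
  then obtain \<delta> where \<delta>: "\<delta> > 0"
    "\<And>h. \<bar>h\<bar> < \<delta> \<Longrightarrow> norm (f (z + d * of_real h) - f z - h *\<^sub>R p z) \<le> \<bar>h\<bar> / real (Suc k)" by auto
  have "min \<delta> (1 - norm z) > 0" using \<delta> z by (simp add: unit_disc_def)
  then obtain n where n: "1 / real (Suc n) < min \<delta> (1 - norm z)" using nat_approx_posE by blast
  have "z \<in> quotient_close f p d k n"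
    unfolding quotient_close_def mem_Collect_eq
  proof (intro conjI allI impI)
    show "norm z + 1 / real (Suc n) < 1" using n by simp
    fix h assume "\<bar>h\<bar> < 1 / real (Suc n)"
    then show "norm (f (z + d * of_real h) - f z - h *\<^sub>R p z) \<le> \<bar>h\<bar> / real (Suc k)"
      using n by (intro \<delta>) linarith
  qed
  then show ?thesis by blast
qed

text \<open>On \<open>E\<close> the function \<open>p\<close> is a uniform limit of difference
  quotients with a fixed step, and these are continuous because \<open>f\<close> is.\<close>

lemma quotient_close_imp_continuous:
  assumes cont: "continuous_on unit_disc f" and d: "norm d = 1"
    and E: "\<And>k. \<exists>n. E \<subseteq> quotient_close f p d k n" and z0: "z0 \<in> E"
  shows "continuous (at z0 within E) p"
  unfolding continuous_within_eps_delta
proof (intro allI impI)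
  fix e :: real assume "e > 0"
  then obtain k where k: "1 / real (Suc k) < e / 4" using nat_approx_posE[of "e/4"] by auto
  obtain n where n: "E \<subseteq> quotient_close f p d k n" using E by blast
  define s where "s = 1 / (2 * real (Suc n))"
  have s: "s > 0" "s < 1 / real (Suc n)" by (simp_all add: s_def field_simps)
  then have sI: "\<bar>s\<bar> < 1 / real (Suc n)" by simp
  have disc: "z \<in> unit_disc" "z + d * of_real s \<in> unit_disc" if "z \<in> E" for z
    using in_unit_disc_shift[OF quotient_closeD(1) d sI] n that by blast+
  have o: "open unit_disc" by (simp add: unit_disc_def)
  have c1: "isCont f z0" "isCont f (z0 + d * of_real s)"
    using cont disc[OF z0] continuous_on_eq_continuous_at[OF o] by auto
  have "isCont (\<lambda>z. f (z + d * of_real s) - f z) z0"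
    by (intro continuous_intros c1 isCont_o2[where f="\<lambda>z. z + d * of_real s" and g=f])
  then obtain \<delta> where \<delta>: "\<delta> > 0"
    "\<And>z. dist z z0 < \<delta> \<Longrightarrow> dist (f (z + d * of_real s) - f z) (f (z0 + d * of_real s) - f z0) < e / 2 * s"
    using \<open>e > 0\<close> s unfolding continuous_at_eps_delta by (metis half_gt_zero mult_pos_pos)
  show "\<exists>\<delta>>0. \<forall>z\<in>E. dist z z0 < \<delta> \<longrightarrow> dist (p z) (p z0) < e"
  proof (intro exI[of _ \<delta>] conjI \<delta> ballI impI)
    fix z assume z: "z \<in> E" "dist z z0 < \<delta>"
    have A: "norm (f (w + d * of_real s) - f w - s *\<^sub>R p w) \<le> s / real (Suc k)" if "w \<in> E" for w
      using quotient_closeD(2)[OF subsetD[OF n that] sI] s by simp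
    let ?q = "\<lambda>w. f (w + d * of_real s) - f w"
    have "s *\<^sub>R (p z - p z0) = (?q z - ?q z0) - (?q z - s *\<^sub>R p z) + (?q z0 - s *\<^sub>R p z0)"
      by (simp add: algebra_simps)
    also have "norm \<dots> \<le> norm (?q z - ?q z0) + norm (?q z - s *\<^sub>R p z) + norm (?q z0 - s *\<^sub>R p z0)"
      by (meson add_mono norm_triangle_ineq norm_triangle_ineq4 order_refl order_trans)
    also have "\<dots> < e / 2 * s + s / real (Suc k) + s / real (Suc k)"
      using \<delta>(2)[OF z(2)] A[OF z(1)] A[OF z0] by (simp add: dist_norm)
    also have "\<dots> = s * (e / 2 + 2 * (1 / real (Suc k)))" by (simp add: algebra_simps)
    also have "\<dots> < s * e" using k s by (intro mult_strict_left_mono) auto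
    finally have "s * norm (p z - p z0) < s * e" using s by simp
    then show "dist (p z) (p z0) < e" using s by (simp add: dist_norm)
  qed
qed

text \<open>
  Going from \<open>z0\<close> to \<open>z\<close> through the corner \<open>z0 + h = z - \<i> t\<close>, the horizontal step is estimated from \<open>z0\<close> and the
  vertical one from \<open>z\<close>, so the corner itself need not belong to \<open>E\<close>.
\<close>

lemma quotient_close_imp_derivative:
  assumes cont: "continuous_on unit_disc f"
    and E1: "\<And>k. \<exists>n. E \<subseteq> quotient_close f p 1 k n"
    and E2: "\<And>k. \<exists>n. E \<subseteq> quotient_close f q \<i> k n" and z0: "z0 \<in> E"
  shows "(f has_derivative (\<lambda>w. Re w *\<^sub>R p z0 + Im w *\<^sub>R q z0)) (at z0 within E)"
  unfolding has_derivative_within_alt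
proof (intro conjI allI impI)
  show "bounded_linear (\<lambda>w. Re w *\<^sub>R p z0 + Im w *\<^sub>R q z0)"
    by (intro bounded_linear_add bounded_linear_scaleR_const bounded_linear_Re bounded_linear_Im)
  fix e :: real assume "e > 0"
  then obtain k where k: "1 / real (Suc k) < e / 4" using nat_approx_posE[of "e/4"] by auto
  obtain m n where m: "E \<subseteq> quotient_close f p 1 k m" and n: "E \<subseteq> quotient_close f q \<i> k n" using E1 E2 by blast
  have "continuous (at z0 within E) q"
    by (rule quotient_close_imp_continuous[OF cont _ E2 z0]) simp
  then obtain \<delta> where \<delta>: "\<delta> > 0" "\<And>z. z \<in> E \<Longrightarrow> dist z z0 < \<delta> \<Longrightarrow> dist (q z) (q z0) < e / 4"
    using \<open>e > 0\<close> unfolding continuous_within_eps_delta by (metis divide_pos_pos zero_less_numeral)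
  define r where "r = min \<delta> (min (1 / real (Suc m)) (1 / real (Suc n)))"
  show "\<exists>d>0. \<forall>z\<in>E. norm (z - z0) < d \<longrightarrow>
      norm (f z - f z0 - (Re (z - z0) *\<^sub>R p z0 + Im (z - z0) *\<^sub>R q z0)) \<le> e * norm (z - z0)"
  proof (intro exI[of _ r] conjI ballI impI)
    show "r > 0" using \<delta> by (simp add: r_def)
    fix z assume z: "z \<in> E" "norm (z - z0) < r"
    define h t where "h = Re (z - z0)" and "t = Im (z - z0)"
    have ht: "\<bar>h\<bar> \<le> norm (z - z0)" "\<bar>t\<bar> \<le> norm (z - z0)"
      unfolding h_def t_def by (rule abs_Re_le_cmod abs_Im_le_cmod)+
    have hI: "\<bar>h\<bar> < 1 / real (Suc m)" and tI: "\<bar>- t\<bar> < 1 / real (Suc n)"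
      using ht z(2) unfolding r_def by simp_all
    have corner: "z0 + 1 * of_real h = z + \<i> * of_real (- t)"
      by (simp add: complex_eq_iff h_def t_def)
    have A: "norm (f (z0 + 1 * of_real h) - f z0 - h *\<^sub>R p z0) \<le> \<bar>h\<bar> / real (Suc k)"
      by (rule quotient_closeD(2)[OF subsetD[OF m z0] hI])
    have B: "norm (f (z + \<i> * of_real (- t)) - f z - (- t) *\<^sub>R q z) \<le> \<bar>- t\<bar> / real (Suc k)"
      by (rule quotient_closeD(2)[OF subsetD[OF n z(1)] tI])
    have C: "norm (t *\<^sub>R (q z - q z0)) \<le> \<bar>t\<bar> * (e / 4)"
      using \<delta>(2)[OF z(1)] z(2) unfolding norm_scaleR by (intro mult_left_mono) (auto simp: r_def dist_norm)
    have "f z - f z0 - (h *\<^sub>R p z0 + t *\<^sub>R q z0) =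
      (f (z0 + 1 * of_real h) - f z0 - h *\<^sub>R p z0) - (f (z + \<i> * of_real (- t)) - f z - (- t) *\<^sub>R q z) + t *\<^sub>R (q z - q z0)"
      unfolding corner by (simp add: algebra_simps)
    also have "norm \<dots> \<le> norm (f (z0 + 1 * of_real h) - f z0 - h *\<^sub>R p z0) + norm (f (z + \<i> * of_real (- t)) - f z - (- t) *\<^sub>R q z) + norm (t *\<^sub>R (q z - q z0))"
      by (meson add_mono norm_triangle_ineq norm_triangle_ineq4 order_refl order_trans)
    also have "\<dots> \<le> \<bar>h\<bar> * (1 / real (Suc k)) + \<bar>t\<bar> * (1 / real (Suc k)) + \<bar>t\<bar> * (e / 4)"
      using A B C by simp
    also have "\<dots> \<le> norm (z - z0) * (e / 4) + norm (z - z0) * (e / 4) + norm (z - z0) * (e / 4)"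
      using ht k \<open>e > 0\<close> by (intro add_mono mult_mono) auto
    also have "\<dots> \<le> e * norm (z - z0)" using \<open>e > 0\<close> by (simp add: algebra_simps mult_right_mono)
    finally show "norm (f z - f z0 - (Re (z - z0) *\<^sub>R p z0 + Im (z - z0) *\<^sub>R q z0)) \<le> e * norm (z - z0)"
      by (simp add: h_def t_def)
  qed
qed

text \<open>Partial derivatives at a point do not yield a total derivative there. When the
  difference quotients in both directions converge uniformly on a set, they do yield a derivative
  relative to that set, and Egorov's theorem supplies countably many such sets that fill the disc up
  to a null set.\<close>

theorem differentiable_decomposition:
  assumes cont: "continuous_on unit_disc f"
    and p[measurable]: "p \<in> borel_measurable borel" and q[measurable]: "q \<in> borel_measurable borel"
    and ae: "AE z in lborel. z \<in> unit_disc \<longrightarrow> partials_at f z (p z) (q z)"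
  shows "\<exists>E :: nat \<Rightarrow> complex set. (\<forall>m. E m \<in> sets borel \<and> E m \<subseteq> unit_disc \<and>
      (\<forall>z\<in>E m. (f has_derivative (\<lambda>w. Re w *\<^sub>R p z + Im w *\<^sub>R q z)) (at z within E m))) \<and>
    (AE z in lborel. z \<in> unit_disc \<longrightarrow> (\<exists>m. z \<in> E m))"
proof -
  define P where "P k n = quotient_close f p 1 k n \<inter> quotient_close f q \<i> k n" for k n
  have inc: "incseq (P k)" for k
    using quotient_close_incseq[of f p 1] quotient_close_incseq[of f q \<i>]
    unfolding P_def incseq_def by blast
  have meas: "P k n \<in> sets lborel" for k n
    unfolding P_def using quotient_close_measurable[OF cont p, of 1] quotient_close_measurable[OF cont q, of \<i>] by auto
  have aeP: "AE z in lborel. z \<in> unit_disc \<longrightarrow> (\<forall>k. \<exists>n. z \<in> P k n)"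
    using ae
  proof eventually_elim
    case (elim z)
    show ?case
    proof (intro impI allI)
      fix k assume z: "z \<in> unit_disc"
      with elim have d: "((\<lambda>h::real. f (z + 1 * of_real h)) has_vector_derivative p z) (at 0)"
        "((\<lambda>h::real. f (z + \<i> * of_real h)) has_vector_derivative q z) (at 0)" by (auto simp: partials_at_def)
      obtain m n where m: "z \<in> quotient_close f p 1 k m" and n: "z \<in> quotient_close f q \<i> k n"
        using quotient_close_ex[where p=p and d=1, OF z d(1)] quotient_close_ex[where p=q and d="\<i>", OF z d(2)] by blast
      have "z \<in> P k (max m n)"
        using m n incseqD[OF quotient_close_incseq[of f p 1 k], of m "max m n"]
          incseqD[OF quotient_close_incseq[of f q \<i> k], of n "max m n"] by (auto simp: P_def)
      then show "\<exists>n. z \<in> P k n" by blast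
    qed
  qed
  have disc: "unit_disc \<in> sets lborel" "emeasure lborel unit_disc < \<infinity>"
    using emeasure_bounded_finite[OF bounded_ball, of "0::complex" 1] by (auto simp: unit_disc_def)
  obtain E :: "nat \<Rightarrow> complex set" where E0: "(\<forall>m. E m \<in> sets lborel \<and> E m \<subseteq> unit_disc \<and> (\<forall>k. \<exists>n. E m \<subseteq> P k n)) \<and>
    (AE x in lborel. x \<in> unit_disc \<longrightarrow> (\<exists>m. x \<in> E m))"
    using egorov_sets[OF disc meas inc aeP] by (rule exE)
  note E = conjunct1[OF E0] conjunct2[OF E0]
  have "(f has_derivative (\<lambda>w. Re w *\<^sub>R p z + Im w *\<^sub>R q z)) (at z within E m)" if z: "z \<in> E m" for m z
  proof (rule quotient_close_imp_derivative[OF cont _ _ z])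
    fix k
    obtain n where "E m \<subseteq> P k n" using E(1) by blast
    then show "\<exists>n. E m \<subseteq> quotient_close f p 1 k n" "\<exists>n. E m \<subseteq> quotient_close f q \<i> k n"
      unfolding P_def by blast+
  qed
  then show ?thesis using E by (intro exI[of _ E]) simp
qed

section \<open>The area of the image\<close>

text \<open>By invariance of domain the image of \<open>U\<close> is open, so the inverse extended
  by 0 is Borel. The image of \<open>S\<close> is the preimage of \<open>S\<close> under this
  extension, cut down to the image of \<open>U\<close>; the cut removes the points where the value 0
  is only a default.\<close>

lemma homeomorphism_borel_image:
  fixes f :: "complex \<Rightarrow> complex"
  assumes hom: "homeomorphism U (f ` U) f g" and U: "open U" and S: "S \<in> sets borel" "S \<subseteq> U"
  shows "f ` S \<in> sets borel"
proof -
  have cont: "continuous_on U f" "continuous_on (f ` U) g" and gf: "\<And>z. z \<in> U \<Longrightarrow> g (f z) = z"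
    using hom by (auto simp: homeomorphism_def)
  have inj: "inj_on f U" using gf by (metis inj_onI)
  have V: "open (f ` U)" by (rule invariance_of_domain[OF cont(1) U inj])
  define G where "G w = (if w \<in> f ` U then g w else 0)" for w
  have G: "G \<in> borel_measurable borel"
    unfolding G_def using cont V by (intro borel_measurable_continuous_on_if) auto
  have "f ` S = (G -` S \<inter> space borel) \<inter> f ` U"
  proof (intro equalityI subsetI)
    fix w assume "w \<in> f ` S"
    then obtain z where z: "z \<in> S" "w = f z" by blast
    then have "w \<in> f ` U" using S by blast
    moreover have "G w = z" using z S gf \<open>w \<in> f ` U\<close> by (simp add: G_def subset_iff)
    ultimately show "w \<in> (G -` S \<inter> space borel) \<inter> f ` U" using z by simp
  next
    fix w assume w: "w \<in> (G -` S \<inter> space borel) \<inter> f ` U"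
    then obtain z where z: "z \<in> U" "w = f z" by blast
    then have "G w = z" using gf by (auto simp: G_def)
    then show "w \<in> f ` S" using w z by auto
  qed
  moreover have "\<dots> \<in> sets borel"
    using measurable_sets[OF G S(1)] V by (intro sets.Int) auto
  ultimately show ?thesis by simp
qed

text \<open>The change of variables formula is exact on each differentiability piece, and
  injectivity keeps the images of disjoint pieces disjoint. The null set outside all pieces adds
  nothing on the left while its image may have positive area, so only an inequality results.\<close>

theorem nn_integral_jacobian_le_image:
  fixes f :: "complex \<Rightarrow> complex"
  assumes hom: "homeomorphism unit_disc (f ` unit_disc) f g"
    and p[measurable]: "p \<in> borel_measurable borel" and q[measurable]: "q \<in> borel_measurable borel"
    and ae: "AE z in lborel. z \<in> unit_disc \<longrightarrow> partials_at f z (p z) (q z)"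
    and S[measurable]: "S \<in> sets borel" and SU: "S \<subseteq> unit_disc"
    and B: "B \<in> sets borel" "bounded B" "f ` S \<subseteq> B"
  shows "(\<integral>\<^sup>+z\<in>S. ennreal \<bar>Re (p z) * Im (q z) - Re (q z) * Im (p z)\<bar> \<partial>lborel) \<le> emeasure lborel B"
proof -
  let ?J = "\<lambda>z. ennreal \<bar>Re (p z) * Im (q z) - Re (q z) * Im (p z)\<bar>"
  have cont: "continuous_on unit_disc f" and inj: "inj_on f unit_disc"
    using hom unfolding homeomorphism_def by (auto intro: inj_on_inverseI)
  from differentiable_decomposition[OF cont p q ae] obtain E :: "nat \<Rightarrow> complex set" where E0:
    "\<forall>m. E m \<in> sets borel \<and> E m \<subseteq> unit_disc \<and>
      (\<forall>z\<in>E m. (f has_derivative (\<lambda>w. Re w *\<^sub>R p z + Im w *\<^sub>R q z)) (at z within E m))"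
    and E2: "AE z in lborel. z \<in> unit_disc \<longrightarrow> (\<exists>m. z \<in> E m)" by (elim exE conjE) (rule that)
  have E[measurable]: "E m \<in> sets borel" for m using E0 by simp
  define D where "D m = disjointed E m \<inter> S" for m
  have Dm[measurable]: "D m \<in> sets borel" for m
    unfolding D_def using sets.range_disjointed_sets[of E borel] E by (intro sets.Int S) blast
  have DE: "D m \<subseteq> E m" "D m \<subseteq> S" for m unfolding D_def using disjointed_subset[of E m] by auto
  have Dd: "disjoint_family D"
    using disjoint_family_disjointed[of E] unfolding D_def disjoint_family_on_def by blast
  have DU: "(\<Union>m. D m) = (\<Union>m. E m) \<inter> S" unfolding D_def using UN_disjointed_eq[of E] by auto
  have fD: "f ` D m \<in> sets borel" for m
    using order_trans[OF DE(2) SU] by (intro homeomorphism_borel_image[OF hom] Dm) (simp_all add: unit_disc_def)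
  have "(\<integral>\<^sup>+z\<in>S. ?J z \<partial>lborel) = (\<integral>\<^sup>+z\<in>(\<Union>m. D m). ?J z \<partial>lborel)"
  proof (rule nn_integral_cong_AE)
    show "AE z in lborel. ?J z * indicator S z = ?J z * indicator (\<Union>m. D m) z"
      using E2
    proof eventually_elim
      case (elim z)
      then show ?case using SU unfolding DU by (auto simp: indicator_def)
    qed
  qed
  also have "\<dots> = (\<Sum>m. \<integral>\<^sup>+z\<in>D m. ?J z \<partial>lborel)"
    using Dd by (intro nn_integral_disjoint_family) auto
  also have "\<dots> = (\<Sum>m. emeasure lborel (f ` D m))"
  proof (rule suminf_cong)
    fix m
    have "(\<integral>\<^sup>+z\<in>D m. ennreal \<bar>jac (\<lambda>w. Re w *\<^sub>R p z + Im w *\<^sub>R q z)\<bar> \<partial>lborel) = emeasure lborel (f ` D m)"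
    proof (rule nn_integral_jacobian_image[OF Dm _ _ fD])
      show "(f has_derivative (\<lambda>w. Re w *\<^sub>R p z + Im w *\<^sub>R q z)) (at z within D m)" if "z \<in> D m" for z
        using E0 that DE by (meson has_derivative_subset subsetD)
      show "inj_on f (D m)" using inj DE SU by (meson inj_on_subset order_trans)
      show "bounded (f ` D m)" using B DE by (meson bounded_subset image_mono order_trans)
      show "(\<lambda>z. jac (\<lambda>w. Re w *\<^sub>R p z + Im w *\<^sub>R q z)) \<in> borel_measurable borel"
        unfolding jac_def by simp
    qed
    then show "(\<integral>\<^sup>+z\<in>D m. ?J z \<partial>lborel) = emeasure lborel (f ` D m)"
      by (simp add: jac_def)
  qed
  also have "\<dots> = emeasure lborel (\<Union>m. f ` D m)"
  proof (rule suminf_emeasure)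
    show "disjoint_family (\<lambda>m. f ` D m)"
      unfolding disjoint_family_on_def
    proof (intro ballI impI)
      fix m n :: nat assume "m \<noteq> n"
      then have "D m \<inter> D n = {}" using Dd by (auto simp: disjoint_family_on_def)
      then show "f ` D m \<inter> f ` D n = {}"
        using inj_on_image_Int[OF inj, of "D m" "D n"] DE SU by (metis image_empty order_trans)
    qed
  qed (use fD in auto)
  also have "\<dots> \<le> emeasure lborel B"
    using image_mono[OF DE(2), of f] B by (intro emeasure_mono UN_least) (auto intro: order_trans)
  finally show ?thesis .
qed

section \<open>The weak radial identity\<close>

text \<open>The outer square makes the truncated paraboloid differentiable across the circle of
  radius \<open>c\<close>, so the chain rule along a line meets no additional exceptional points.
  The gradient is of size 1/c and lives on a disc of area pi c^2, which makes the energy bound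
  independent of \<open>c\<close>.\<close>

definition cutoff :: "real \<Rightarrow> complex \<Rightarrow> real" where
  "cutoff c w = (max 0 (1 - (norm w)\<^sup>2 / c\<^sup>2))\<^sup>2"

definition cutoff_grad :: "real \<Rightarrow> complex \<Rightarrow> complex" where
  "cutoff_grad c w = (- 4 / c\<^sup>2 * max 0 (1 - (norm w)\<^sup>2 / c\<^sup>2)) *\<^sub>R w"

lemma has_real_derivative_max_square:
  "((\<lambda>s::real. (max 0 (1 - s))\<^sup>2) has_real_derivative - 2 * max 0 (1 - s)) (at s)"
proof -
  consider "s < 1" | "s = 1" | "s > 1" by linarith
  then show ?thesis
  proof cases
    case 1
    have "((\<lambda>s::real. (1 - s)\<^sup>2) has_real_derivative - 2 * (1 - s)) (at s)"
      by (auto intro!: derivative_eq_intros)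
    then have "((\<lambda>s::real. (max 0 (1 - s))\<^sup>2) has_real_derivative - 2 * (1 - s)) (at s)"
      by (rule has_field_derivative_transform_within_open[where S="{..<1}"]) (use 1 in auto)
    then show ?thesis using 1 by simp
  next
    case 3
    have "((\<lambda>s::real. 0) has_real_derivative 0) (at s)" by simp
    then have "((\<lambda>s::real. (max 0 (1 - s))\<^sup>2) has_real_derivative 0) (at s)"
      by (rule has_field_derivative_transform_within_open[where S="{1<..}"]) (use 3 in auto)
    then show ?thesis using 3 by simp
  next
    case 2
    \<comment> \<open>At the corner the function is bounded by the square of the distance to 1, so
      its derivative is 0.\<close>
    have key: "\<bar>(max 0 (1 - y))\<^sup>2\<bar> \<le> e * \<bar>y - 1\<bar>" if y: "\<bar>y - 1\<bar> < e" for e y :: real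
    proof -
      have "\<bar>(max 0 (1 - y))\<^sup>2\<bar> = max 0 (1 - y) * max 0 (1 - y)"
        by (simp add: power2_eq_square)
      also have "\<dots> \<le> \<bar>y - 1\<bar> * \<bar>y - 1\<bar>" by (intro mult_mono) auto
      also have "\<dots> \<le> e * \<bar>y - 1\<bar>" using y by (intro mult_right_mono) auto
      finally show ?thesis .
    qed
    have "((\<lambda>s::real. (max 0 (1 - s))\<^sup>2) has_derivative (\<lambda>h. 0)) (at 1)"
      unfolding has_derivative_at_alt using key by (auto intro!: exI)
    moreover have "(\<lambda>h::real. 0) = (*) 0" by auto
    ultimately show ?thesis using 2 by (simp add: has_field_derivative_def)
  qed
qed

lemma cutoff_has_derivative:
  "(cutoff c has_derivative (\<lambda>h. inner (cutoff_grad c w) h)) (at w)"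
proof -
  have 1: "((\<lambda>w. (norm w)\<^sup>2 / c\<^sup>2) has_derivative (\<lambda>h. 2 * inner w h / c\<^sup>2)) (at w)"
    unfolding power2_norm_eq_inner divide_inverse by (auto intro!: derivative_eq_intros simp: inner_commute)
  have 2: "((\<lambda>s::real. (max 0 (1 - s))\<^sup>2) has_derivative (\<lambda>h. - 2 * max 0 (1 - (norm w)\<^sup>2 / c\<^sup>2) * h)) (at ((norm w)\<^sup>2 / c\<^sup>2))"
    by (rule has_real_derivative_max_square[unfolded has_field_derivative_def])
  have "((\<lambda>w. (max 0 (1 - (norm w)\<^sup>2 / c\<^sup>2))\<^sup>2) has_derivative
     (\<lambda>h. - 2 * max 0 (1 - (norm w)\<^sup>2 / c\<^sup>2) * (2 * inner w h / c\<^sup>2))) (at w)"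
    using has_derivative_compose[OF 1 2] by simp
  moreover have "(\<lambda>h. - 2 * max 0 (1 - (norm w)\<^sup>2 / c\<^sup>2) * (2 * inner w h / c\<^sup>2)) = (\<lambda>h. inner (cutoff_grad c w) h)"
    by (auto simp: cutoff_grad_def fun_eq_iff)
  ultimately show ?thesis unfolding cutoff_def[abs_def] by simp
qed

lemma cutoff_outside: "c > 0 \<Longrightarrow> norm w \<ge> c \<Longrightarrow> cutoff c w = 0"
  and cutoff_grad_outside: "c > 0 \<Longrightarrow> norm w \<ge> c \<Longrightarrow> cutoff_grad c w = 0"
  using power_mono[of c "norm w" 2] by (auto simp: cutoff_def cutoff_grad_def max_def field_simps)

lemma cutoff_bounds: "0 \<le> cutoff c w" "cutoff c w \<le> 1"
  by (auto simp: cutoff_def power_le_one)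

lemma norm_cutoff_grad_le:
  assumes "c > 0"
  shows "norm (cutoff_grad c w) \<le> 4 / c"
proof (cases "norm w \<ge> c")
  case True
  then show ?thesis using cutoff_grad_outside[OF assms True] assms by simp
next
  case False
  have "norm (cutoff_grad c w) = 4 / c\<^sup>2 * max 0 (1 - (norm w)\<^sup>2 / c\<^sup>2) * norm w"
    by (simp add: cutoff_grad_def abs_mult)
  also have "\<dots> \<le> 4 / c\<^sup>2 * 1 * c"
    using False assms by (intro mult_mono) auto
  finally show ?thesis using assms by (simp add: power2_eq_square)
qed

lemma cutoff_lipschitz:
  assumes "c > 0"
  shows "\<bar>cutoff c w - cutoff c w'\<bar> \<le> 4 / c * norm (w - w')"
proof -
  have "norm (cutoff c w - cutoff c w') \<le> 4 / c * norm (w - w')"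
  proof (rule differentiable_bound[where S=UNIV and f'="\<lambda>w h. inner (cutoff_grad c w) h"])
    fix x :: complex
    show "(cutoff c has_derivative (\<lambda>h. inner (cutoff_grad c x) h)) (at x within UNIV)"
      using cutoff_has_derivative by simp
    show "onorm (\<lambda>h. inner (cutoff_grad c x) h) \<le> 4 / c"
      using assms
    proof (intro onorm_bound)
      fix h :: complex
      have "norm (inner (cutoff_grad c x) h) \<le> norm (cutoff_grad c x) * norm h" by (simp add: Cauchy_Schwarz_ineq2)
      also have "\<dots> \<le> 4 / c * norm h" by (intro mult_right_mono norm_cutoff_grad_le assms) auto
      finally show "norm (inner (cutoff_grad c x) h) \<le> 4 / c * norm h" .
    qed simp
  qed auto
  then show ?thesis by simp
qed

text \<open>Meant for the product of a Lipschitz function of \<phi> with a Lipschitz function of the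
  line parameter: its increments are controlled by those of \<phi> and of the identity
  together.\<close>

lemma abs_cont_dominated:
  assumes AC: "abs_cont_on_interval \<phi> a b" and "C > 0"
    and le: "\<And>s t. s \<in> {a..b} \<Longrightarrow> t \<in> {a..b} \<Longrightarrow> norm (F s - F t) \<le> C * (\<bar>s - t\<bar> + norm (\<phi> s - \<phi> t))"
  shows "abs_cont_on_interval F a b"
  unfolding abs_cont_on_interval_def
proof (intro allI impI)
  fix e :: real assume "e > 0"
  define e' where "e' = e / (2 * C)"
  have e': "e' > 0" using \<open>e > 0\<close> \<open>C > 0\<close> by (simp add: e'_def)
  obtain \<delta> where "\<delta> > 0 \<and> (\<forall>(n::nat) l r.
        (\<forall>k<n. a \<le> l k \<and> l k \<le> r k \<and> r k \<le> b) \<longrightarrow>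
        (\<forall>j<n. \<forall>k<n. j \<noteq> k \<longrightarrow> r j \<le> l k \<or> r k \<le> l j) \<longrightarrow>
        (\<Sum>k<n. r k - l k) < \<delta> \<longrightarrow> (\<Sum>k<n. norm (\<phi> (r k) - \<phi> (l k))) < e')"
    using AC[unfolded abs_cont_on_interval_def, rule_format, OF e'] by (rule exE)
  note \<delta> = conjunct1[OF this] conjunct2[OF this, rule_format]
  show "\<exists>\<delta>>0. \<forall>(n::nat) l r. (\<forall>k<n. a \<le> l k \<and> l k \<le> r k \<and> r k \<le> b) \<longrightarrow>
        (\<forall>j<n. \<forall>k<n. j \<noteq> k \<longrightarrow> r j \<le> l k \<or> r k \<le> l j) \<longrightarrow>
        (\<Sum>k<n. r k - l k) < \<delta> \<longrightarrow> (\<Sum>k<n. norm (F (r k) - F (l k))) < e"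
  proof (intro exI[of _ "min \<delta> e'"] conjI allI impI)
    show "min \<delta> e' > 0" using \<delta>(1) e' by simp
    fix n :: nat and l r :: "nat \<Rightarrow> real"
    assume A: "\<forall>k<n. a \<le> l k \<and> l k \<le> r k \<and> r k \<le> b"
      and B: "\<forall>j<n. \<forall>k<n. j \<noteq> k \<longrightarrow> r j \<le> l k \<or> r k \<le> l j" and S: "(\<Sum>k<n. r k - l k) < min \<delta> e'"
    have S2: "(\<Sum>k<n. norm (\<phi> (r k) - \<phi> (l k))) < e'"
      by (rule \<delta>(2)) (use A B S in auto)
    have "(\<Sum>k<n. norm (F (r k) - F (l k))) \<le> (\<Sum>k<n. C * ((r k - l k) + norm (\<phi> (r k) - \<phi> (l k))))"
    proof (rule sum_mono)
      fix k assume "k \<in> {..<n}"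
      then have "a \<le> l k" "l k \<le> r k" "r k \<le> b" using A by auto
      then show "norm (F (r k) - F (l k)) \<le> C * ((r k - l k) + norm (\<phi> (r k) - \<phi> (l k)))"
        using le[of "r k" "l k"] by simp
    qed
    also have "\<dots> = C * ((\<Sum>k<n. r k - l k) + (\<Sum>k<n. norm (\<phi> (r k) - \<phi> (l k))))"
      by (simp only: sum_distrib_left[symmetric] sum.distrib)
    also have "\<dots> < C * (e' + e')" using S S2 \<open>C > 0\<close> by (intro mult_strict_left_mono) auto
    also have "\<dots> = e" using \<open>C > 0\<close> by (simp add: e'_def)
    finally show "(\<Sum>k<n. norm (F (r k) - F (l k))) < e" .
  qed
qed

text \<open>Integration by parts on one line: the integrand is almost everywhere the derivative of
  \<open>cutoff c (\<phi> x - w0) * g x\<close>. This product is absolutely continuous and vanishes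
  at both ends, where \<phi> has left the disc of radius \<open>c\<close> about
  \<open>w0\<close>.\<close>

lemma cutoff_line_integral_zero:
  fixes \<phi> :: "real \<Rightarrow> complex" and g :: "real \<Rightarrow> real"
  assumes ab: "a \<le> b" and AC: "abs_cont_on_interval \<phi> a b" and N: "negligible N"
    and der: "\<And>x. x \<in> {a..b} - N \<Longrightarrow> (\<phi> has_vector_derivative \<phi>' x) (at x)"
    and g: "\<And>x. (g has_real_derivative g' x) (at x)" and g': "\<And>x. \<bar>g' x\<bar> \<le> C"
    and c: "c > 0" and ends: "norm (\<phi> a - w0) \<ge> c" "norm (\<phi> b - w0) \<ge> c"
  shows "((\<lambda>x. inner (cutoff_grad c (\<phi> x - w0)) (\<phi>' x) * g x + cutoff c (\<phi> x - w0) * g' x) has_integral 0) {a..b}"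
proof -
  define u where "u x = cutoff c (\<phi> x - w0)" for x
  \<comment> \<open>The real product is embedded into the complex numbers because
    \<open>abs_cont_on_interval\<close> is about complex-valued functions; the real part is taken at
    the end.\<close>
  define F where "F x = complex_of_real (u x * g x)" for x
  have C0: "C \<ge> 0" using g'[of a] by linarith
  have glip: "\<bar>g s - g t\<bar> \<le> C * \<bar>s - t\<bar>" for s t
    using field_differentiable_bound[of UNIV g g' C s t] g g' by simp
  define G where "G = \<bar>g a\<bar> + C * (b - a)"
  have G0: "G \<ge> 0" using C0 ab by (simp add: G_def)
  have gb: "\<bar>g s\<bar> \<le> G" if "s \<in> {a..b}" for s
  proof -
    have "\<bar>g s\<bar> \<le> \<bar>g a\<bar> + \<bar>g s - g a\<bar>" by linarith
    also have "\<bar>g s - g a\<bar> \<le> C * \<bar>s - a\<bar>" by (rule glip)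
    also have "C * \<bar>s - a\<bar> \<le> C * (b - a)" using that C0 by (intro mult_left_mono) auto
    finally show ?thesis by (simp add: G_def)
  qed
  have ACF: "abs_cont_on_interval F a b"
  proof (rule abs_cont_dominated[OF AC, of "G * (4 / c) + C + 1"])
    \<comment> \<open>\<open>4 / c\<close> is the Lipschitz constant of the bump, \<open>G\<close> a
      bound for \<open>g\<close> and \<open>C\<close> its Lipschitz constant; the summand 1 only
      ensures positivity.\<close>
    show "0 < G * (4 / c) + C + 1" using G0 C0 c by (intro add_nonneg_pos add_nonneg_nonneg) auto
    fix s t assume st: "s \<in> {a..b}" "t \<in> {a..b}"
    have "F s - F t = complex_of_real ((u s - u t) * g s + u t * (g s - g t))"
      by (simp add: F_def algebra_simps)
    then have "norm (F s - F t) = \<bar>(u s - u t) * g s + u t * (g s - g t)\<bar>" by (simp only: norm_of_real)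
    also have "\<dots> \<le> \<bar>u s - u t\<bar> * \<bar>g s\<bar> + \<bar>u t\<bar> * \<bar>g s - g t\<bar>"
      using abs_triangle_ineq by (metis abs_mult)
    also have "\<dots> \<le> (4 / c * norm (\<phi> s - \<phi> t)) * G + 1 * (C * \<bar>s - t\<bar>)"
    proof (intro add_mono mult_mono)
      show "\<bar>u s - u t\<bar> \<le> 4 / c * norm (\<phi> s - \<phi> t)"
        using cutoff_lipschitz[OF c, of "\<phi> s - w0" "\<phi> t - w0"] by (simp add: u_def)
      show "\<bar>u t\<bar> \<le> 1" using cutoff_bounds by (simp add: u_def)
    qed (use gb[OF st(1)] glip c in auto)
    also have "\<dots> \<le> (G * (4 / c) + C + 1) * norm (\<phi> s - \<phi> t) + (G * (4 / c) + C + 1) * \<bar>s - t\<bar>"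
    proof (intro add_mono)
      show "4 / c * norm (\<phi> s - \<phi> t) * G \<le> (G * (4 / c) + C + 1) * norm (\<phi> s - \<phi> t)"
        using mult_right_mono[of "G * (4 / c)" "G * (4 / c) + C + 1" "norm (\<phi> s - \<phi> t)"] C0 by (simp add: algebra_simps)
      have "C \<le> G * (4 / c) + C + 1" using G0 c by simp
      then show "1 * (C * \<bar>s - t\<bar>) \<le> (G * (4 / c) + C + 1) * \<bar>s - t\<bar>"
        by (simp add: mult_right_mono)
    qed
    finally show "norm (F s - F t) \<le> (G * (4 / c) + C + 1) * (\<bar>s - t\<bar> + norm (\<phi> s - \<phi> t))"
      by (simp add: algebra_simps)
  qed
  let ?I = "\<lambda>x. inner (cutoff_grad c (\<phi> x - w0)) (\<phi>' x) * g x + u x * g' x"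
  have "((\<lambda>x. complex_of_real (?I x)) has_integral F b - F a) {a..b}"
  proof (rule abs_cont_fundamental_theorem[OF ab ACF N])
    fix x assume x: "x \<in> {a..b} - N"
    have "((\<lambda>x. \<phi> x - w0) has_derivative (\<lambda>h. h *\<^sub>R \<phi>' x)) (at x)"
      using der[OF x] by (auto simp: has_vector_derivative_def intro!: derivative_eq_intros)
    from has_derivative_compose[OF this cutoff_has_derivative, of c]
    have "(u has_derivative (\<lambda>h. inner (cutoff_grad c (\<phi> x - w0)) (h *\<^sub>R \<phi>' x))) (at x)"
      by (simp add: u_def[abs_def])
    then have "(u has_real_derivative inner (cutoff_grad c (\<phi> x - w0)) (\<phi>' x)) (at x)"
      unfolding has_field_derivative_def by (rule has_derivative_eq_rhs) (auto simp: fun_eq_iff)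
    from DERIV_mult[OF this g] have "((\<lambda>x. u x * g x) has_real_derivative ?I x) (at x)"
      by (simp add: add.commute mult.commute)
    then have "((\<lambda>x. complex_of_real (u x * g x)) has_vector_derivative complex_of_real (?I x)) (at x)"
      by (rule has_vector_derivative_of_real)
    then show "(F has_vector_derivative complex_of_real (?I x)) (at x within {a..b})"
      unfolding F_def[abs_def] by (rule has_vector_derivative_at_within)
  qed
  moreover have "F a = 0" "F b = 0" using ends c by (simp_all add: F_def u_def cutoff_outside)
  ultimately have "((\<lambda>x. complex_of_real (?I x)) has_integral 0) {a..b}" by simp
  from has_integral_linear[OF this bounded_linear_Re] show ?thesis
    by (simp add: o_def u_def)
qed

section \<open>Fubini on horizontal and vertical lines\<close>

text \<open>The exceptional set is enlarged to a Borel null set, to which Fubini and the exchange of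
  the two coordinates apply. Both orders are wanted: one partial derivative is integrated along
  horizontal lines, the other along vertical ones.\<close>

lemma AE_complex_lines:
  assumes "AE z in lborel. P z"
  shows "AE y in lborel. AE x in lborel. P (Complex x y)"
    and "AE x in lborel. AE y in lborel. P (Complex x y)"
proof -
  obtain N where N: "{z. \<not> P z} \<subseteq> N" "N \<in> null_sets lborel"
    using assms unfolding eventually_ae_filter by auto
  then have [measurable]: "N \<in> sets borel" by auto
  have m[measurable]: "(\<lambda>(x, y). Complex x y) \<in> borel_measurable (lborel \<Otimes>\<^sub>M lborel)"
    unfolding Complex_eq case_prod_unfold by measurable
  have "AE z in (lborel :: complex measure). z \<notin> N" using N(2) by (rule AE_not_in)
  then have "AE p in lborel \<Otimes>\<^sub>M lborel. (case p of (x, y) \<Rightarrow> Complex x y) \<notin> N"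
    by (subst (asm) lborel_complex_eq_distr_pair, subst (asm) AE_distr_iff) auto
  then have A: "AE x in lborel. AE y in lborel. Complex x y \<notin> N"
    using lborel_pair.AE_pair by fastforce
  then show "AE x in lborel. AE y in lborel. P (Complex x y)"
    using N by (elim eventually_mono) blast
  have "{p \<in> space (lborel \<Otimes>\<^sub>M lborel). Complex (fst p) (snd p) \<notin> N} \<in> sets (lborel \<Otimes>\<^sub>M lborel)"
    using measurable_sets[OF m, of "- N"] by (auto simp: vimage_def case_prod_unfold Int_def space_pair_measure)
  from lborel_pair.AE_commute[OF this] A have "AE y in lborel. AE x in lborel. Complex x y \<notin> N" by simp
  then show "AE y in lborel. AE x in lborel. P (Complex x y)"
    using N by (elim eventually_mono) blast
qed

text \<open>On a single line the vanishing is known as a gauge integral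
  (\<open>has_integral\<close>). It transfers to the Lebesgue integral only where the latter exists,
  and Fubini guarantees that on almost every line; hence the conditional premises.\<close>

lemma integral_complex_eq_zero_of_lines:
  fixes H :: "complex \<Rightarrow> real"
  assumes H: "integrable lborel H"
  shows "(AE y in lborel. integrable lborel (\<lambda>x. H (Complex x y)) \<longrightarrow> (\<integral>x. H (Complex x y) \<partial>lborel) = 0) \<Longrightarrow> integral\<^sup>L lborel H = 0"
    and "(AE x in lborel. integrable lborel (\<lambda>y. H (Complex x y)) \<longrightarrow> (\<integral>y. H (Complex x y) \<partial>lborel) = 0) \<Longrightarrow> integral\<^sup>L lborel H = 0"
proof -
  have m[measurable]: "(\<lambda>(x, y). Complex x y) \<in> measurable (lborel \<Otimes>\<^sub>M lborel) borel"
    unfolding Complex_eq case_prod_unfold by measurable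
  have Hm[measurable]: "H \<in> borel_measurable borel" using H by auto
  have I: "integrable (lborel \<Otimes>\<^sub>M lborel) (\<lambda>(x, y). H (Complex x y))"
    using H by (subst (asm) lborel_complex_eq_distr_pair, subst (asm) integrable_distr_eq) (auto simp: case_prod_unfold)
  have E: "integral\<^sup>L lborel H = integral\<^sup>L (lborel \<Otimes>\<^sub>M lborel) (\<lambda>(x, y). H (Complex x y))"
    by (subst lborel_complex_eq_distr_pair, subst integral_distr) (auto simp: case_prod_unfold)
  {
    assume Z: "AE x in lborel. integrable lborel (\<lambda>y. H (Complex x y)) \<longrightarrow> (\<integral>y. H (Complex x y) \<partial>lborel) = 0"
    have "integral\<^sup>L lborel H = (\<integral>x. (\<integral>y. H (Complex x y) \<partial>lborel) \<partial>lborel)"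
      using lborel_pair.integral_fst'[OF I] E by simp
    also have "\<dots> = 0"
      using lborel_pair.AE_integrable_fst'[OF I] Z by (intro integral_eq_zero_AE) (auto elim: eventually_elim2)
    finally show "integral\<^sup>L lborel H = 0" .
  }
  {
    assume Z: "AE y in lborel. integrable lborel (\<lambda>x. H (Complex x y)) \<longrightarrow> (\<integral>x. H (Complex x y) \<partial>lborel) = 0"
    have "integral\<^sup>L lborel H = (\<integral>y. (\<integral>x. H (Complex x y) \<partial>lborel) \<partial>lborel)"
      using lborel_pair.integral_snd[OF I] E by simp
    also have "\<dots> = 0"
      using lborel_pair.AE_integrable_snd[OF I] Z by (intro integral_eq_zero_AE) (auto elim: eventually_elim2)
    finally show "integral\<^sup>L lborel H = 0" .
  }
qed

section \<open>Pointwise consequences of the equation and measurability\<close>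

text \<open>Let a and b be the z- and conjugate-z-derivatives and k = (K - 1) / (K + 1). Then |b| =
  k |a|, and J = |a|^2 - |b|^2 = (1 - k^2) |a|^2. The argument of the coefficient is chosen so that
  the radial derivative z a + cnj z b collapses to (1 - k) z a. The factor 1 / K is (1 - k) / (1 +
  k), and the factor K in the last two bounds is (1 + k) / (1 - k), as both partials have norm at
  most (1 + k) |a|.\<close>

lemma radial_beltrami_identities:
  fixes z p q :: complex and K :: real
  assumes K: "K \<ge> 1" and z: "z \<noteq> 0"
    and eq: "(p + \<i> * q) / 2 = (- of_real ((K - 1) / (K + 1)) * (z / cnj z)) * ((p - \<i> * q) / 2)"
  defines "J \<equiv> Re p * Im q - Re q * Im p"
  shows "J \<ge> 0" "(norm (Re z *\<^sub>R p + Im z *\<^sub>R q))\<^sup>2 = (norm z)\<^sup>2 * J / K"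
    "(norm p)\<^sup>2 \<le> K * J" "(norm q)\<^sup>2 \<le> K * J"
proof -
  define k where "k = (K - 1) / (K + 1)"
  define a where "a = (p - \<i> * q) / 2"
  define b where "b = (p + \<i> * q) / 2"
  have b: "b = - of_real k * (z / cnj z) * a" using eq by (simp add: a_def b_def k_def)
  have k: "0 \<le> k" "1 - k = 2 / (K + 1)" "1 + k = 2 * K / (K + 1)" using K by (auto simp: k_def field_simps)
  have nb: "norm b = k * norm a" using z k by (simp add: b norm_mult norm_divide)
  have pq: "p = a + b" "q = \<i> * (a - b)" by (simp_all add: a_def b_def field_simps)
  have J: "J = (norm a)\<^sup>2 - (norm b)\<^sup>2"
    unfolding J_def pq cmod_power2 by (simp add: algebra_simps power2_eq_square)
  have J2: "J = ((1 - k) * (1 + k)) * (norm a)\<^sup>2" unfolding J nb by (simp add: power2_eq_square algebra_simps)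
  have J3: "J = 4 * K / (K + 1)\<^sup>2 * (norm a)\<^sup>2" unfolding J2 k by (simp add: power2_eq_square)
  show "J \<ge> 0" using J3 K by simp
  have "Re z *\<^sub>R p + Im z *\<^sub>R q = z * a + cnj z * b"
    unfolding pq by (simp add: complex_eq_iff algebra_simps)
  also have "cnj z * b = - of_real k * z * a" using z by (simp add: b)
  also have "z * a + - of_real k * z * a = of_real (1 - k) * z * a" by (simp add: algebra_simps)
  finally have "norm (Re z *\<^sub>R p + Im z *\<^sub>R q) = \<bar>1 - k\<bar> * norm z * norm a"
    by (simp only: norm_mult norm_of_real)
  then have "(norm (Re z *\<^sub>R p + Im z *\<^sub>R q))\<^sup>2 = (1 - k)\<^sup>2 * (norm z)\<^sup>2 * (norm a)\<^sup>2"
    by (simp add: power_mult_distrib)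
  also have "\<dots> = (norm z)\<^sup>2 * J / K" unfolding J3 k using K by (simp add: power_divide)
  finally show "(norm (Re z *\<^sub>R p + Im z *\<^sub>R q))\<^sup>2 = (norm z)\<^sup>2 * J / K" .
  have KJ: "K * J = ((1 + k) * norm a)\<^sup>2"
    unfolding J3 k by (simp add: power2_eq_square)
  have "norm p \<le> (1 + k) * norm a" unfolding pq using norm_triangle_ineq[of a b] nb by (simp add: algebra_simps)
  then show "(norm p)\<^sup>2 \<le> K * J" unfolding KJ by (intro power_mono) auto
  have "norm q \<le> (1 + k) * norm a" unfolding pq using norm_triangle_ineq4[of a b] nb unfolding norm_mult by (simp add: algebra_simps)
  then show "(norm q)\<^sup>2 \<le> K * J" unfolding KJ by (intro power_mono) auto
qed

text \<open>The partials are limits of difference quotients with steps 1 / (n + 1) of a Borel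
  extension of \<open>f\<close>. Since \<open>lim\<close> is total, the resulting functions are
  Borel on the whole plane, with unspecified values where a partial does not exist.\<close>

lemma borel_measurable_partials:
  assumes cont: "continuous_on unit_disc f"
  shows "\<exists>p q. p \<in> borel_measurable borel \<and> q \<in> borel_measurable borel \<and>
    (\<forall>z\<in>unit_disc. \<forall>a b. partials_at f z a b \<longrightarrow> p z = a \<and> q z = b)"
proof -
  define F where "F z = (if z \<in> unit_disc then f z else 0)" for z
  have Fm[measurable]: "F \<in> borel_measurable borel"
    unfolding F_def using cont by (intro borel_measurable_continuous_on_if) (auto simp: unit_disc_def)
  define Q where "Q d z n = real (Suc n) *\<^sub>R (F (z + d * of_real (1 / real (Suc n))) - F z)" for d z n
  have Qm: "(\<lambda>z. lim (Q d z)) \<in> borel_measurable borel" for d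
    unfolding Q_def by (rule borel_measurable_lim_metric) measurable
  have lim: "lim (Q d z) = a" if z: "z \<in> unit_disc"
    and der: "((\<lambda>h::real. f (z + d * of_real h)) has_vector_derivative a) (at 0)" for d z a
  proof -
    have h0: "(\<lambda>n. 1 / real (Suc n)) \<longlonglongrightarrow> 0"
      using LIMSEQ_inverse_real_of_nat unfolding inverse_eq_divide .
    then have h: "filterlim (\<lambda>n. 1 / real (Suc n)) (at 0) sequentially"
      unfolding filterlim_at by simp
    have "((\<lambda>y. norm (f (z + d * of_real y) - f z - y *\<^sub>R a) / norm y) \<longlongrightarrow> 0) (at 0)"
      using der by (simp add: has_vector_derivative_def has_derivative_iff_norm)
    from filterlim_compose[OF this h]
    have T: "(\<lambda>n. norm (f (z + d * of_real (1 / real (Suc n))) - f z - (1 / real (Suc n)) *\<^sub>R a) / norm (1 / real (Suc n))) \<longlonglongrightarrow> 0" .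
    have rescale: "norm (X - (1 / r) *\<^sub>R a) / norm (1 / r) = norm (r *\<^sub>R X - a)" if "r > 0" for X and r :: real
    proof -
      have "r *\<^sub>R X - a = r *\<^sub>R (X - (1 / r) *\<^sub>R a)" using that by (simp add: scaleR_diff_right)
      then have "norm (r *\<^sub>R X - a) = r * norm (X - (1 / r) *\<^sub>R a)" using that by (simp only: norm_scaleR abs_of_pos)
      then show ?thesis using that by simp
    qed
    have "(\<lambda>n. norm (real (Suc n) *\<^sub>R (f (z + d * of_real (1 / real (Suc n))) - f z) - a)) \<longlonglongrightarrow> 0"
      by (rule Lim_transform_eventually[OF T], intro always_eventually allI rescale) simp
    then have L: "(\<lambda>n. real (Suc n) *\<^sub>R (f (z + d * of_real (1 / real (Suc n))) - f z)) \<longlonglongrightarrow> a"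
      by (rule LIM_zero_cancel[OF tendsto_norm_zero_cancel])
    have "(\<lambda>n. z + d * of_real (1 / real (Suc n))) \<longlonglongrightarrow> z + d * of_real 0"
      by (intro tendsto_intros h0)
    then have "eventually (\<lambda>n. z + d * of_real (1 / real (Suc n)) \<in> unit_disc) sequentially"
      using z by (intro topological_tendstoD) (auto simp: unit_disc_def)
    then have "eventually (\<lambda>n. real (Suc n) *\<^sub>R (f (z + d * of_real (1 / real (Suc n))) - f z) = Q d z n) sequentially"
      by eventually_elim (use z in \<open>simp add: Q_def F_def\<close>)
    from Lim_transform_eventually[OF L this] show ?thesis by (rule limI)
  qed
  have "lim (Q 1 z) = a \<and> lim (Q \<i> z) = b" if "z \<in> unit_disc" "partials_at f z a b" for z a b
    using that by (intro conjI lim) (auto simp: partials_at_def)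
  then show ?thesis using Qm by blast
qed

text \<open>One component of the field z / (|z|^2 + \<epsilon>), restricted to a line parallel to
  its axis; \<open>k\<close> is \<epsilon> plus the square of the fixed coordinate.\<close>

lemma radial_component_derivative:
  fixes k :: real
  assumes "k > 0"
  shows "((\<lambda>x. x / (x\<^sup>2 + k)) has_real_derivative (k - x\<^sup>2) / (x\<^sup>2 + k)\<^sup>2) (at x)"
    and "\<bar>(k - x\<^sup>2) / (x\<^sup>2 + k)\<^sup>2\<bar> \<le> 1 / k"
proof -
  have pos: "x\<^sup>2 + k > 0" using assms by (simp add: add_nonneg_pos)
  show "((\<lambda>x. x / (x\<^sup>2 + k)) has_real_derivative (k - x\<^sup>2) / (x\<^sup>2 + k)\<^sup>2) (at x)"
    using pos by (auto intro!: derivative_eq_intros simp: power2_eq_square algebra_simps)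
  have "\<bar>k - x\<^sup>2\<bar> \<le> x\<^sup>2 + k" using assms by (auto simp: abs_if)
  then have "\<bar>k - x\<^sup>2\<bar> / (x\<^sup>2 + k)\<^sup>2 \<le> (x\<^sup>2 + k) / (x\<^sup>2 + k)\<^sup>2" by (intro divide_right_mono) auto
  also have "\<dots> = 1 / (x\<^sup>2 + k)" using pos by (simp add: power2_eq_square)
  also have "\<dots> \<le> 1 / k" using assms by (intro frac_le) auto
  finally show "\<bar>(k - x\<^sup>2) / (x\<^sup>2 + k)\<^sup>2\<bar> \<le> 1 / k" by (simp add: abs_divide)
qed

text \<open>A closed rectangle inside the disc, as \<open>ACL_on\<close> requires, whose boundary
  keeps distance at least 1/2 from 0. The bump composed with \<open>f\<close> will vanish from that
  distance on, so there are no boundary terms.\<close>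

definition half_square :: "complex set" where
  "half_square = {z. - 1/2 \<le> Re z \<and> Re z \<le> 1/2 \<and> - 1/2 \<le> Im z \<and> Im z \<le> 1/2}"

lemma half_square_subset_disc: "half_square \<subseteq> unit_disc"
proof
  fix z assume "z \<in> half_square"
  then have "\<bar>Re z\<bar> \<le> 1/2" "\<bar>Im z\<bar> \<le> 1/2" by (auto simp: half_square_def)
  then have "(Re z)\<^sup>2 \<le> (1/2)\<^sup>2" "(Im z)\<^sup>2 \<le> (1/2)\<^sup>2" by (metis abs_ge_zero power2_abs power_mono)+
  then have "(norm z)\<^sup>2 < 1\<^sup>2" unfolding cmod_power2 by (simp add: power_divide)
  then show "z \<in> unit_disc" by (simp add: unit_disc_def power2_less_imp_less)
qed

lemma half_square_borel [measurable]: "half_square \<in> sets borel"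
  and half_square_finite: "emeasure lborel half_square < \<infinity>"
proof -
  have eq: "half_square = cbox (Complex (- 1/2) (- 1/2)) (Complex (1/2) (1/2))"
    by (auto simp: half_square_def in_cbox_complex_iff)
  show "half_square \<in> sets borel" unfolding eq by simp
  show "emeasure lborel half_square < \<infinity>" unfolding eq by (rule emeasure_bounded_finite) simp
qed

lemma cutoff_measurable [measurable]: "cutoff c \<in> borel_measurable borel"
  "cutoff_grad c \<in> borel_measurable borel"
  unfolding cutoff_def[abs_def] cutoff_grad_def[abs_def] by measurable

lemma line_derivative_of_partials:
  assumes "partials_at f (Complex x y) p q"
  shows "((\<lambda>t. f (Complex t y)) has_vector_derivative p) (at x)"
    and "((\<lambda>t. f (Complex x t)) has_vector_derivative q) (at y)"
proof -
  have 1: "((\<lambda>t. t - x) has_vector_derivative 1) (at x)" for x :: real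
    by (auto intro!: derivative_eq_intros)
  have eq1: "Complex x y + of_real (t - x) = Complex t y" and eq2: "Complex x y + \<i> * of_real (t - y) = Complex x t" for t
    by (simp_all add: complex_eq_iff)
  have "((\<lambda>h. f (Complex x y + of_real h)) has_vector_derivative p) (at (x - x))"
    using assms by (simp add: partials_at_def)
  from vector_diff_chain_at[OF 1 this]
  show "((\<lambda>t. f (Complex t y)) has_vector_derivative p) (at x)"
    by (simp only: o_def eq1 scaleR_one)
  have "((\<lambda>h. f (Complex x y + \<i> * of_real h)) has_vector_derivative q) (at (y - y))"
    using assms by (simp add: partials_at_def)
  from vector_diff_chain_at[OF 1 this]
  show "((\<lambda>t. f (Complex x t)) has_vector_derivative q) (at y)"
    by (simp only: o_def eq2 scaleR_one)
qed

lemma AE_negligible: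
  assumes "AE x in lborel. P x"
  shows "negligible {x. \<not> P (x::real)}"
proof -
  obtain N where "{x. \<not> P x} \<subseteq> N" "N \<in> null_sets lborel"
    using assms unfolding eventually_ae_filter by auto
  then show ?thesis
    using negligible_iff_null_sets negligible_subset null_sets_completionI by blast
qed

lemma integral_zero_of_has_integral:
  fixes H :: "real \<Rightarrow> real"
  assumes I: "integrable lborel H" and z: "(h has_integral 0) {a..b}"
    and H: "\<And>x. H x = (if x \<in> {a..b} then h x else 0)"
  shows "integral\<^sup>L lborel H = 0"
proof -
  have "(H has_integral 0) UNIV"
  proof -
    have "H = (\<lambda>x. if x \<in> {a..b} then h x else 0)" using H by (intro ext)
    then show ?thesis using z by (simp only: has_integral_restrict_UNIV)
  qed
  moreover have "(H has_integral integral\<^sup>L lborel H) UNIV" using I by (rule has_integral_integral_real)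
  ultimately show ?thesis by (rule has_integral_unique[symmetric])
qed

text \<open>Here \<open>V\<close> will be a component of the regularised field and \<open>V'\<close>
  its derivative, both bounded on the square. The gradient of the bump confines the first integrand
  to the set where \<open>F\<close> is close to \<open>w0\<close>, the only place where the partial
  has to be integrable.\<close>

lemma cutoff_integrable:
  assumes [measurable]: "F \<in> borel_measurable borel" "p \<in> borel_measurable borel" "V \<in> borel_measurable borel" "V' \<in> borel_measurable borel"
    and c: "c > 0" and fin: "(\<integral>\<^sup>+z\<in>{z\<in>half_square. norm (F z - w0) < c}. ennreal (norm (p z)) \<partial>lborel) < \<infinity>"
    and V: "\<And>z. z \<in> half_square \<Longrightarrow> \<bar>V z\<bar> \<le> B" and V': "\<And>z. z \<in> half_square \<Longrightarrow> \<bar>V' z\<bar> \<le> B"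
  shows "integrable lborel (\<lambda>z. indicator half_square z * (inner (cutoff_grad c (F z - w0)) (p z) * V z))"
    and "integrable lborel (\<lambda>z. indicator half_square z * (cutoff c (F z - w0) * V' z))"
proof -
  have "0 \<in> half_square" by (simp add: half_square_def)
  then have B: "B \<ge> 0" using V by force
  show "integrable lborel (\<lambda>z. indicator half_square z * (inner (cutoff_grad c (F z - w0)) (p z) * V z))"
  proof (rule integrableI_bounded)
    let ?\<Omega> = "{z\<in>half_square. norm (F z - w0) < c}"
    have pt: "norm (indicator half_square z * (inner (cutoff_grad c (F z - w0)) (p z) * V z))
        \<le> 4 / c * B * (norm (p z) * indicator ?\<Omega> z)" for z
    proof (cases "z \<in> ?\<Omega>")
      case True
      then have "norm (indicator half_square z * (inner (cutoff_grad c (F z - w0)) (p z) * V z)) = \<bar>inner (cutoff_grad c (F z - w0)) (p z)\<bar> * \<bar>V z\<bar>"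
        by (simp add: abs_mult)
      also have "\<dots> \<le> (norm (cutoff_grad c (F z - w0)) * norm (p z)) * B"
        using True V B by (intro mult_mono Cauchy_Schwarz_ineq2) auto
      also have "\<dots> \<le> (4 / c * norm (p z)) * B"
        using B by (intro mult_right_mono norm_cutoff_grad_le c) auto
      finally show ?thesis using True by (simp add: mult_ac)
    next
      case False
      then have "z \<notin> half_square \<or> cutoff_grad c (F z - w0) = 0" using cutoff_grad_outside[OF c] by force
      then show ?thesis using False by auto
    qed
    have "(\<integral>\<^sup>+z. ennreal (norm (indicator half_square z * (inner (cutoff_grad c (F z - w0)) (p z) * V z))) \<partial>lborel)
       \<le> (\<integral>\<^sup>+z. ennreal (4 / c * B) * (ennreal (norm (p z)) * indicator ?\<Omega> z) \<partial>lborel)"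
    proof (rule nn_integral_mono)
      fix z
      have "ennreal (norm (indicator half_square z * (inner (cutoff_grad c (F z - w0)) (p z) * V z)))
         \<le> ennreal (4 / c * B * (norm (p z) * indicator ?\<Omega> z))" by (intro ennreal_leI pt)
      also have "\<dots> = ennreal (4 / c * B) * (ennreal (norm (p z)) * indicator ?\<Omega> z)"
      proof -
        have "ennreal (4 / c * B * (norm (p z) * indicator ?\<Omega> z)) = ennreal (4 / c * B) * ennreal (norm (p z) * indicator ?\<Omega> z)"
          using B c by (intro ennreal_mult) auto
        also have "ennreal (norm (p z) * indicator ?\<Omega> z) = ennreal (norm (p z)) * indicator ?\<Omega> z"
          by (simp add: indicator_def)
        finally show ?thesis .
      qed
      finally show "ennreal (norm (indicator half_square z * (inner (cutoff_grad c (F z - w0)) (p z) * V z)))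
         \<le> ennreal (4 / c * B) * (ennreal (norm (p z)) * indicator ?\<Omega> z)" .
    qed
    also have "\<dots> = ennreal (4 / c * B) * (\<integral>\<^sup>+z\<in>?\<Omega>. ennreal (norm (p z)) \<partial>lborel)"
      by (rule nn_integral_cmult) measurable
    also have "\<dots> < \<infinity>" using fin by (simp add: ennreal_mult_less_top)
    finally show "(\<integral>\<^sup>+z. ennreal (norm (indicator half_square z * (inner (cutoff_grad c (F z - w0)) (p z) * V z))) \<partial>lborel) < \<infinity>" .
  qed measurable
  show "integrable lborel (\<lambda>z. indicator half_square z * (cutoff c (F z - w0) * V' z))"
  proof (rule integrableI_bounded_set[where A=half_square and B=B])
    show "AE z in lborel. z \<in> half_square \<longrightarrow> norm (indicator half_square z * (cutoff c (F z - w0) * V' z)) \<le> B"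
    proof (intro AE_I2 impI)
      fix z assume z: "z \<in> half_square"
      have "\<bar>cutoff c (F z - w0)\<bar> * \<bar>V' z\<bar> \<le> 1 * B"
        using cutoff_bounds[of c "F z - w0"] V'[OF z] by (intro mult_mono) auto
      then show "norm (indicator half_square z * (cutoff c (F z - w0) * V' z)) \<le> B" using z by (simp add: abs_mult)
    qed
  qed (use half_square_finite in auto)
qed

text \<open>
  The divergence theorem for \<open>cutoff c (f - w0)\<close> times the field \<open>z / (|z|\<^sup>2 + \<epsilon>)\<close>, whose divergence is
  \<open>2 \<epsilon> / (|z|\<^sup>2 + \<epsilon>)\<^sup>2\<close>. The function \<open>F\<close> stands for a Borel extension of \<open>f\<close> outside the disc.
\<close>

theorem weak_radial_identity:
  fixes f F p q :: "complex \<Rightarrow> complex"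
  assumes ACL: "ACL_on unit_disc f" and mF: "F \<in> borel_measurable borel"
    and mp: "p \<in> borel_measurable borel" and mq: "q \<in> borel_measurable borel"
    and Ff: "\<And>z. z \<in> unit_disc \<Longrightarrow> F z = f z"
    and ae: "AE z in lborel. z \<in> unit_disc \<longrightarrow> partials_at f z (p z) (q z)"
    and c: "c > 0" and \<epsilon>: "\<epsilon> > 0"
    and outside: "\<And>z. z \<in> unit_disc \<Longrightarrow> norm z \<ge> 1/2 \<Longrightarrow> norm (f z - w0) \<ge> c"
    and fin: "(\<integral>\<^sup>+z\<in>{z\<in>half_square. norm (F z - w0) < c}. ennreal (norm (p z)) \<partial>lborel) < \<infinity>"
      "(\<integral>\<^sup>+z\<in>{z\<in>half_square. norm (F z - w0) < c}. ennreal (norm (q z)) \<partial>lborel) < \<infinity>"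
  defines "T \<equiv> \<lambda>z. indicator half_square z * (inner (cutoff_grad c (F z - w0)) (Re z *\<^sub>R p z + Im z *\<^sub>R q z) / ((norm z)\<^sup>2 + \<epsilon>))"
    and "W \<equiv> \<lambda>z. indicator half_square z * (cutoff c (F z - w0) * (2 * \<epsilon> / ((norm z)\<^sup>2 + \<epsilon>)\<^sup>2))"
  shows "integrable lborel T" "integrable lborel W" "integral\<^sup>L lborel W = - integral\<^sup>L lborel T"
proof -
  \<comment> \<open>The denominators are grouped as a square plus a constant on the line, so that
    \<open>radial_component_derivative\<close> applies to each line literally.\<close>
  define V1 V1' V2 V2' where "V1 z = Re z / ((Re z)\<^sup>2 + ((Im z)\<^sup>2 + \<epsilon>))"
    and "V1' z = ((Im z)\<^sup>2 + \<epsilon> - (Re z)\<^sup>2) / ((Re z)\<^sup>2 + ((Im z)\<^sup>2 + \<epsilon>))\<^sup>2"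
    and "V2 z = Im z / ((Im z)\<^sup>2 + ((Re z)\<^sup>2 + \<epsilon>))"
    and "V2' z = ((Re z)\<^sup>2 + \<epsilon> - (Im z)\<^sup>2) / ((Im z)\<^sup>2 + ((Re z)\<^sup>2 + \<epsilon>))\<^sup>2" for z :: complex
  note Vdefs = V1_def V1'_def V2_def V2'_def
  have mV: "V1 \<in> borel_measurable borel" "V1' \<in> borel_measurable borel" "V2 \<in> borel_measurable borel" "V2' \<in> borel_measurable borel"
    unfolding Vdefs[abs_def] by measurable
  have Vb: "\<bar>x / (x\<^sup>2 + (y\<^sup>2 + \<epsilon>))\<bar> \<le> 1 / \<epsilon>" if "\<bar>x\<bar> \<le> 1" for x y :: real
  proof -
    have "\<bar>x / (x\<^sup>2 + (y\<^sup>2 + \<epsilon>))\<bar> = \<bar>x\<bar> / (x\<^sup>2 + (y\<^sup>2 + \<epsilon>))" using \<epsilon> by (simp add: abs_divide)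
    also have "\<dots> \<le> 1 / \<epsilon>" using that \<epsilon> by (intro frac_le) auto
    finally show ?thesis .
  qed
  have Vb': "\<bar>((y\<^sup>2 + \<epsilon>) - x\<^sup>2) / (x\<^sup>2 + (y\<^sup>2 + \<epsilon>))\<^sup>2\<bar> \<le> 1 / \<epsilon>" for x y :: real
  proof -
    have "\<bar>((y\<^sup>2 + \<epsilon>) - x\<^sup>2) / (x\<^sup>2 + (y\<^sup>2 + \<epsilon>))\<^sup>2\<bar> \<le> 1 / (y\<^sup>2 + \<epsilon>)"
      using \<epsilon> by (intro radial_component_derivative(2)) (simp add: add_nonneg_pos)
    also have "\<dots> \<le> 1 / \<epsilon>" using \<epsilon> by (intro frac_le) auto
    finally show ?thesis .
  qed
  have hs: "\<bar>Re z\<bar> \<le> 1" "\<bar>Im z\<bar> \<le> 1" if "z \<in> half_square" for z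
    using that by (auto simp: half_square_def)
  define A1 A2 B1 B2 where "A1 z = indicator half_square z * (inner (cutoff_grad c (F z - w0)) (p z) * V1 z)"
    and "A2 z = indicator half_square z * (inner (cutoff_grad c (F z - w0)) (q z) * V2 z)"
    and "B1 z = indicator half_square z * (cutoff c (F z - w0) * V1' z)"
    and "B2 z = indicator half_square z * (cutoff c (F z - w0) * V2' z)" for z
  have Vbounds: "\<bar>V1 z\<bar> \<le> 1/\<epsilon>" "\<bar>V1' z\<bar> \<le> 1/\<epsilon>" "\<bar>V2 z\<bar> \<le> 1/\<epsilon>" "\<bar>V2' z\<bar> \<le> 1/\<epsilon>" if "z \<in> half_square" for z
    unfolding Vdefs by (rule Vb hs[OF that] Vb')+
  have I1: "integrable lborel A1" "integrable lborel B1"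
    unfolding A1_def[abs_def] B1_def[abs_def]
    using cutoff_integrable[OF mF mp mV(1,2) c fin(1) Vbounds(1,2)] by simp_all
  have I2: "integrable lborel A2" "integrable lborel B2"
    unfolding A2_def[abs_def] B2_def[abs_def]
    using cutoff_integrable[OF mF mq mV(3,4) c fin(2) Vbounds(3,4)] by simp_all
  have hsq: "{z. - 1/2 \<le> Re z \<and> Re z \<le> 1/2 \<and> - 1/2 \<le> Im z \<and> Im z \<le> 1/2} \<subseteq> unit_disc"
    using half_square_subset_disc unfolding half_square_def .
  have "(AE y in lborel. y \<in> {- 1/2..1/2} \<longrightarrow> abs_cont_on_interval (\<lambda>x. f (Complex x y)) (- 1/2) (1/2)) \<and>
     (AE x in lborel. x \<in> {- 1/2..1/2} \<longrightarrow> abs_cont_on_interval (\<lambda>y. f (Complex x y)) (- 1/2) (1/2))"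
  proof (rule ACL[unfolded ACL_on_def, rule_format])
    show "- 1/2 \<le> (1/2::real) \<and> - 1/2 \<le> (1/2::real) \<and>
      {z. - 1/2 \<le> Re z \<and> Re z \<le> 1/2 \<and> - 1/2 \<le> Im z \<and> Im z \<le> 1/2} \<subseteq> unit_disc"
      using hsq by (intro conjI) simp_all
  qed
  note ACx = conjunct1[OF this] and ACy = conjunct2[OF this]
  have mem: "Complex x y \<in> half_square \<longleftrightarrow> x \<in> {- 1/2..1/2} \<and> y \<in> {- 1/2..1/2}" for x y
    by (auto simp: half_square_def)
  have edge: "norm (f (Complex x y) - w0) \<ge> c" if "Complex x y \<in> half_square" "\<bar>x\<bar> = 1/2 \<or> \<bar>y\<bar> = 1/2" for x y
  proof (rule outside)
    show "Complex x y \<in> unit_disc" using that half_square_subset_disc by blast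
    show "norm (Complex x y) \<ge> 1/2"
      using that abs_Re_le_cmod[of "Complex x y"] abs_Im_le_cmod[of "Complex x y"] by auto
  qed
  have Z1: "integral\<^sup>L lborel (\<lambda>z. A1 z + B1 z) = 0"
  proof (rule integral_complex_eq_zero_of_lines(1))
    show "integrable lborel (\<lambda>z. A1 z + B1 z)" using I1 by simp
    show "AE y in lborel. integrable lborel (\<lambda>x. A1 (Complex x y) + B1 (Complex x y)) \<longrightarrow>
       (\<integral>x. (A1 (Complex x y) + B1 (Complex x y)) \<partial>lborel) = 0"
      using ACx AE_complex_lines(1)[OF ae]
    proof eventually_elim
      case (elim y)
      show ?case
      proof (intro impI)
        assume I: "integrable lborel (\<lambda>x. A1 (Complex x y) + B1 (Complex x y))"
        show "(\<integral>x. (A1 (Complex x y) + B1 (Complex x y)) \<partial>lborel) = 0"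
        proof (cases "y \<in> {- 1/2..1/2}")
          case False
          then have "Complex x y \<notin> half_square" for x using mem by blast
          then show ?thesis by (simp add: A1_def B1_def)
        next
          case True
          define N where "N = {x. \<not> (Complex x y \<in> unit_disc \<longrightarrow> partials_at f (Complex x y) (p (Complex x y)) (q (Complex x y)))}"
          have N: "negligible N" unfolding N_def by (rule AE_negligible[OF elim(2)])
          have k: "y\<^sup>2 + \<epsilon> > 0" using \<epsilon> by (simp add: add_nonneg_pos)
          have L: "((\<lambda>x. inner (cutoff_grad c (f (Complex x y) - w0)) (p (Complex x y)) * (x / (x\<^sup>2 + (y\<^sup>2 + \<epsilon>)))
               + cutoff c (f (Complex x y) - w0) * ((y\<^sup>2 + \<epsilon> - x\<^sup>2) / (x\<^sup>2 + (y\<^sup>2 + \<epsilon>))\<^sup>2)) has_integral 0) {- 1/2..1/2}"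
          proof (rule cutoff_line_integral_zero[OF _ _ N _ radial_component_derivative(1)[OF k] radial_component_derivative(2)[OF k] c])
            show "abs_cont_on_interval (\<lambda>x. f (Complex x y)) (- 1/2) (1/2)" using elim(1) True by blast
            show "((\<lambda>x. f (Complex x y)) has_vector_derivative p (Complex x y)) (at x)" if "x \<in> {- 1/2..1/2} - N" for x
            proof -
              have "Complex x y \<in> unit_disc" using that True half_square_subset_disc by (auto simp: half_square_def)
              then show ?thesis using that by (intro line_derivative_of_partials(1)) (auto simp: N_def)
            qed
            show "c \<le> norm (f (Complex (- 1/2) y) - w0)" "c \<le> norm (f (Complex (1/2) y) - w0)"
              using True by (auto intro!: edge simp: mem)
          qed simp
          show ?thesis
          proof (rule integral_zero_of_has_integral[OF I L])
            fix x
            have "F (Complex x y) = f (Complex x y)" if "x \<in> {- 1/2..1/2}"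
              using that True half_square_subset_disc by (intro Ff) (auto simp: half_square_def)
            then show "A1 (Complex x y) + B1 (Complex x y) = (if x \<in> {- 1/2..1/2} then
                inner (cutoff_grad c (f (Complex x y) - w0)) (p (Complex x y)) * (x / (x\<^sup>2 + (y\<^sup>2 + \<epsilon>)))
               + cutoff c (f (Complex x y) - w0) * ((y\<^sup>2 + \<epsilon> - x\<^sup>2) / (x\<^sup>2 + (y\<^sup>2 + \<epsilon>))\<^sup>2) else 0)"
              using True mem[of x y] by (simp add: A1_def B1_def V1_def V1'_def)
          qed
        qed
      qed
    qed
  qed
  have Z2: "integral\<^sup>L lborel (\<lambda>z. A2 z + B2 z) = 0"
  proof (rule integral_complex_eq_zero_of_lines(2))
    show "integrable lborel (\<lambda>z. A2 z + B2 z)" using I2 by simp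
    show "AE x in lborel. integrable lborel (\<lambda>y. A2 (Complex x y) + B2 (Complex x y)) \<longrightarrow>
       (\<integral>y. (A2 (Complex x y) + B2 (Complex x y)) \<partial>lborel) = 0"
      using ACy AE_complex_lines(2)[OF ae]
    proof eventually_elim
      case (elim x)
      show ?case
      proof (intro impI)
        assume I: "integrable lborel (\<lambda>y. A2 (Complex x y) + B2 (Complex x y))"
        show "(\<integral>y. (A2 (Complex x y) + B2 (Complex x y)) \<partial>lborel) = 0"
        proof (cases "x \<in> {- 1/2..1/2}")
          case False
          then have "Complex x y \<notin> half_square" for y using mem by blast
          then show ?thesis by (simp add: A2_def B2_def)
        next
          case True
          define N where "N = {y. \<not> (Complex x y \<in> unit_disc \<longrightarrow> partials_at f (Complex x y) (p (Complex x y)) (q (Complex x y)))}"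
          have N: "negligible N" unfolding N_def by (rule AE_negligible[OF elim(2)])
          have k: "x\<^sup>2 + \<epsilon> > 0" using \<epsilon> by (simp add: add_nonneg_pos)
          have L: "((\<lambda>y. inner (cutoff_grad c (f (Complex x y) - w0)) (q (Complex x y)) * (y / (y\<^sup>2 + (x\<^sup>2 + \<epsilon>)))
               + cutoff c (f (Complex x y) - w0) * ((x\<^sup>2 + \<epsilon> - y\<^sup>2) / (y\<^sup>2 + (x\<^sup>2 + \<epsilon>))\<^sup>2)) has_integral 0) {- 1/2..1/2}"
          proof (rule cutoff_line_integral_zero[OF _ _ N _ radial_component_derivative(1)[OF k] radial_component_derivative(2)[OF k] c])
            show "abs_cont_on_interval (\<lambda>y. f (Complex x y)) (- 1/2) (1/2)" using elim(1) True by blast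
            show "((\<lambda>y. f (Complex x y)) has_vector_derivative q (Complex x y)) (at y)" if "y \<in> {- 1/2..1/2} - N" for y
            proof -
              have "Complex x y \<in> unit_disc" using that True half_square_subset_disc by (auto simp: half_square_def)
              then show ?thesis using that by (intro line_derivative_of_partials(2)) (auto simp: N_def)
            qed
            show "c \<le> norm (f (Complex x (- 1/2)) - w0)" "c \<le> norm (f (Complex x (1/2)) - w0)"
              using True by (auto intro!: edge simp: mem)
          qed simp
          show ?thesis
          proof (rule integral_zero_of_has_integral[OF I L])
            fix y
            have "F (Complex x y) = f (Complex x y)" if "y \<in> {- 1/2..1/2}"
              using that True half_square_subset_disc by (intro Ff) (auto simp: half_square_def)
            then show "A2 (Complex x y) + B2 (Complex x y) = (if y \<in> {- 1/2..1/2} then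
                inner (cutoff_grad c (f (Complex x y) - w0)) (q (Complex x y)) * (y / (y\<^sup>2 + (x\<^sup>2 + \<epsilon>)))
               + cutoff c (f (Complex x y) - w0) * ((x\<^sup>2 + \<epsilon> - y\<^sup>2) / (y\<^sup>2 + (x\<^sup>2 + \<epsilon>))\<^sup>2) else 0)"
              using True mem[of x y] by (simp add: A2_def B2_def V2_def V2'_def)
          qed
        qed
      qed
    qed
  qed
  have S: "(Re z)\<^sup>2 + ((Im z)\<^sup>2 + \<epsilon>) = (norm z)\<^sup>2 + \<epsilon>" "(Im z)\<^sup>2 + ((Re z)\<^sup>2 + \<epsilon>) = (norm z)\<^sup>2 + \<epsilon>" for z
    by (simp_all add: cmod_power2)
  have Teq: "T = (\<lambda>z. A1 z + A2 z)"
    unfolding T_def A1_def A2_def V1_def V2_def S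
    by (simp add: fun_eq_iff inner_add_right algebra_simps add_divide_distrib)
  have Weq: "W = (\<lambda>z. B1 z + B2 z)"
  proof
    fix z
    have "V1' z + V2' z = 2 * \<epsilon> / ((norm z)\<^sup>2 + \<epsilon>)\<^sup>2"
      unfolding V1'_def V2'_def S add_divide_distrib[symmetric] by simp
    then have "W z = indicator half_square z * (cutoff c (F z - w0) * (V1' z + V2' z))" by (simp add: W_def)
    then show "W z = B1 z + B2 z" by (simp add: B1_def B2_def algebra_simps)
  qed
  show "integrable lborel T" "integrable lborel W" unfolding Teq Weq using I1 I2 by simp_all
  show "integral\<^sup>L lborel W = - integral\<^sup>L lborel T"
    unfolding Teq Weq using I1 I2 Z1 Z2 by simp
qed

section \<open>Nonexistence for a radial coefficient\<close>

lemma emeasure_ball_complex: "r \<ge> 0 \<Longrightarrow> emeasure lborel (ball (c::complex) r) = ennreal (pi * r\<^sup>2)"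
  by (simp add: emeasure_ball unit_ball_vol_2)

text \<open>Continuity from above of the measure with density \<open>h\<close> along balls shrinking
  to a point, which is a null set.\<close>

lemma nn_integral_small_ball_less:
  fixes h :: "complex \<Rightarrow> ennreal"
  assumes [measurable]: "h \<in> borel_measurable borel" and fin: "(\<integral>\<^sup>+z\<in>unit_disc. h z \<partial>lborel) < \<infinity>" and e: "e > 0"
  obtains r where "0 < r" "r < 1/2" "(\<integral>\<^sup>+z\<in>ball 0 r. h z \<partial>lborel) < e"
proof -
  define M where "M = density lborel h"
  define B where "B n = ball (0::complex) (1 / real (Suc n))" for n
  have em: "emeasure M A = (\<integral>\<^sup>+z\<in>A. h z \<partial>lborel)" if "A \<in> sets borel" for A
    unfolding M_def using that by (simp add: emeasure_density)
  have "(\<lambda>n. emeasure M (B n)) \<longlonglongrightarrow> emeasure M (\<Inter>n. B n)"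
  proof (rule Lim_emeasure_decseq)
    show "range B \<subseteq> sets M" by (auto simp: M_def B_def)
    show "decseq B"
      unfolding B_def by (intro decseq_SucI subset_ball) (simp add: field_simps)
    fix n
    have "emeasure M (B n) \<le> emeasure M unit_disc"
    proof (rule emeasure_mono)
      show "B n \<subseteq> unit_disc" unfolding B_def unit_disc_def by (rule subset_ball) simp
    qed (simp add: M_def unit_disc_def)
    also have "\<dots> < \<infinity>" using fin by (subst em) (auto simp: unit_disc_def)
    finally show "emeasure M (B n) \<noteq> \<infinity>" by simp
  qed
  moreover have "(\<Inter>n. B n) = {0}"
  proof (intro equalityI subsetI)
    fix z assume z: "z \<in> (\<Inter>n. B n)"
    show "z \<in> {0}"
    proof (rule ccontr)
      assume "z \<notin> {0}"
      then have "norm z > 0" by simp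
      then obtain n where "1 / real (Suc n) < norm z" using nat_approx_posE by blast
      moreover have "z \<in> B n" using z by blast
      ultimately show False by (simp add: B_def)
    qed
  qed (simp add: B_def)
  moreover have "emeasure M {0} = 0"
  proof -
    have "{0::complex} \<in> null_sets lborel" by (auto intro!: null_setsI)
    then show ?thesis by (subst em) (auto simp: nn_integral_null_set)
  qed
  ultimately have "(\<lambda>n. emeasure M (B n)) \<longlonglongrightarrow> 0" by simp
  then have "eventually (\<lambda>n. emeasure M (B n) < e) sequentially" using e by (rule order_tendstoD(2))
  then obtain N where N: "\<And>n. n \<ge> N \<Longrightarrow> emeasure M (B n) < e" by (auto simp: eventually_sequentially)
  show thesis
  proof (rule that[of "1 / real (Suc (max N 2))"])
    show "1 / real (Suc (max N 2)) < 1/2" by (simp add: field_simps)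
    show "(\<integral>\<^sup>+z\<in>ball 0 (1 / real (Suc (max N 2))). h z \<partial>lborel) < e"
      using N[of "max N 2"] em[of "B (max N 2)"] by (simp add: B_def del: of_nat_Suc)
  qed simp
qed

text \<open>AM-GM, used twice: to make the partials integrable from K and J, and to split the radial
  term into an energy part and a part with 1 / (|z|^2 K).\<close>

lemma le_half_sum_of_square_le_mult:
  fixes x a b :: real
  assumes "x\<^sup>2 \<le> a * b" "0 \<le> a" "0 \<le> b"
  shows "x \<le> (a + b) / 2"
proof -
  have "a * b \<le> ((a + b) / 2)\<^sup>2"
    using sum_squares_ge_zero[of "a - b" 0] by (simp add: power2_eq_square field_simps)
  then have "x\<^sup>2 \<le> ((a + b) / 2)\<^sup>2" using assms(1) by linarith
  then show ?thesis by (rule power2_le_imp_le) (use assms in simp)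
qed

theorem no_homeo_ACL_solution:
  fixes K :: "complex \<Rightarrow> real"
  assumes Km[measurable]: "K \<in> borel_measurable borel" and K1: "\<And>z. K z \<ge> 1"
    and Kint: "(\<integral>\<^sup>+z\<in>unit_disc. ennreal (K z) \<partial>lborel) < \<infinity>"
    and Kinv: "(\<integral>\<^sup>+z\<in>unit_disc. ennreal (1 / ((norm z)\<^sup>2 * K z)) \<partial>lborel) < \<infinity>"
    and \<mu>: "\<And>z. z \<noteq> 0 \<Longrightarrow> \<mu> z = - of_real ((K z - 1) / (K z + 1)) * (z / cnj z)"
  shows "\<not> homeo_ACL_solution \<mu> f"
proof
  assume sol: "homeo_ACL_solution \<mu> f"
  note sol' = sol[unfolded homeo_ACL_solution_def]
  obtain g where hom: "homeomorphism unit_disc (f ` unit_disc) f g"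
    using conjunct1[OF sol'] by (rule exE)
  have ACL: "ACL_on unit_disc f" and bel: "AE z in lborel. z \<in> unit_disc \<longrightarrow> beltrami_at \<mu> f z"
    using conjunct2[OF sol'] by simp_all
  have cont: "continuous_on unit_disc f" and contg: "continuous_on (f ` unit_disc) g"
    and gf: "\<And>z. z \<in> unit_disc \<Longrightarrow> g (f z) = z"
    using hom by (auto simp: homeomorphism_def)
  have disc0: "0 \<in> unit_disc" and disc_open: "open unit_disc" by (simp_all add: unit_disc_def)
  have mD[measurable]: "unit_disc \<in> sets borel" using disc_open by (rule borel_open)
  from borel_measurable_partials[OF cont] obtain p q where mp[measurable]: "p \<in> borel_measurable borel"
    and mq[measurable]: "q \<in> borel_measurable borel"
    and pq: "\<forall>z\<in>unit_disc. \<forall>a b. partials_at f z a b \<longrightarrow> p z = a \<and> q z = b"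
    by (elim exE conjE) (rule that)
  define J where "J z = Re (p z) * Im (q z) - Re (q z) * Im (p z)" for z
  have mJ[measurable]: "J \<in> borel_measurable borel" unfolding J_def[abs_def] by measurable
  have ae: "AE z in lborel. z \<in> unit_disc \<longrightarrow> partials_at f z (p z) (q z) \<and> z \<noteq> 0 \<and> J z \<ge> 0 \<and>
     (norm (Re z *\<^sub>R p z + Im z *\<^sub>R q z))\<^sup>2 = (norm z)\<^sup>2 * J z / K z \<and>
     (norm (p z))\<^sup>2 \<le> K z * J z \<and> (norm (q z))\<^sup>2 \<le> K z * J z"
    using bel AE_lborel_singleton[of 0]
  proof eventually_elim
    case (elim z)
    show ?case
    proof
      assume z: "z \<in> unit_disc"
      then obtain a b where ab: "partials_at f z a b" and eq: "(a + \<i> * b) / 2 = \<mu> z * ((a - \<i> * b) / 2)"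
        using elim by (auto simp: beltrami_at_def partials_at_def)
      have [simp]: "p z = a" "q z = b" using pq z ab by auto
      note R = radial_beltrami_identities[OF K1 elim(2) eq[unfolded \<mu>[OF elim(2)]]]
      show "partials_at f z (p z) (q z) \<and> z \<noteq> 0 \<and> J z \<ge> 0 \<and>
         (norm (Re z *\<^sub>R p z + Im z *\<^sub>R q z))\<^sup>2 = (norm z)\<^sup>2 * J z / K z \<and>
         (norm (p z))\<^sup>2 \<le> K z * J z \<and> (norm (q z))\<^sup>2 \<le> K z * J z"
        unfolding J_def using R ab elim(2) by simp
    qed
  qed
  have aep: "AE z in lborel. z \<in> unit_disc \<longrightarrow> partials_at f z (p z) (q z)"
    using ae by eventually_elim blast

  define w0 where "w0 = f 0"
  define F where "F z = (if z \<in> unit_disc then f z else 0)" for z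
  have mF[measurable]: "F \<in> borel_measurable borel"
    unfolding F_def using cont disc_open by (intro borel_measurable_continuous_on_if) auto
  have Ff: "F z = f z" if "z \<in> unit_disc" for z using that by (simp add: F_def)
  \<comment> \<open>This integral will enter with the factor 64 and so cost pi / 32. Together with
    pi / 16 from the area this is 3 pi / 32, below the lower bound pi / 8.\<close>
  have "ennreal (pi / 2048) > 0" by simp
  from nn_integral_small_ball_less[OF _ Kinv this]
  obtain r where r: "0 < r" "r < 1/2" and rI: "(\<integral>\<^sup>+z\<in>ball 0 r. ennreal (1 / ((norm z)\<^sup>2 * K z)) \<partial>lborel) < ennreal (pi / 2048)"
    by auto
  \<comment> \<open>The radius \<open>r\<close> depends on \<open>K\<close> alone. Continuity of the
    inverse of \<open>f\<close> at \<open>w0\<close> then yields a bump on the target whose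
    composition with \<open>f\<close> is supported in the ball of radius \<open>r\<close>.\<close>
  obtain c where c: "c > 0" and cw: "\<And>w. w \<in> f ` unit_disc \<Longrightarrow> dist w w0 < c \<Longrightarrow> dist (g w) (g w0) < r"
    using contg[unfolded continuous_on_iff, rule_format, of w0 r] r disc0 by (auto simp: w0_def)
  have small: "norm z < r" if "z \<in> unit_disc" "norm (f z - w0) < c" for z
    using cw[of "f z"] that gf disc0 by (simp add: w0_def dist_norm)
  define \<Omega> where "\<Omega> = {z\<in>half_square. norm (F z - w0) < c}"
  have mB[measurable]: "ball (0::complex) r \<in> sets borel" by simp
  have m\<Omega>[measurable]: "\<Omega> \<in> sets borel" unfolding \<Omega>_def by measurable
  have \<Omega>D: "z \<in> unit_disc" "norm (f z - w0) < c" "norm z < r" if "z \<in> \<Omega>" for z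
    using that half_square_subset_disc small Ff by (auto simp: \<Omega>_def subset_iff)
  have area: "(\<integral>\<^sup>+z\<in>\<Omega>. ennreal \<bar>J z\<bar> \<partial>lborel) \<le> ennreal (pi * c\<^sup>2)"
  proof -
    have "(\<integral>\<^sup>+z\<in>\<Omega>. ennreal \<bar>Re (p z) * Im (q z) - Re (q z) * Im (p z)\<bar> \<partial>lborel) \<le> emeasure lborel (ball w0 c)"
    proof (rule nn_integral_jacobian_le_image[OF hom mp mq aep m\<Omega>])
      show "\<Omega> \<subseteq> unit_disc" using \<Omega>D by blast
      show "f ` \<Omega> \<subseteq> ball w0 c" using \<Omega>D by (auto simp: dist_norm norm_minus_commute)
    qed auto
    then show ?thesis using c by (simp add: J_def emeasure_ball_complex)
  qed
  have fin: "(\<integral>\<^sup>+z\<in>\<Omega>. ennreal (norm (v z)) \<partial>lborel) < \<infinity>"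
    if v[measurable]: "v \<in> borel_measurable borel" and aev: "AE z in lborel. z \<in> unit_disc \<longrightarrow> J z \<ge> 0 \<and> (norm (v z))\<^sup>2 \<le> K z * J z"
    for v :: "complex \<Rightarrow> complex"
  proof -
    have "(\<integral>\<^sup>+z\<in>\<Omega>. ennreal (norm (v z)) \<partial>lborel) \<le> (\<integral>\<^sup>+z. ennreal (K z) * indicator unit_disc z + ennreal \<bar>J z\<bar> * indicator \<Omega> z \<partial>lborel)"
    proof (rule nn_integral_mono_AE)
      show "AE z in lborel. ennreal (norm (v z)) * indicator \<Omega> z \<le> ennreal (K z) * indicator unit_disc z + ennreal \<bar>J z\<bar> * indicator \<Omega> z"
        using aev
      proof eventually_elim
        case (elim z)
        show ?case
        proof (cases "z \<in> \<Omega>")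
          case True
          then have z: "z \<in> unit_disc" using \<Omega>D by blast
          with elim have "norm (v z) \<le> (K z + J z) / 2"
            using K1[of z] by (intro le_half_sum_of_square_le_mult) auto
          also have "\<dots> \<le> K z + \<bar>J z\<bar>" using K1[of z] by simp
          finally have "ennreal (norm (v z)) \<le> ennreal (K z + \<bar>J z\<bar>)" by (rule ennreal_leI)
          also have "\<dots> = ennreal (K z) + ennreal \<bar>J z\<bar>"
            using order_trans[OF zero_le_one K1] by (intro ennreal_plus) auto
          finally have "ennreal (norm (v z)) \<le> ennreal (K z) + ennreal \<bar>J z\<bar>" .
          then show ?thesis using True z by simp
        qed simp
      qed
    qed
    also have "\<dots> = (\<integral>\<^sup>+z\<in>unit_disc. ennreal (K z) \<partial>lborel) + (\<integral>\<^sup>+z\<in>\<Omega>. ennreal \<bar>J z\<bar> \<partial>lborel)"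
      by (rule nn_integral_add) measurable
    also have "\<dots> < \<infinity>" using Kint le_less_trans[OF area, of \<infinity>] by simp
    finally show ?thesis .
  qed
  have finp: "(\<integral>\<^sup>+z\<in>{z\<in>half_square. norm (F z - w0) < c}. ennreal (norm (p z)) \<partial>lborel) < \<infinity>"
    and finq: "(\<integral>\<^sup>+z\<in>{z\<in>half_square. norm (F z - w0) < c}. ennreal (norm (q z)) \<partial>lborel) < \<infinity>"
    unfolding \<Omega>_def[symmetric]
    by (rule fin[OF mp], use ae in eventually_elim, blast) (rule fin[OF mq], use ae in eventually_elim, blast)

  obtain \<rho> where \<rho>: "\<rho> > 0" "\<And>z. z \<in> unit_disc \<Longrightarrow> norm z < \<rho> \<Longrightarrow> norm (f z - w0) < c / 2"
    using cont[unfolded continuous_on_iff, rule_format, of 0 "c / 2"] c disc0 by (auto simp: w0_def dist_norm)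
  \<comment> \<open>On the ball of radius \<open>e\<close> the values of \<open>f\<close> stay
    within \<open>c / 2\<close> of \<open>w0\<close>, where the bump is at least 1/4. The
    regularisation parameter is \<open>e\<^sup>2\<close>, matched to this ball.\<close>
  define e where "e = min \<rho> r"
  have e: "e > 0" "e \<le> r" "e \<le> \<rho>" using \<rho> r by (auto simp: e_def)
  define T where "T z = indicator half_square z * (inner (cutoff_grad c (F z - w0)) (Re z *\<^sub>R p z + Im z *\<^sub>R q z) / ((norm z)\<^sup>2 + e\<^sup>2))" for z
  define W where "W z = indicator half_square z * (cutoff c (F z - w0) * (2 * e\<^sup>2 / ((norm z)\<^sup>2 + e\<^sup>2)\<^sup>2))" for z
  have outside: "norm (f z - w0) \<ge> c" if "z \<in> unit_disc" "norm z \<ge> 1/2" for z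
    using small[of z] that r by force
  have e2: "e\<^sup>2 > 0" using e by simp
  note id = weak_radial_identity[OF ACL mF mp mq Ff aep c e2 outside finp finq, folded T_def[abs_def] W_def[abs_def]]

  \<comment> \<open>On the ball of radius \<open>e\<close> the divergence is at least 1 / (2 e^2)
    and the bump at least 1/4. Multiplied by the area pi e^2 this gives pi / 8, whatever
    \<open>c\<close> and \<open>e\<close> are.\<close>
  have lower: "pi / 8 \<le> integral\<^sup>L lborel W"
  proof -
    have Bfin: "emeasure lborel (ball (0::complex) e) < \<infinity>" by (rule emeasure_bounded_finite) simp
    have "pi / 8 = integral\<^sup>L lborel (\<lambda>z. (1 / (8 * e\<^sup>2)) * indicator (ball (0::complex) e) z)"
    proof -
      have "measure lborel (ball (0::complex) e) = pi * e\<^sup>2"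
        using emeasure_ball_complex[of e 0] e by (simp add: measure_def)
      then show ?thesis using e by simp
    qed
    also have "\<dots> \<le> integral\<^sup>L lborel W"
    proof (rule integral_mono)
      show "integrable lborel (\<lambda>z. (1 / (8 * e\<^sup>2)) * indicator (ball (0::complex) e) z)"
        using Bfin by (intro integrable_mult_right integrable_real_indicator) auto
      show "integrable lborel W" by (rule id)
      fix z :: complex
      show "(1 / (8 * e\<^sup>2)) * indicator (ball 0 e) z \<le> W z"
      proof (cases "z \<in> ball 0 e")
        case False
        then show ?thesis using cutoff_bounds[of c] by (simp add: W_def)
      next
        case True
        then have z: "norm z < e" by simp
        have hs: "z \<in> half_square"
          using abs_Re_le_cmod[of z] abs_Im_le_cmod[of z] z e r by (auto simp: half_square_def abs_le_iff)
        then have zd: "z \<in> unit_disc" using half_square_subset_disc by blast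
        have "norm (F z - w0) \<le> c / 2" using \<rho>(2)[OF zd] z e Ff[OF zd] by simp
        then have "(norm (F z - w0))\<^sup>2 \<le> (c / 2)\<^sup>2" by (intro power_mono) auto
        then have "(norm (F z - w0))\<^sup>2 / c\<^sup>2 \<le> 1 / 4" using c by (simp add: power_divide divide_le_eq)
        then have half: "max 0 (1 - (norm (F z - w0))\<^sup>2 / c\<^sup>2) \<ge> 1 / 2" by (intro max.coboundedI2) linarith
        have "(1 / 2)\<^sup>2 \<le> cutoff c (F z - w0)" unfolding cutoff_def by (rule power_mono[OF half]) simp
        then have u: "1 / 4 \<le> cutoff c (F z - w0)" by (simp add: power_divide)
        have "(norm z)\<^sup>2 \<le> e\<^sup>2" using z by (intro power_mono) auto
        then have "((norm z)\<^sup>2 + e\<^sup>2)\<^sup>2 \<le> (2 * e\<^sup>2)\<^sup>2" by (intro power_mono) auto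
        then have "2 * e\<^sup>2 / (2 * e\<^sup>2)\<^sup>2 \<le> 2 * e\<^sup>2 / ((norm z)\<^sup>2 + e\<^sup>2)\<^sup>2"
          using e2 by (intro divide_left_mono mult_pos_pos) (auto intro!: zero_less_power add_nonneg_pos)
        moreover have "2 * e\<^sup>2 / (2 * e\<^sup>2)\<^sup>2 = 1 / (2 * e\<^sup>2)" using e2 by (simp add: power2_eq_square)
        ultimately have "1 / (2 * e\<^sup>2) \<le> 2 * e\<^sup>2 / ((norm z)\<^sup>2 + e\<^sup>2)\<^sup>2" by simp
        with u have "1 / 4 * (1 / (2 * e\<^sup>2)) \<le> cutoff c (F z - w0) * (2 * e\<^sup>2 / ((norm z)\<^sup>2 + e\<^sup>2)\<^sup>2)"
          by (intro mult_mono) auto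
        then show ?thesis using hs True by (simp add: W_def)
      qed
    qed
    finally show ?thesis .
  qed

  \<comment> \<open>With X the norm of the radial derivative, the square of (4 / c) X / |z|^2 is 16
    J / (c^2 |z|^2 K), factored as J / (8 c^2) times 128 / (|z|^2 K) before AM-GM. The weights give
    the area term a share of pi / 16 and leave the rest to the choice of \<open>r\<close>.\<close>
  have Tpt: "AE z in lborel. ennreal (norm (T z)) \<le>
      ennreal (1 / (16 * c\<^sup>2)) * (ennreal \<bar>J z\<bar> * indicator \<Omega> z) + ennreal 64 * (ennreal (1 / ((norm z)\<^sup>2 * K z)) * indicator (ball 0 r) z)"
    using ae
  proof eventually_elim
    case (elim z)
    show ?case
    proof (cases "z \<in> \<Omega>")
      case False
      then have "z \<notin> half_square \<or> cutoff_grad c (F z - w0) = 0"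
        using cutoff_grad_outside[OF c, of "F z - w0"] by (force simp: \<Omega>_def)
      then have "T z = 0" by (auto simp: T_def)
      then show ?thesis by simp
    next
      case True
      then have z: "z \<in> unit_disc" "norm z < r" using \<Omega>D by blast+
      with elim have z0: "norm z > 0" and J0: "J z \<ge> 0"
        and D: "(norm (Re z *\<^sub>R p z + Im z *\<^sub>R q z))\<^sup>2 = (norm z)\<^sup>2 * J z / K z" by auto
      define X where "X = norm (Re z *\<^sub>R p z + Im z *\<^sub>R q z)"
      have K0: "K z > 0" using K1[of z] by linarith
      have "norm (T z) \<le> \<bar>inner (cutoff_grad c (F z - w0)) (Re z *\<^sub>R p z + Im z *\<^sub>R q z)\<bar> / ((norm z)\<^sup>2 + e\<^sup>2)"
        by (simp add: T_def indicator_def)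
      also have "\<dots> \<le> (4 / c * X) / (norm z)\<^sup>2"
      proof (rule frac_le)
        have "\<bar>inner (cutoff_grad c (F z - w0)) (Re z *\<^sub>R p z + Im z *\<^sub>R q z)\<bar> \<le> norm (cutoff_grad c (F z - w0)) * X"
          unfolding X_def by (rule Cauchy_Schwarz_ineq2)
        also have "\<dots> \<le> 4 / c * X" by (intro mult_right_mono norm_cutoff_grad_le c) (simp add: X_def)
        finally show "\<bar>inner (cutoff_grad c (F z - w0)) (Re z *\<^sub>R p z + Im z *\<^sub>R q z)\<bar> \<le> 4 / c * X" .
      qed (use c z0 in \<open>auto simp: X_def\<close>)
      also have "\<dots> \<le> (J z / (8 * c\<^sup>2) + 128 / ((norm z)\<^sup>2 * K z)) / 2"
      proof (rule le_half_sum_of_square_le_mult)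
        have "(4 / c * X / (norm z)\<^sup>2)\<^sup>2 = 16 / c\<^sup>2 * X\<^sup>2 / ((norm z)\<^sup>2)\<^sup>2"
          by (simp add: power_divide power_mult_distrib)
        also have "\<dots> = J z / (8 * c\<^sup>2) * (128 / ((norm z)\<^sup>2 * K z))"
          unfolding X_def D using c z0 K0 by (simp add: field_simps power2_eq_square)
        finally show "(4 / c * X / (norm z)\<^sup>2)\<^sup>2 \<le> J z / (8 * c\<^sup>2) * (128 / ((norm z)\<^sup>2 * K z))" by simp
      qed (use J0 K0 in auto)
      also have "\<dots> = 1 / (16 * c\<^sup>2) * J z + 64 * (1 / ((norm z)\<^sup>2 * K z))" by simp
      finally have "ennreal (norm (T z)) \<le> ennreal (1 / (16 * c\<^sup>2) * J z + 64 * (1 / ((norm z)\<^sup>2 * K z)))"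
        by (rule ennreal_leI)
      also have "\<dots> = ennreal (1 / (16 * c\<^sup>2)) * ennreal (J z) + ennreal 64 * ennreal (1 / ((norm z)\<^sup>2 * K z))"
      proof -
        have "ennreal (1 / (16 * c\<^sup>2) * J z + 64 * (1 / ((norm z)\<^sup>2 * K z)))
            = ennreal (1 / (16 * c\<^sup>2) * J z) + ennreal (64 * (1 / ((norm z)\<^sup>2 * K z)))"
          using J0 K0 by (intro ennreal_plus) auto
        moreover have "ennreal (1 / (16 * c\<^sup>2) * J z) = ennreal (1 / (16 * c\<^sup>2)) * ennreal (J z)"
          using J0 by (intro ennreal_mult) auto
        moreover have "ennreal (64 * (1 / ((norm z)\<^sup>2 * K z))) = ennreal 64 * ennreal (1 / ((norm z)\<^sup>2 * K z))"
          using K0 by (intro ennreal_mult) auto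
        ultimately show ?thesis by (simp only:)
      qed
      finally show ?thesis using True z J0 by simp
    qed
  qed
  have "ennreal (integral\<^sup>L lborel (\<lambda>z. norm (T z))) = (\<integral>\<^sup>+z. ennreal (norm (T z)) \<partial>lborel)"
    using id(1) by (intro nn_integral_eq_integral[symmetric]) auto
  also have "\<dots> \<le> (\<integral>\<^sup>+z. ennreal (1 / (16 * c\<^sup>2)) * (ennreal \<bar>J z\<bar> * indicator \<Omega> z) + ennreal 64 * (ennreal (1 / ((norm z)\<^sup>2 * K z)) * indicator (ball 0 r) z) \<partial>lborel)"
    by (rule nn_integral_mono_AE[OF Tpt])
  also have "\<dots> = ennreal (1 / (16 * c\<^sup>2)) * (\<integral>\<^sup>+z\<in>\<Omega>. ennreal \<bar>J z\<bar> \<partial>lborel)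
      + ennreal 64 * (\<integral>\<^sup>+z\<in>ball 0 r. ennreal (1 / ((norm z)\<^sup>2 * K z)) \<partial>lborel)"
  proof -
    have e1: "(\<integral>\<^sup>+z. ennreal (1 / (16 * c\<^sup>2)) * (ennreal \<bar>J z\<bar> * indicator \<Omega> z) \<partial>lborel)
        = ennreal (1 / (16 * c\<^sup>2)) * (\<integral>\<^sup>+z\<in>\<Omega>. ennreal \<bar>J z\<bar> \<partial>lborel)"
      by (rule nn_integral_cmult) measurable
    have e2: "(\<integral>\<^sup>+z. ennreal 64 * (ennreal (1 / ((norm z)\<^sup>2 * K z)) * indicator (ball 0 r) z) \<partial>lborel)
        = ennreal 64 * (\<integral>\<^sup>+z\<in>ball 0 r. ennreal (1 / ((norm z)\<^sup>2 * K z)) \<partial>lborel)"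
      by (rule nn_integral_cmult) measurable
    show ?thesis
      unfolding e1[symmetric] e2[symmetric] by (rule nn_integral_add) measurable
  qed
  also have "\<dots> \<le> ennreal (1 / (16 * c\<^sup>2)) * ennreal (pi * c\<^sup>2) + ennreal 64 * ennreal (pi / 2048)"
    by (intro add_mono mult_left_mono area less_imp_le[OF rI] zero_le)
  also have "\<dots> = ennreal (pi / 16 + pi / 32)"
  proof -
    have "ennreal (1 / (16 * c\<^sup>2)) * ennreal (pi * c\<^sup>2) = ennreal (1 / (16 * c\<^sup>2) * (pi * c\<^sup>2))"
      by (rule ennreal_mult[symmetric]) auto
    also have "1 / (16 * c\<^sup>2) * (pi * c\<^sup>2) = pi / 16" using c by simp
    finally have 1: "ennreal (1 / (16 * c\<^sup>2)) * ennreal (pi * c\<^sup>2) = ennreal (pi / 16)" .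
    have "ennreal 64 * ennreal (pi / 2048) = ennreal (64 * (pi / 2048))"
      by (rule ennreal_mult[symmetric]) auto
    also have "64 * (pi / 2048) = pi / 32" by simp
    finally have 2: "ennreal 64 * ennreal (pi / 2048) = ennreal (pi / 32)" .
    show ?thesis unfolding 1 2 by (rule ennreal_plus[symmetric]) auto
  qed
  finally have "integral\<^sup>L lborel (\<lambda>z. norm (T z)) \<le> pi / 16 + pi / 32"
    by (subst (asm) ennreal_le_iff) auto
  moreover have "- integral\<^sup>L lborel T \<le> integral\<^sup>L lborel (\<lambda>z. norm (T z))"
    using integral_norm_bound[of lborel T] abs_ge_minus_self[of "integral\<^sup>L lborel T"]
    unfolding real_norm_def by linarith
  ultimately show False using lower id(3) pi_gt_zero by linarith
qed

section \<open>Construction of the dilatation\<close>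

lemma term_le_suminf_ennreal: "(h :: nat \<Rightarrow> ennreal) k \<le> (\<Sum>j. h j)"
  using sum_le_suminf[of h "{k}"] by simp

text \<open>A dyadic count in place of the exact value 2 pi ln (1 / a): on the ring 2^-(n+1) <= |z|
  < 2^-n the integrand is at most 4^(n+1), and the enclosing ball has area pi / 4^n. Each ring costs
  at most 4 pi, and at most 1 + log 2 (1 / a) rings meet the region.\<close>

lemma nn_integral_inverse_square_annulus:
  assumes a: "0 < a" "a \<le> 1"
  shows "(\<integral>\<^sup>+z\<in>{z\<in>unit_disc. norm z > a}. ennreal (1 / (norm z)\<^sup>2) \<partial>lborel) \<le> ennreal (4 * pi * (1 + log 2 (1 / a)))"
proof -
  define N where "N = nat \<lceil>log 2 (1 / a)\<rceil>"
  have l0: "log 2 (1 / a) \<ge> 0" using a by simp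
  have N: "real N \<le> 1 + log 2 (1 / a)" using l0 unfolding N_def by linarith
  let ?B = "\<lambda>n. ball (0::complex) ((1/2)^n)"
  have pt: "ennreal (1 / (norm z)\<^sup>2) * indicator {z\<in>unit_disc. norm z > a} z \<le> (\<Sum>n<N. ennreal (4^(n+1)) * indicator (?B n) z)" for z
  proof (cases "z \<in> unit_disc \<and> norm z > a")
    case False
    then show ?thesis by auto
  next
    case True
    then have z: "norm z < 1" "norm z > a" "norm z > 0" using a by (auto simp: unit_disc_def)
    define m where "m = (LEAST m. (1/2)^m \<le> norm z)"
    have "\<exists>m. (1/2::real)^m < norm z" using z by (intro real_arch_pow_inv) auto
    then have ex: "\<exists>m. (1/2::real)^m \<le> norm z" by (blast intro: less_imp_le)
    have m: "(1/2)^m \<le> norm z" unfolding m_def by (rule LeastI_ex[OF ex])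
    have "m \<noteq> 0" using m z by (cases m) auto
    then obtain n where n: "m = Suc n" by (cases m) auto
    have n2: "norm z < (1/2)^n"
      using not_less_Least[of n "\<lambda>m. (1/2)^m \<le> norm z"] n unfolding m_def by (simp add: not_le)
    have "a < (1/2)^n" using z n2 by linarith
    then have "2^n < 1 / a" using a by (simp add: power_divide field_simps)
    then have "real n < log 2 (1 / a)" using a by (simp add: less_log_iff powr_realpow)
    then have nN: "n < N" unfolding N_def by linarith
    have "(1/2)^(2*m) \<le> (norm z)\<^sup>2" using power_mono[OF m, of 2] by (simp add: power_mult[symmetric] mult.commute)
    then have "1 / (norm z)\<^sup>2 \<le> 1 / (1/2)^(2*m)" using z by (intro divide_left_mono) auto
    also have "\<dots> = 4^(n+1)" by (simp add: n power_divide power_mult)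
    finally have "ennreal (1 / (norm z)\<^sup>2) \<le> ennreal (4^(n+1)) * indicator (?B n) z"
      using n2 by (auto intro: ennreal_leI)
    also have "\<dots> \<le> (\<Sum>n<N. ennreal (4^(n+1)) * indicator (?B n) z)"
      by (rule member_le_sum) (use nN in auto)
    finally show ?thesis using True by simp
  qed
  have "(\<integral>\<^sup>+z\<in>{z\<in>unit_disc. norm z > a}. ennreal (1 / (norm z)\<^sup>2) \<partial>lborel)
     \<le> (\<integral>\<^sup>+z. (\<Sum>n<N. ennreal (4^(n+1)) * indicator (?B n) z) \<partial>lborel)"
    by (rule nn_integral_mono) (rule pt)
  also have "\<dots> = (\<Sum>n<N. \<integral>\<^sup>+z. ennreal (4^(n+1)) * indicator (?B n) z \<partial>lborel)"
  proof (rule nn_integral_sum)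
    fix n
    have [measurable]: "?B n \<in> sets borel" by simp
    show "(\<lambda>z. ennreal (4^(n+1)) * indicator (?B n) z) \<in> borel_measurable lborel" by measurable
  qed
  also have "\<dots> = (\<Sum>n<N. ennreal (4 * pi))"
  proof (rule sum.cong[OF refl])
    fix n
    have "(\<integral>\<^sup>+z. ennreal (4^(n+1)) * indicator (?B n) z \<partial>lborel) = ennreal (4^(n+1)) * ennreal (pi * ((1/2)^n)\<^sup>2)"
      by (subst nn_integral_cmult_indicator) (simp_all add: emeasure_ball_complex)
    also have "\<dots> = ennreal (4^(n+1) * (pi * ((1/2)^n)\<^sup>2))" by (rule ennreal_mult[symmetric]) auto
    also have "4^(n+1) * (pi * ((1/2)^n)\<^sup>2) = 4 * pi * (4^n * ((1/2)^2)^n)"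
      by (simp add: power_mult[symmetric] mult.commute)
    also have "\<dots> = 4 * pi" by (simp add: power_divide)
    finally show "(\<integral>\<^sup>+z. ennreal (4^(n+1)) * indicator (?B n) z \<partial>lborel) = ennreal (4 * pi)" .
  qed
  also have "\<dots> = ennreal (real N * (4 * pi))" by (simp add: ennreal_mult ennreal_of_nat_eq_real_of_nat)
  also have "\<dots> \<le> ennreal (4 * pi * (1 + log 2 (1 / a)))"
    using mult_right_mono[OF N, of "4 * pi"] by (intro ennreal_leI) (simp add: mult_ac)
  finally show ?thesis .
qed

lemma nn_integral_step_function_finite:
  fixes R c :: "nat \<Rightarrow> real"
  assumes c: "\<And>j. c j \<ge> 0" and R: "\<And>j. R j \<ge> 0" and sum: "summable (\<lambda>j. c j * (R j)\<^sup>2)"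
  shows "(\<integral>\<^sup>+z. (\<Sum>j. ennreal (c j) * indicator (cball (0::complex) (R j)) z) \<partial>lborel) < \<infinity>"
proof -
  have "(\<integral>\<^sup>+z. (\<Sum>j. ennreal (c j) * indicator (cball (0::complex) (R j)) z) \<partial>lborel)
     = (\<Sum>j. \<integral>\<^sup>+z. ennreal (c j) * indicator (cball (0::complex) (R j)) z \<partial>lborel)"
  proof (rule nn_integral_suminf)
    fix j
    have [measurable]: "cball (0::complex) (R j) \<in> sets borel" by simp
    show "(\<lambda>z. ennreal (c j) * indicator (cball (0::complex) (R j)) z) \<in> borel_measurable lborel" by measurable
  qed
  also have "\<dots> = (\<Sum>j. ennreal (pi * (c j * (R j)\<^sup>2)))"
  proof (rule suminf_cong)
    fix j
    have "(\<integral>\<^sup>+z. ennreal (c j) * indicator (cball (0::complex) (R j)) z \<partial>lborel) = ennreal (c j) * ennreal (pi * (R j)\<^sup>2)"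
      using R[of j] by (subst nn_integral_cmult_indicator) (simp_all add: emeasure_cball unit_ball_vol_2)
    also have "\<dots> = ennreal (c j * (pi * (R j)\<^sup>2))" using c by (intro ennreal_mult[symmetric]) auto
    finally show "(\<integral>\<^sup>+z. ennreal (c j) * indicator (cball (0::complex) (R j)) z \<partial>lborel) = ennreal (pi * (c j * (R j)\<^sup>2))"
      by (simp add: mult_ac)
  qed
  also have "\<dots> = ennreal (\<Sum>j. pi * (c j * (R j)\<^sup>2))"
    using c sum by (intro suminf_ennreal2 summable_mult) auto
  finally show ?thesis by simp
qed

lemma radial_profile:
  fixes G :: "nat \<Rightarrow> real"
  assumes G1: "\<And>j. G j \<ge> 1" and sumG: "summable (\<lambda>j. ln (G j) / 2^j)"
  shows "\<exists>J \<in> measurable borel (count_space UNIV). (\<integral>\<^sup>+z\<in>unit_disc. ennreal (G (J z)) \<partial>lborel) < \<infinity> \<and>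
    (\<integral>\<^sup>+z\<in>unit_disc. ennreal (2 ^ J z) \<partial>lborel) < \<infinity> \<and>
    (\<integral>\<^sup>+z\<in>unit_disc. ennreal (1 / ((norm z)\<^sup>2 * 2 ^ J z)) \<partial>lborel) < \<infinity>"
proof -
  \<comment> \<open>The value \<open>2\<^sup>j\<close> is taken on \<open>R (j + 1) < |z| \<le> R j\<close>; the area \<open>\<pi> / (4\<^sup>j G j)\<close> pays for \<open>G j\<close> and \<open>2\<^sup>j\<close>,
    while \<open>log (1 / R j)\<close> only costs \<open>log (G j)\<close>.\<close>
  define R where "R j = 1 / sqrt (4^j * G j)" for j
  have G0: "G j > 0" for j using G1[of j] by linarith
  have s1: "4^j * G j \<ge> 4^j" for j using mult_left_mono[OF G1[of j], of "4^j"] by simp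
  have s0: "4^j * G j > 0" for j using G0[of j] by simp
  have R0: "R j > 0" for j using s0[of j] by (simp add: R_def)
  have R2: "(R j)\<^sup>2 = 1 / (4^j * G j)" for j using s0[of j] by (simp add: R_def power_divide)
  have sqrt4: "sqrt (4^j) = 2^j" for j :: nat
    by (simp add: real_sqrt_power)
  have Rle: "R j \<le> (1/2)^j" for j
  proof -
    have "2^j \<le> sqrt (4^j * G j)" using real_sqrt_le_mono[OF s1[of j]] by (simp add: sqrt4)
    then show ?thesis by (simp add: R_def power_divide frac_le)
  qed
  have R1: "R j \<le> 1" for j using Rle[of j] power_le_one[of "1/2::real" j] by simp
  \<comment> \<open>The index exists for \<open>z \<noteq> 0\<close> because
    \<open>R j \<le> (1/2)^j\<close>. Minimality alone gives \<open>norm z \<le> R (J z)\<close>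
    when \<open>J z > 0\<close>, so monotonicity of \<open>R\<close> need not be discussed. The
    origin is removed as a null set.\<close>
  define J where "J z = (LEAST j. norm z > R (Suc j))" for z :: complex
  have Jm[measurable]: "J \<in> measurable borel (count_space UNIV)"
    unfolding J_def[abs_def] by measurable
  have J: "norm z > R (Suc (J z))" "J z = 0 \<or> norm z \<le> R (J z)" if "z \<noteq> 0" for z
  proof -
    have "norm z > 0" using that by simp
    then obtain n where "(1/2)^n < norm z" using real_arch_pow_inv[of "norm z" "1/2"] by auto
    moreover have "(1/2)^(Suc n) \<le> (1/2::real)^n" by simp
    ultimately have ex: "norm z > R (Suc n)" using Rle[of "Suc n"] by linarith
    then show "norm z > R (Suc (J z))" unfolding J_def by (rule LeastI)
    show "J z = 0 \<or> norm z \<le> R (J z)"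
    proof (cases "J z")
      case (Suc k)
      then have "\<not> norm z > R (Suc k)" using not_less_Least[of k "\<lambda>j. norm z > R (Suc j)"] by (simp add: J_def)
      then show ?thesis using Suc by simp
    qed simp
  qed
  \<comment> \<open>The set where \<open>J z = j\<close> has area at most
    \<open>pi * (R j)\<^sup>2\<close> for \<open>j > 0\<close>; for \<open>j = 0\<close> it may
    reach out to the unit circle, hence the separate summand with \<open>c 0\<close>.\<close>
  have bound: "(\<integral>\<^sup>+z\<in>unit_disc. ennreal (c (J z)) \<partial>lborel) < \<infinity>"
    if c: "\<And>j. c j \<ge> 0" and sum: "summable (\<lambda>j. c j * (R j)\<^sup>2)" for c
  proof -
    have "(\<integral>\<^sup>+z\<in>unit_disc. ennreal (c (J z)) \<partial>lborel) \<le>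
      (\<integral>\<^sup>+z. ennreal (c 0) * indicator unit_disc z + (\<Sum>j. ennreal (c j) * indicator (cball 0 (R j)) z) \<partial>lborel)"
    proof (rule nn_integral_mono_AE)
      show "AE z in lborel. ennreal (c (J z)) * indicator unit_disc z \<le>
          ennreal (c 0) * indicator unit_disc z + (\<Sum>j. ennreal (c j) * indicator (cball 0 (R j)) z)"
        using AE_lborel_singleton[of 0]
      proof eventually_elim
        case (elim z)
        show ?case
        proof (cases "J z = 0")
          case False
          then have "z \<in> cball 0 (R (J z))" using J(2)[OF elim] by simp
          then have "ennreal (c (J z)) * indicator unit_disc z \<le> ennreal (c (J z)) * indicator (cball 0 (R (J z))) z"
            by (simp add: indicator_def)
          also have "\<dots> \<le> (\<Sum>j. ennreal (c j) * indicator (cball 0 (R j)) z)"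
            by (rule term_le_suminf_ennreal)
          finally show ?thesis by (simp add: add_increasing)
        qed simp
      qed
    qed
    also have "\<dots> = (\<integral>\<^sup>+z. ennreal (c 0) * indicator unit_disc z \<partial>lborel) + (\<integral>\<^sup>+z. (\<Sum>j. ennreal (c j) * indicator (cball (0::complex) (R j)) z) \<partial>lborel)"
    proof (rule nn_integral_add)
      have [measurable]: "unit_disc \<in> sets borel" "\<And>j. cball (0::complex) (R j) \<in> sets borel"
        by (simp_all add: unit_disc_def)
      show "(\<lambda>z. ennreal (c 0) * indicator unit_disc z) \<in> borel_measurable lborel" by measurable
      show "(\<lambda>z. \<Sum>j. ennreal (c j) * indicator (cball (0::complex) (R j)) z) \<in> borel_measurable lborel" by measurable
    qed
    also have "\<dots> < \<infinity>"
    proof -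
      have "(\<integral>\<^sup>+z. ennreal (c 0) * indicator unit_disc z \<partial>lborel) < \<infinity>"
        by (subst nn_integral_cmult_indicator) (auto simp: unit_disc_def emeasure_ball_complex ennreal_mult_less_top)
      then show ?thesis
        using nn_integral_step_function_finite[OF c less_imp_le[OF R0] sum] by simp
    qed
    finally show ?thesis .
  qed
  have I1: "(\<integral>\<^sup>+z\<in>unit_disc. ennreal (G (J z)) \<partial>lborel) < \<infinity>"
  proof (rule bound)
    have "G j * (R j)\<^sup>2 = (1/4)^j" for j using G0[of j] by (simp add: R2 power_divide)
    then show "summable (\<lambda>j. G j * (R j)\<^sup>2)" by (simp add: summable_geometric)
  qed (rule less_imp_le[OF G0])
  have I2: "(\<integral>\<^sup>+z\<in>unit_disc. ennreal (2 ^ J z) \<partial>lborel) < \<infinity>"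
  proof (rule bound[of "\<lambda>j. 2^j"])
    have "norm (2^j * (R j)\<^sup>2) \<le> (1/2)^j" for j
    proof -
      have "norm (2^j * (R j)\<^sup>2) = 2^j / (4^j * G j)" using G0[of j] by (simp add: R2)
      also have "\<dots> \<le> 2^j / 4^j" using s1[of j] by (intro divide_left_mono) (auto simp: G0)
      also have "\<dots> = (1/2)^j" by (simp add: power_divide[symmetric])
      finally show ?thesis .
    qed
    then show "summable (\<lambda>j. 2^j * (R j)\<^sup>2)"
      by (intro summable_comparison_test'[OF summable_geometric[of "1/2::real"], of 0]) auto
  qed simp
  let ?A = "\<lambda>j. {z\<in>unit_disc. norm z > R (Suc j)}"
  have mA[measurable]: "?A j \<in> sets borel" for j
    unfolding unit_disc_def by measurable
  have I3: "(\<integral>\<^sup>+z\<in>unit_disc. ennreal (1 / ((norm z)\<^sup>2 * 2 ^ J z)) \<partial>lborel) < \<infinity>"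
  proof -
    have "(\<integral>\<^sup>+z\<in>unit_disc. ennreal (1 / ((norm z)\<^sup>2 * 2 ^ J z)) \<partial>lborel) \<le>
       (\<integral>\<^sup>+z. (\<Sum>j. ennreal ((1/2)^j) * (ennreal (1 / (norm z)\<^sup>2) * indicator (?A j) z)) \<partial>lborel)"
    proof (rule nn_integral_mono_AE)
      show "AE z in lborel. ennreal (1 / ((norm z)\<^sup>2 * 2 ^ J z)) * indicator unit_disc z \<le>
          (\<Sum>j. ennreal ((1/2)^j) * (ennreal (1 / (norm z)\<^sup>2) * indicator (?A j) z))"
        using AE_lborel_singleton[of 0]
      proof eventually_elim
        case (elim z)
        have "1 / ((norm z)\<^sup>2 * 2 ^ J z) = (1/2)^J z * (1 / (norm z)\<^sup>2)" by (simp add: power_divide)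
        then have "ennreal (1 / ((norm z)\<^sup>2 * 2 ^ J z)) = ennreal ((1/2)^J z) * ennreal (1 / (norm z)\<^sup>2)"
          by (simp only:) (rule ennreal_mult, auto)
        then have "ennreal (1 / ((norm z)\<^sup>2 * 2 ^ J z)) * indicator unit_disc z
          = ennreal ((1/2)^J z) * (ennreal (1 / (norm z)\<^sup>2) * indicator (?A (J z)) z)"
          using J(1)[OF elim] by (simp add: indicator_def)
        also have "\<dots> \<le> (\<Sum>j. ennreal ((1/2)^j) * (ennreal (1 / (norm z)\<^sup>2) * indicator (?A j) z))"
          by (rule term_le_suminf_ennreal)
        finally show ?case .
      qed
    qed
    also have "\<dots> = (\<Sum>j. \<integral>\<^sup>+z. ennreal ((1/2)^j) * (ennreal (1 / (norm z)\<^sup>2) * indicator (?A j) z) \<partial>lborel)"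
      by (rule nn_integral_suminf) measurable
    also have "\<dots> = (\<Sum>j. ennreal ((1/2)^j) * (\<integral>\<^sup>+z\<in>?A j. ennreal (1 / (norm z)\<^sup>2) \<partial>lborel))"
      by (intro suminf_cong nn_integral_cmult) measurable
    also have "\<dots> \<le> (\<Sum>j. ennreal ((1/2)^j) * ennreal (4 * pi * (1 + log 2 (1 / R (Suc j)))))"
      by (intro suminf_le mult_left_mono nn_integral_inverse_square_annulus R0 R1) auto
    also have "\<dots> = (\<Sum>j. ennreal (4 * pi * ((1/2)^j * (1 + log 2 (1 / R (Suc j))))))"
    proof (rule suminf_cong)
      fix j
      have "0 \<le> log 2 (1 / R (Suc j))" using R0[of "Suc j"] R1[of "Suc j"] by simp
      then have "ennreal ((1/2)^j) * ennreal (4 * pi * (1 + log 2 (1 / R (Suc j)))) = ennreal ((1/2)^j * (4 * pi * (1 + log 2 (1 / R (Suc j)))))"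
        by (intro ennreal_mult[symmetric]) auto
      also have "(1/2)^j * (4 * pi * (1 + log 2 (1 / R (Suc j)))) = 4 * pi * ((1/2)^j * (1 + log 2 (1 / R (Suc j))))"
        by (rule mult.left_commute)
      finally show "ennreal ((1/2)^j) * ennreal (4 * pi * (1 + log 2 (1 / R (Suc j)))) = ennreal (4 * pi * ((1/2)^j * (1 + log 2 (1 / R (Suc j)))))" .
    qed
    also have "\<dots> = ennreal (\<Sum>j. 4 * pi * ((1/2)^j * (1 + log 2 (1 / R (Suc j)))))"
    proof (rule suminf_ennreal2)
      show "0 \<le> 4 * pi * ((1/2)^j * (1 + log 2 (1 / R (Suc j))))" for j
        using R0[of "Suc j"] R1[of "Suc j"] by simp
      \<comment> \<open>log 2 (1 / R (j + 1)) is (j + 1) + ln (G (j + 1)) / (2 ln 2). The last term,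
        weighted by 2^-j, is a multiple of the series that converges by assumption.\<close>
      have eq: "(1/2)^j * (1 + log 2 (1 / R (Suc j))) = (1/2)^j + real (Suc j) * (1/2)^j + (1 / ln 2) * (ln (G (Suc j)) / 2^Suc j)" for j
      proof -
        have "1 / R (Suc j) = 2^Suc j * sqrt (G (Suc j))"
          unfolding R_def by (simp only: real_sqrt_mult sqrt4) simp
        moreover have "ln (2^Suc j * sqrt (G (Suc j))) = ln (2^Suc j) + ln (sqrt (G (Suc j)))"
          using G0[of "Suc j"] by (intro ln_mult_pos) auto
        moreover have "ln (2^Suc j) = real (Suc j) * ln 2" by (rule ln_realpow)
        moreover have "ln (sqrt (G (Suc j))) = ln (G (Suc j)) / 2" using G0[of "Suc j"] by (simp add: ln_sqrt)
        ultimately have "ln (1 / R (Suc j)) = real (Suc j) * ln 2 + ln (G (Suc j)) / 2" by (simp only:)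
        then have "log 2 (1 / R (Suc j)) = real (Suc j) + ln (G (Suc j)) / (2 * ln 2)"
          unfolding log_def by (simp add: add_divide_distrib)
        then show ?thesis by (simp add: distrib_left power_divide mult_ac del: of_nat_Suc)
      qed
      have "summable (\<lambda>j. real (Suc j) * (1/2)^j)"
        using geometric_deriv_sums[of "1/2::real"] by (auto simp: sums_iff)
      moreover have "summable (\<lambda>j. ln (G (Suc j)) / 2^Suc j)" using sumG by (subst summable_Suc_iff)
      ultimately have "summable (\<lambda>j. (1/2)^j + real (Suc j) * (1/2)^j + (1 / ln 2) * (ln (G (Suc j)) / 2^Suc j))"
        by (intro summable_add summable_mult summable_geometric) auto
      then show "summable (\<lambda>j. 4 * pi * ((1/2)^j * (1 + log 2 (1 / R (Suc j)))))"
        unfolding eq by (rule summable_mult)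
    qed
    finally show ?thesis using le_less_trans by fastforce
  qed
  show ?thesis using Jm I1 I2 I3 by blast
qed

section \<open>From the logarithmic integral to the series, and the conclusion\<close>

text \<open>\<open>log_integral_infinite\<close> can fail because of the negative part as well. Each
  claim is therefore tested at a \<delta> beyond which log \<Phi> is nonnegative: the negative part
  then integrates to 0, and the failure says that the positive part is finite.\<close>

lemma not_log_integral_infinite_imp:
  fixes \<Phi> :: "ennreal \<Rightarrow> ennreal"
  assumes mono: "mono \<Phi>" and not: "\<not> (\<exists>\<delta>>0. log_integral_infinite \<Phi> \<delta>)"
  shows "\<Phi> (ennreal t) < \<infinity>"
    and "summable (\<lambda>j. ln (max 1 (enn2real (\<Phi> (ennreal (2^j))))) / 2^j)"
proof -
  have mon: "\<Phi> (ennreal s) \<le> \<Phi> (ennreal t)" if "s \<le> t" for s t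
    using mono that by (intro monoD[OF mono] ennreal_leI)
  show fin: "\<Phi> (ennreal t) < \<infinity>" for t
  proof (rule ccontr)
    assume "\<not> \<Phi> (ennreal t) < \<infinity>"
    then have inf: "\<Phi> (ennreal t) = \<infinity>" by (simp add: less_top[symmetric])
    \<comment> \<open>The maximum keeps \<delta> positive, since \<open>t\<close> may be
      negative.\<close>
    define \<delta> where "\<delta> = max t 1"
    have infs: "\<Phi> (ennreal s) = \<infinity>" if "s \<ge> \<delta>" for s
      using mon[of t s] that inf by (simp add: \<delta>_def top_unique)
    have "\<infinity> = (\<integral>\<^sup>+s. \<infinity> * indicator {\<delta>..\<delta>+1} s \<partial>lborel)"
      by (subst nn_integral_cmult_indicator) (auto simp: ennreal_top_mult)
    also have "\<dots> \<le> (\<integral>\<^sup>+s\<in>{\<delta>..}. log_pos \<Phi> s * ennreal (1 / s\<^sup>2) \<partial>lborel)"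
    proof (rule nn_integral_mono)
      fix s :: real
      show "\<infinity> * indicator {\<delta>..\<delta>+1} s \<le> log_pos \<Phi> s * ennreal (1 / s\<^sup>2) * indicator {\<delta>..} s"
      proof (cases "s \<in> {\<delta>..\<delta>+1}")
        case True
        then have s: "s \<ge> \<delta>" "s > 0" by (auto simp: \<delta>_def)
        then have "log_pos \<Phi> s * ennreal (1 / s\<^sup>2) = \<infinity>"
          using infs[of s] by (simp add: log_pos_def ennreal_top_mult)
        then show ?thesis using s by simp
      qed simp
    qed
    finally have "(\<integral>\<^sup>+s\<in>{\<delta>..}. log_pos \<Phi> s * ennreal (1 / s\<^sup>2) \<partial>lborel) = \<infinity>" by (simp add: top_unique)
    moreover have "(\<integral>\<^sup>+s\<in>{\<delta>..}. log_neg \<Phi> s * ennreal (1 / s\<^sup>2) \<partial>lborel) = (\<integral>\<^sup>+s. 0 \<partial>(lborel :: real measure))"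
      using infs by (intro nn_integral_cong) (auto simp: log_neg_def indicator_def)
    moreover have "\<delta> > 0" by (simp add: \<delta>_def)
    ultimately show False using not unfolding log_integral_infinite_def by auto
  qed
  define a where "a j = ln (max 1 (enn2real (\<Phi> (ennreal (2^j)))))" for j :: nat
  have a0: "a j \<ge> 0" for j by (simp add: a_def)
  have "summable (\<lambda>j. a j / 2^j)"
  proof (cases "\<forall>j::nat. enn2real (\<Phi> (ennreal (2^j))) \<le> 1")
    case True
    then have "a j = 0" for j by (simp add: a_def max_absorb1)
    then show ?thesis by simp
  next
    case False
    then obtain k :: nat where k: "enn2real (\<Phi> (ennreal (2^k))) > 1" by (auto simp: not_le)
    have lb: "enn2real (\<Phi> (ennreal s)) \<ge> enn2real (\<Phi> (ennreal t))" if "t \<le> s" for s t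
      using mon[OF that] fin by (intro enn2real_mono) auto
    have big: "enn2real (\<Phi> (ennreal s)) > 1" if "s \<ge> 2^k" for s using lb[OF that] k by linarith
    have "(\<integral>\<^sup>+s\<in>{2^k..}. log_neg \<Phi> s * ennreal (1 / s\<^sup>2) \<partial>lborel) = (\<integral>\<^sup>+s. 0 \<partial>(lborel :: real measure))"
    proof (rule nn_integral_cong)
      fix s :: real
      show "log_neg \<Phi> s * ennreal (1 / s\<^sup>2) * indicator {2^k..} s = 0"
      proof (cases "s \<ge> 2^k")
        case True
        from big[OF this] have "\<Phi> (ennreal s) \<noteq> 0" "ln (enn2real (\<Phi> (ennreal s))) \<ge> 0" by auto
        then show ?thesis by (simp add: log_neg_def)
      qed simp
    qed
    moreover have "\<not> log_integral_infinite \<Phi> (2^k)" using not by (metis zero_less_numeral zero_less_power)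
    ultimately have I: "(\<integral>\<^sup>+s\<in>{2^k..}. log_pos \<Phi> s * ennreal (1 / s\<^sup>2) \<partial>lborel) < \<infinity>"
      unfolding log_integral_infinite_def by (simp add: less_top[symmetric])
    have sq: "((2::real)^n)\<^sup>2 = 4^n" for n by (simp add: power2_eq_square power_mult_distrib[symmetric])
    define B where "B i = {2^(k+i)..<(2::real)^(k+i+1)}" for i
    \<comment> \<open>A lower bound for log \<Phi>(t) / t^2 on \<open>B i\<close>: monotonicity
      takes the value of \<Phi> at the left end, and 1 / t^2 is taken at the right end. Times the
      length of \<open>B i\<close> this is a quarter of \<open>a (i + k) / 2^(i + k)\<close>, whence
      the later factor 4.\<close>
    define c where "c i = a (i + k) / 4^(i+k+1)" for i
    have c0: "c i \<ge> 0" for i using a0 by (simp add: c_def)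
    have Bd: "disjoint_family B"
      unfolding disjoint_family_on_def
    proof (intro ballI impI)
      have *: "B i \<inter> B j = {}" if "i < j" for i j
      proof -
        have "(2::real)^(k+i+1) \<le> 2^(k+j)" using that by (intro power_increasing) auto
        then show ?thesis by (auto simp: B_def)
      qed
      fix i j :: nat assume "i \<noteq> j"
      then show "B i \<inter> B j = {}" using *[of i j] *[of j i] by (cases "i < j") auto
    qed
    have "(\<Sum>i. ennreal (c i) * ennreal (2^(k+i))) = (\<Sum>i. \<integral>\<^sup>+s. ennreal (c i) * indicator (B i) s \<partial>lborel)"
      by (intro suminf_cong, subst nn_integral_cmult_indicator) (auto simp: B_def)
    also have "\<dots> = (\<integral>\<^sup>+s. (\<Sum>i. ennreal (c i) * indicator (B i) s) \<partial>lborel)"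
      by (rule nn_integral_suminf[symmetric]) (simp add: B_def)
    also have "\<dots> \<le> (\<integral>\<^sup>+s\<in>{2^k..}. log_pos \<Phi> s * ennreal (1 / s\<^sup>2) \<partial>lborel)"
    proof (rule nn_integral_mono)
      fix s :: real
      show "(\<Sum>i. ennreal (c i) * indicator (B i) s) \<le> log_pos \<Phi> s * ennreal (1 / s\<^sup>2) * indicator {2^k..} s"
      proof (cases "\<exists>i. s \<in> B i")
        case False
        then show ?thesis by simp
      next
        case True
        then obtain i where i: "s \<in> B i" by blast
        then have s: "2^(k+i) \<le> s" "s < 2^(k+i+1)" by (auto simp: B_def)
        have "(2::real)^k \<le> 2^(k+i)" by (intro power_increasing) auto
        then have sk: "2^k \<le> s" using s by linarith
        have s0: "s > 0" using sk zero_less_power[of "2::real" k] by linarith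
        have "(\<Sum>i. ennreal (c i) * indicator (B i) s) = ennreal (c i)"
          using suminf_cmult_indicator[OF Bd i, of "\<lambda>i. ennreal (c i)"] by simp
        also have "\<dots> \<le> ennreal (a (k+i) * (1 / s\<^sup>2))"
        proof (rule ennreal_leI)
          have "s\<^sup>2 \<le> (2^(k+i+1))\<^sup>2" using s s0 by (intro power_mono) auto
          also have "\<dots> = 4^(k+i+1)" by (rule sq)
          finally have "1 / 4^(k+i+1) \<le> 1 / s\<^sup>2" using s0 by (intro divide_left_mono) auto
          then have "a (k+i) * (1 / 4^(k+i+1)) \<le> a (k+i) * (1 / s\<^sup>2)" using a0 by (rule mult_left_mono)
          then show "c i \<le> a (k+i) * (1 / s\<^sup>2)" by (simp add: c_def add.commute)
        qed
        also have "\<dots> = ennreal (a (k+i)) * ennreal (1 / s\<^sup>2)" using a0 by (intro ennreal_mult) auto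
        also have "\<dots> \<le> log_pos \<Phi> s * ennreal (1 / s\<^sup>2)"
        proof (rule mult_right_mono)
          have "a (k+i) \<le> ln (enn2real (\<Phi> (ennreal s)))"
            unfolding a_def using lb[OF s(1)] big[OF sk] by (subst ln_le_cancel_iff) auto
          then show "ennreal (a (k+i)) \<le> log_pos \<Phi> s"
            using fin[of s] by (auto simp: log_pos_def intro!: ennreal_leI)
        qed simp
        finally show ?thesis using sk by simp
      qed
    qed
    also note I
    finally have "(\<Sum>i. ennreal (c i * 2^(k+i))) < \<infinity>" using c0 by (simp add: ennreal_mult)
    then have "summable (\<lambda>i. c i * 2^(k+i))" using c0 by (intro summable_suminf_not_top) auto
    then have "summable (\<lambda>i. 4 * (c i * 2^(k+i)))" by (rule summable_mult)
    moreover have "4 * (c i * 2^(k+i)) = a (i + k) / 2^(i + k)" for i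
    proof -
      have "(4::real)^(i+k) = 2^(i+k) * 2^(i+k)" by (simp add: power_mult_distrib[symmetric])
      then show ?thesis by (simp add: c_def add.commute)
    qed
    ultimately have "summable (\<lambda>i. a (i + k) / 2^(i + k))" by simp
    then show ?thesis by (simp add: summable_iff_shift[of "\<lambda>j. a j / 2^j"])
  qed
  then show "summable (\<lambda>j. ln (max 1 (enn2real (\<Phi> (ennreal (2^j))))) / 2^j)" by (simp add: a_def)
qed

theorem theorem5p1:
  fixes \<Phi> :: "ennreal \<Rightarrow> ennreal"
  assumes "mono \<Phi>"
    and "convex_ennreal_fun \<Phi>"
    and "\<forall>\<mu>::complex \<Rightarrow> complex.
           \<mu> \<in> borel_measurable (lebesgue_on unit_disc) \<longrightarrow>
           (\<forall>z\<in>unit_disc. \<mu> z \<in> unit_disc) \<longrightarrow>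
           (\<integral>\<^sup>+ z \<in> unit_disc. \<Phi> (ennreal (dilatation \<mu> z)) \<partial>lborel) < \<infinity> \<longrightarrow>
           (\<exists>f. homeo_ACL_solution \<mu> f)"
  shows "\<exists>\<delta>>0. log_integral_infinite \<Phi> \<delta>"
proof (rule ccontr)
  assume "\<not> (\<exists>\<delta>>0. log_integral_infinite \<Phi> \<delta>)"
  note L = not_log_integral_infinite_imp[OF assms(1) this]
  \<comment> \<open>The maximum with 1 turns \<open>ln (G j)\<close> into the positive part of log
    \<Phi>(2^j), while \<open>G j\<close> still dominates \<Phi>(2^j), which is finite.\<close>
  define G where "G j = max 1 (enn2real (\<Phi> (ennreal (2^j))))" for j :: nat
  have G1: "G j \<ge> 1" for j by (simp add: G_def)
  have sumG: "summable (\<lambda>j. ln (G j) / 2^j)" using L(2) by (simp add: G_def)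
  obtain J where Jm[measurable]: "J \<in> measurable borel (count_space UNIV)" and J:
    "(\<integral>\<^sup>+z\<in>unit_disc. ennreal (G (J z)) \<partial>lborel) < \<infinity> \<and>
    (\<integral>\<^sup>+z\<in>unit_disc. ennreal (2 ^ J z) \<partial>lborel) < \<infinity> \<and>
    (\<integral>\<^sup>+z\<in>unit_disc. ennreal (1 / ((norm z)\<^sup>2 * 2 ^ J z)) \<partial>lborel) < \<infinity>"
    using radial_profile[OF G1 sumG] by (rule bexE)
  define K :: "complex \<Rightarrow> real" where "K z = 2 ^ J z" for z
  have Km[measurable]: "K \<in> borel_measurable borel"
    unfolding K_def[abs_def] by measurable
  have K1: "K z \<ge> 1" for z by (simp add: K_def)
  \<comment> \<open>For \<open>z \<noteq> 0\<close> the factor \<open>z / cnj z\<close> has modulus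
    1, so the modulus of \<mu> is (K - 1) / (K + 1) and the dilatation is \<open>K\<close>. At 0
    division by zero makes the value 0, which is still admissible.\<close>
  define \<mu> where "\<mu> z = - of_real ((K z - 1) / (K z + 1)) * (z / cnj z)" for z
  have \<mu>n: "norm (\<mu> z) = (if z = 0 then 0 else (K z - 1) / (K z + 1))" for z
  proof -
    have "norm (\<mu> z) = \<bar>(K z - 1) / (K z + 1)\<bar> * norm (z / cnj z)"
      unfolding \<mu>_def by (simp only: norm_mult norm_minus_cancel norm_of_real)
    then show ?thesis using K1[of z] by (simp add: norm_divide)
  qed
  have \<mu>1: "norm (\<mu> z) < 1" for z using K1[of z] by (simp add: \<mu>n)
  have dil: "dilatation \<mu> z = K z" if "z \<noteq> 0" for z
    using K1[of z] that by (simp add: dilatation_def \<mu>n field_simps)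
  have "\<mu> \<in> borel_measurable borel"
  proof -
    have "cnj \<in> borel_measurable borel" by (intro borel_measurable_continuous_onI continuous_intros)
    then show ?thesis unfolding \<mu>_def[abs_def] by measurable
  qed
  then have "\<mu> \<in> borel_measurable (lebesgue_on unit_disc)"
    by (intro measurable_restrict_space1 measurable_completion) simp
  moreover have "\<forall>z\<in>unit_disc. \<mu> z \<in> unit_disc" using \<mu>1 by (simp add: unit_disc_def)
  moreover have "(\<integral>\<^sup>+ z \<in> unit_disc. \<Phi> (ennreal (dilatation \<mu> z)) \<partial>lborel) < \<infinity>"
  proof -
    have "(\<integral>\<^sup>+ z \<in> unit_disc. \<Phi> (ennreal (dilatation \<mu> z)) \<partial>lborel) \<le> (\<integral>\<^sup>+z\<in>unit_disc. ennreal (G (J z)) \<partial>lborel)"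
    proof (rule nn_integral_mono_AE)
      show "AE z in lborel. \<Phi> (ennreal (dilatation \<mu> z)) * indicator unit_disc z \<le> ennreal (G (J z)) * indicator unit_disc z"
        using AE_lborel_singleton[of 0]
      proof eventually_elim
        case (elim z)
        have "\<Phi> (ennreal (dilatation \<mu> z)) = ennreal (enn2real (\<Phi> (ennreal (2 ^ J z))))"
          using L(1)[of "2 ^ J z"] dil[OF elim] by (simp add: K_def)
        also have "\<dots> \<le> ennreal (G (J z))" by (intro ennreal_leI) (simp add: G_def)
        finally show ?case by (rule mult_right_mono) simp
      qed
    qed
    also have "\<dots> < \<infinity>" using J by simp
    finally show ?thesis .
  qed
  ultimately obtain f where "homeo_ACL_solution \<mu> f" using assms(3) by blast
  moreover have "\<not> homeo_ACL_solution \<mu> f"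
    using J by (intro no_homeo_ACL_solution[OF Km K1]) (simp_all add: K_def \<mu>_def)
  ultimately show False by blast
qed

end
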